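(* Let $\Sigma$ be a complete properly immersed self-expander hypersurface in $\mathbb{R}^{n+1}$. Assume that its mean curvature $H$ satisfies $|H|(x)\le a|x|+b$ for all $x\in\Sigma$, for some constants $0\le a<\frac12$ and $b>0$. Then the bottom $\lambda_1$ of the spectrum of the drifted Laplacian $\mathcal{L}=\Delta+\frac12\langle x,\nabla\cdot\rangle$ on $\Sigma$, i.e. the first weighted $L^2$ eigenvalue of $\mathcal{L}$, satisfies $$\lambda_1\le\frac{(\alpha+1)n}{4}+\frac{(\alpha+1)\int_\Sigma\left(\frac12H^2-\frac{\alpha-1}{16}|x^T|^2\right)e^{-\frac\alpha4|x|^2}\,d\sigma}{\int_\Sigma e^{-\frac\alpha4|x|^2}\,d\sigma}$$ for all $\alpha>\frac{a^2}{\frac14-a^2}$.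
   Context: $x$ denotes the position vector, $x^T$ and $x^\perp$ its tangent and normal components along $\Sigma$. For an immersed hypersurface $\Sigma$ with induced metric, volume form $d\sigma$, gradient $\nabla$ and Laplacian $\Delta$, the mean curvature vector $\mathbf{H}$ is the trace of $A(X,Y)=(\overline\nabla_XY)^\perp$ ($\overline\nabla$ the Euclidean connection), and $\Sigma$ is a self-expander if $\mathbf{H}=\frac12x^\perp$. The mean curvature $H$ is defined by $\mathbf{H}=-H\mathbf{n}$, $\mathbf{n}$ the unit normal. $\Sigma$ is properly immersed if the preimage under the immersion of every compact subset of $\mathbb{R}^{n+1}$ is compact. The operator $\mathcal{L}$ is self-adjoint in $L^2(\Sigma,e^{\frac{|x|^2}{4}}d\sigma)$, and $$\lambda_1=\inf\left\{\frac{\int_\Sigma|\nabla\varphi|^2e^{\frac{|x|^2}{4}}d\sigma}{\int_\Sigma\varphi^2e^{\frac{|x|^2}{4}}d\sigma}:\ \varphi\in C_0^\infty(\Sigma),\ \int_\Sigma\varphi^2e^{\frac{|x|^2}{4}}d\sigma\ne0\right\}.$$ (Eigenvalues are those of $-\mathcal{L}$: $\mathcal{L}u+\lambda u=0$.) *)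

theory Defs
  imports "HOL-Analysis.Analysis"
begin

section \<open>Smooth maps between Euclidean spaces\<close>

text \<open>Both predicates are meant for open \<open>S\<close>, so that derivatives at points of \<open>S\<close> are
  unrestricted.\<close>

primrec Ck_on :: "nat \<Rightarrow> ('a::euclidean_space) set \<Rightarrow> ('a \<Rightarrow> 'b::real_normed_vector) \<Rightarrow> bool" where
  "Ck_on 0 S f \<longleftrightarrow> continuous_on S f"
| "Ck_on (Suc k) S f \<longleftrightarrow>
     (\<forall>x\<in>S. f differentiable (at x)) \<and>
     (\<forall>v. Ck_on k S (\<lambda>x. frechet_derivative f (at x) v))"

definition smooth_on :: "('a::euclidean_space) set \<Rightarrow> ('a \<Rightarrow> 'b::real_normed_vector) \<Rightarrow> bool" where
  "smooth_on S f \<longleftrightarrow> (\<forall>k. Ck_on k S f)"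


section \<open>Smooth manifolds\<close>

text \<open>The manifold is the whole type \<open>'m\<close>, assumed Hausdorff and second countable where it is used;
  a smooth structure of dimension \<open>CARD('n)\<close> is given by an atlas. A chart is a pair of an open
  domain and a coordinate map, whose values outside the domain are irrelevant.\<close>

type_synonym ('m, 'n) chart = "'m set \<times> ('m \<Rightarrow> real ^ 'n)"

definition chart_inv :: "('m, 'n::finite) chart \<Rightarrow> real ^ 'n \<Rightarrow> 'm" where
  "chart_inv c = inv_into (fst c) (snd c)"

definition is_chart :: "('m::topological_space, 'n::finite) chart \<Rightarrow> bool" where
  "is_chart c \<longleftrightarrow>
     open (fst c) \<and> open (snd c ` fst c) \<and>
     homeomorphism (fst c) (snd c ` fst c) (snd c) (chart_inv c)"

definition smooth_atlas :: "('m::topological_space, 'n::finite) chart set \<Rightarrow> bool" where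
  "smooth_atlas A \<longleftrightarrow>
     (\<forall>c\<in>A. is_chart c) \<and> (\<Union>c\<in>A. fst c) = UNIV \<and>
     (\<forall>c\<in>A. \<forall>d\<in>A. smooth_on (snd c ` (fst c \<inter> fst d)) (snd d \<circ> chart_inv c))"

definition smooth_map ::
  "('m::topological_space, 'n::finite) chart set \<Rightarrow> ('m \<Rightarrow> 'v::real_normed_vector) \<Rightarrow> bool" where
  "smooth_map A u \<longleftrightarrow> (\<forall>c\<in>A. smooth_on (snd c ` fst c) (u \<circ> chart_inv c))"

text \<open>The derivative at \<open>p\<close> of a vector-valued map \<open>Y\<close> in the direction of the tangent vector with
  coordinates \<open>v\<close> in the chart \<open>c\<close>. For \<open>Y\<close> a vector field along the immersion this is the
  Euclidean connection.\<close>

definition chart_deriv ::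
  "('m, 'n::finite) chart \<Rightarrow> ('m \<Rightarrow> 'v::real_normed_vector) \<Rightarrow> 'm \<Rightarrow> real ^ 'n \<Rightarrow> 'v" where
  "chart_deriv c Y p v = frechet_derivative (Y \<circ> chart_inv c) (at (snd c p)) v"

definition immersion ::
  "('m::topological_space, 'n::finite) chart set \<Rightarrow> ('m \<Rightarrow> 'v::real_normed_vector) \<Rightarrow> bool" where
  "immersion A F \<longleftrightarrow> smooth_map A F \<and> (\<forall>c\<in>A. \<forall>p\<in>fst c. inj (chart_deriv c F p))"

text \<open>Pointwise geometric quantities are computed in some chart around the point; they do not
  depend on its choice.\<close>

definition chart_at :: "('m, 'n::finite) chart set \<Rightarrow> 'm \<Rightarrow> ('m, 'n) chart" where
  "chart_at A p = (SOME c. c \<in> A \<and> p \<in> fst c)"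


section \<open>The induced metric\<close>

definition coord_field ::
  "('m, 'n::finite) chart \<Rightarrow> ('m \<Rightarrow> 'v::real_inner) \<Rightarrow> 'n \<Rightarrow> 'm \<Rightarrow> 'v" where
  "coord_field c F i p = chart_deriv c F p (axis i 1)"

definition metric_matrix ::
  "('m, 'n::finite) chart \<Rightarrow> ('m \<Rightarrow> 'v::real_inner) \<Rightarrow> 'm \<Rightarrow> real ^ 'n ^ 'n" where
  "metric_matrix c F p = (\<chi> i j. coord_field c F i p \<bullet> coord_field c F j p)"

definition tangent_space ::
  "('m, 'n::finite) chart set \<Rightarrow> ('m \<Rightarrow> 'v::real_inner) \<Rightarrow> 'm \<Rightarrow> 'v set" where
  "tangent_space A F p = range (chart_deriv (chart_at A p) F p)"

definition tangent_part ::
  "('m, 'n::finite) chart set \<Rightarrow> ('m \<Rightarrow> 'v::real_inner) \<Rightarrow> 'm \<Rightarrow> 'v \<Rightarrow> 'v" where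
  "tangent_part A F p v =
     (THE w. w \<in> tangent_space A F p \<and> (\<forall>z\<in>tangent_space A F p. orthogonal (v - w) z))"

definition normal_part ::
  "('m, 'n::finite) chart set \<Rightarrow> ('m \<Rightarrow> 'v::real_inner) \<Rightarrow> 'm \<Rightarrow> 'v \<Rightarrow> 'v" where
  "normal_part A F p v = v - tangent_part A F p v"

text \<open>The gradient \<open>g\<^sup>i\<^sup>j (\<partial>\<^sub>i u) \<partial>\<^sub>j\<close>, identified with its image under the differential of the
  immersion, so that its Riemannian norm is its Euclidean norm.\<close>

definition gradient ::
  "('m, 'n::finite) chart set \<Rightarrow> ('m \<Rightarrow> 'v::real_inner) \<Rightarrow> ('m \<Rightarrow> real) \<Rightarrow> 'm \<Rightarrow> 'v" where
  "gradient A F u p =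
     (let c = chart_at A p in
      \<Sum>i\<in>UNIV. \<Sum>j\<in>UNIV.
        (matrix_inv (metric_matrix c F p) $ i $ j * chart_deriv c u p (axis i 1))
          *\<^sub>R coord_field c F j p)"

text \<open>The Riemannian measure: the Borel measure that in every chart has density
  \<open>sqrt (det g)\<close> with respect to Lebesgue measure.\<close>

definition volume_measure ::
  "('m::topological_space, 'n::finite) chart set \<Rightarrow> ('m \<Rightarrow> 'v::real_inner) \<Rightarrow> 'm measure" where
  "volume_measure A F =
     (THE \<mu>. sets \<mu> = sets borel \<and>
        (\<forall>c\<in>A. \<forall>B\<in>sets borel. B \<subseteq> fst c \<longrightarrow>
           emeasure \<mu> B =
             (\<integral>\<^sup>+ y. ennreal (sqrt (det (metric_matrix c F (chart_inv c y))))
                     * indicator (snd c ` B) y \<partial>lborel)))"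


section \<open>Completeness and properness\<close>

definition piecewise_C1_curve ::
  "('m::topological_space, 'n::finite) chart set \<Rightarrow> (real \<Rightarrow> 'm) \<Rightarrow> bool" where
  "piecewise_C1_curve A \<gamma> \<longleftrightarrow>
     path \<gamma> \<and>
     (\<forall>c\<in>A. \<forall>s t. 0 \<le> s \<and> s < t \<and> t \<le> 1 \<and> \<gamma> ` {s..t} \<subseteq> fst c \<longrightarrow>
        (snd c \<circ> \<gamma>) piecewise_C1_differentiable_on {s..t})"

text \<open>The speed of a curve in the induced metric is the Euclidean speed of its image. Lengths are
  extended nonnegative reals because the library notion of piecewise \<open>C\<^sup>1\<close> does not bound the speed
  near the break points.\<close>

definition curve_length ::
  "('m \<Rightarrow> 'v::euclidean_space) \<Rightarrow> (real \<Rightarrow> 'm) \<Rightarrow> ennreal" where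
  "curve_length F \<gamma> =
     (\<integral>\<^sup>+ t. ennreal (norm (vector_derivative (F \<circ> \<gamma>) (at t))) * indicator {0..1} t \<partial>lborel)"

text \<open>The distance is infinite between different components.\<close>

definition riem_dist ::
  "('m::topological_space, 'n::finite) chart set \<Rightarrow> ('m \<Rightarrow> 'v::euclidean_space) \<Rightarrow>
     'm \<Rightarrow> 'm \<Rightarrow> ennreal" where
  "riem_dist A F p q =
     (INF \<gamma>\<in>{\<gamma>. piecewise_C1_curve A \<gamma> \<and> pathstart \<gamma> = p \<and> pathfinish \<gamma> = q}.
        curve_length F \<gamma>)"

definition riem_complete ::
  "('m::topological_space, 'n::finite) chart set \<Rightarrow> ('m \<Rightarrow> 'v::euclidean_space) \<Rightarrow> bool" where
  "riem_complete A F \<longleftrightarrow>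
     (\<forall>s :: nat \<Rightarrow> 'm.
        (\<forall>e>0. \<exists>N. \<forall>j\<ge>N. \<forall>k\<ge>N. riem_dist A F (s j) (s k) < e) \<longrightarrow>
        (\<exists>p. (\<lambda>k. riem_dist A F (s k) p) \<longlonglongrightarrow> 0))"

definition properly_immersed ::
  "('m::topological_space, 'n::finite) chart set \<Rightarrow> ('m \<Rightarrow> 'v::euclidean_space) \<Rightarrow> bool" where
  "properly_immersed A F \<longleftrightarrow> immersion A F \<and> (\<forall>K. compact K \<longrightarrow> compact (F -` K))"


section \<open>Mean curvature and self-expanders\<close>

definition second_fundamental_form ::
  "('m, 'n::finite) chart set \<Rightarrow> ('m \<Rightarrow> 'v::real_inner) \<Rightarrow> 'n \<Rightarrow> 'n \<Rightarrow> 'm \<Rightarrow> 'v" where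
  "second_fundamental_form A F i j p =
     (let c = chart_at A p in
      normal_part A F p (chart_deriv c (coord_field c F j) p (axis i 1)))"

definition mean_curvature_vector ::
  "('m, 'n::finite) chart set \<Rightarrow> ('m \<Rightarrow> 'v::real_inner) \<Rightarrow> 'm \<Rightarrow> 'v" where
  "mean_curvature_vector A F p =
     (\<Sum>i\<in>UNIV. \<Sum>j\<in>UNIV.
        matrix_inv (metric_matrix (chart_at A p) F p) $ i $ j
          *\<^sub>R second_fundamental_form A F i j p)"

definition self_expander ::
  "('m, 'n::finite) chart set \<Rightarrow> ('m \<Rightarrow> 'v::real_inner) \<Rightarrow> bool" where
  "self_expander A F \<longleftrightarrow>
     (\<forall>p. mean_curvature_vector A F p = (1/2) *\<^sub>R normal_part A F p (F p))"

text \<open>No continuity is asked of \<open>\<nu>\<close>: the sign of the mean curvature at a point depends on the choice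
  of the normal, its absolute value does not, and one-sided hypersurfaces are included.\<close>

definition unit_normal ::
  "('m, 'n::finite) chart set \<Rightarrow> ('m \<Rightarrow> 'v::real_inner) \<Rightarrow> ('m \<Rightarrow> 'v) \<Rightarrow> bool" where
  "unit_normal A F \<nu> \<longleftrightarrow>
     (\<forall>p. norm (\<nu> p) = 1 \<and> (\<forall>z\<in>tangent_space A F p. orthogonal (\<nu> p) z))"

definition mean_curvature ::
  "('m, 'n::finite) chart set \<Rightarrow> ('m \<Rightarrow> 'v::real_inner) \<Rightarrow> ('m \<Rightarrow> 'v) \<Rightarrow> 'm \<Rightarrow> real" where
  "mean_curvature A F \<nu> p = (THE h. mean_curvature_vector A F p = - (h *\<^sub>R \<nu> p))"


section \<open>The bottom of the spectrum\<close>

definition test_functions :: "('m::topological_space, 'n::finite) chart set \<Rightarrow> ('m \<Rightarrow> real) set" where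
  "test_functions A = {\<phi>. smooth_map A \<phi> \<and> compact (closure {p. \<phi> p \<noteq> 0})}"

text \<open>The first eigenvalue of \<open>- \<L>\<close>, for the drifted Laplacian \<open>\<L> = \<Delta> + \<langle>x, \<nabla> \<cdot>\<rangle> / 2\<close>, in
  the weighted space with weight \<open>exp (|x|\<^sup>2 / 4)\<close>.\<close>

definition lambda1 ::
  "('m::topological_space, 'n::finite) chart set \<Rightarrow> ('m \<Rightarrow> 'v::euclidean_space) \<Rightarrow> real" where
  "lambda1 A F =
     (let \<sigma> = volume_measure A F; w = (\<lambda>p. exp ((norm (F p))\<^sup>2 / 4)) in
      Inf {(LINT p|\<sigma>. (norm (gradient A F \<phi> p))\<^sup>2 * w p) / (LINT p|\<sigma>. (\<phi> p)\<^sup>2 * w p) | \<phi>.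
             \<phi> \<in> test_functions A \<and> (LINT p|\<sigma>. (\<phi> p)\<^sup>2 * w p) \<noteq> 0})"

end

theory Submission
  imports Defs
begin

text \<open>Write \<open>s = |x|\<^sup>2\<close> and \<open>q = |x\<^sup>T|\<^sup>2\<close>. On a self-expander \<open>\<langle>\<^bold>H, x\<rangle> = (s - q) / 2\<close> and
  \<open>4 H\<^sup>2 = s - q\<close>, so the divergence theorem for the field \<open>u x\<^sup>T\<close> reads
  \<open>\<integral> u (n + (s - q) / 2) + \<langle>\<nabla>u, x\<rangle> = 0\<close>. For \<open>u = \<eta>(s) exp (- \<alpha> s / 4)\<close> with a nonincreasing cutoff
  \<open>\<eta>\<close> the term containing \<open>\<eta>'\<close> has a sign. Together with the bound on \<open>H\<close>, which makes
  \<open>\<alpha> q - 4 H\<^sup>2 - 2 n\<close> grow like a positive multiple of \<open>s\<close>, this first gives the integrability of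
  \<open>(1 + s) exp (- \<alpha> s / 4)\<close> and then, in the limit,
  \<open>\<integral> (2 n + 4 H\<^sup>2 - \<alpha> q) exp (- \<alpha> s / 4) \<ge> 0\<close>. The test functions \<open>\<eta>(s) exp (- (\<alpha> + 1) s / 8)\<close> give
  \<open>\<lambda>\<^sub>1 \<le> ((\<alpha> + 1)\<^sup>2 / 16) \<integral> q exp (- \<alpha> s / 4) / \<integral> exp (- \<alpha> s / 4)\<close>, and the previous inequality
  turns this into the claim.\<close>

section \<open>Functions of class \<open>C\<^sup>k\<close>\<close>

text \<open>Nothing is known in advance about the volume growth of \<Sigma>: properness only makes
  the volume of each set |x| \<le> r finite. The finiteness of the weighted integrals has to be
  extracted from the divergence theorem itself, which is why the sign of the cutoff term is
  essential and why the growth of H enters. Since s - q = 4 H^2 \<le> 4 (a sqrt s + b)^2, the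
  function \<alpha> q - 4 H^2 = \<alpha> s - (\<alpha> + 1) (s - q) has leading coefficient at least
  \<alpha> - 4 a^2 (\<alpha> + 1) in s, and the lower bound imposed on \<alpha> says exactly that
  this number is positive. The analysis sees the hypersurface only through a measure and the two
  functions s and q; the locale \<open>weighted_estimate\<close> separates it from the geometry. On
  the geometric side the gradient and the mean curvature vector are read off in a chosen chart and
  the volume is a definite description. Independence of the chart, and existence and uniqueness of
  the measure, must therefore be settled before the integrals can be localized to charts.\<close>

lemma Ck_on_cong:
  assumes "open S" "\<And>x. x \<in> S \<Longrightarrow> f x = g x"
  shows "Ck_on k S f \<longleftrightarrow> Ck_on k S g"
proof -
  have "Ck_on k S f \<Longrightarrow> Ck_on k S g" if "\<And>x. x \<in> S \<Longrightarrow> f x = g x" for f g :: "'a \<Rightarrow> 'b"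
    using that
  proof (induction k arbitrary: f g)
    case 0
    then show ?case using continuous_on_cong[of S S f g] by simp
  next
    case (Suc k)
    have d: "(g has_derivative frechet_derivative f (at x)) (at x)" if "x \<in> S" for x
      by (rule has_derivative_transform_within_open[where f = f, OF _ assms(1) that])
        (use Suc.prems that in \<open>auto simp: frechet_derivative_works[symmetric]\<close>)
    have eq: "frechet_derivative f (at x) = frechet_derivative g (at x)" if "x \<in> S" for x
      by (rule frechet_derivative_at[OF d[OF that]])
    have "Ck_on k S (\<lambda>x. frechet_derivative g (at x) v)" for v
      by (rule Suc.IH[of "\<lambda>x. frechet_derivative f (at x) v"]) (use Suc.prems eq in simp_all)
    moreover have "g differentiable (at x)" if "x \<in> S" for x
      using d[OF that] by (auto simp: differentiable_def)
    ultimately show ?case by simp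
  qed
  from this[of f g] this[of g f] assms(2) show ?thesis by metis
qed

text \<open>\<open>Ck_on\<close> is phrased with \<open>frechet_derivative\<close>; this rule
  accepts an explicit formula for the derivative instead.\<close>

lemma Ck_on_SucI:
  assumes "open S" "\<And>x. x \<in> S \<Longrightarrow> (f has_derivative f' x) (at x)"
    and "\<And>v. Ck_on k S (\<lambda>x. f' x v)"
  shows "Ck_on (Suc k) S f"
proof -
  have "Ck_on k S (\<lambda>x. frechet_derivative f (at x) v)" for v
    using assms(3)[of v] frechet_derivative_at[OF assms(2)]
    by (subst Ck_on_cong[OF assms(1), of _ "\<lambda>x. f' x v"]) auto
  then show ?thesis
    using assms(2) by (auto simp: differentiable_def)
qed

lemma Ck_on_SucD:
  assumes "Ck_on (Suc k) S f" "x \<in> S"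
  shows "(f has_derivative frechet_derivative f (at x)) (at x)"
  using assms by (simp add: frechet_derivative_works[symmetric])

lemma Ck_on_Suc_imp:
  "Ck_on (Suc k) S f \<Longrightarrow> Ck_on k S f"
proof (induction k arbitrary: f)
  case 0
  then show ?case
    by (auto intro!: differentiable_imp_continuous_on
        simp: differentiable_on_def differentiable_at_withinI)
qed auto

lemma Ck_on_imp_continuous_on: "Ck_on k S f \<Longrightarrow> continuous_on S f"
  by (induction k) (auto dest: Ck_on_Suc_imp simp del: Ck_on.simps(2))

lemma Ck_on_subset: "Ck_on k S f \<Longrightarrow> T \<subseteq> S \<Longrightarrow> Ck_on k T f"
  by (induction k arbitrary: f) (auto intro: continuous_on_subset)

text \<open>Serves to glue a function with compact support in an open set to the zero function on
  the complement of the support.\<close>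

lemma Ck_on_Un:
  "open S \<Longrightarrow> open T \<Longrightarrow> Ck_on k S f \<Longrightarrow> Ck_on k T f \<Longrightarrow> Ck_on k (S \<union> T) f"
  by (induction k arbitrary: f) (auto intro: continuous_on_open_Un)

lemma Ck_on_const [simp]: "open S \<Longrightarrow> Ck_on k S (\<lambda>x. c)"
  by (induction k arbitrary: c) auto

lemma Ck_on_add:
  "open S \<Longrightarrow> Ck_on k S f \<Longrightarrow> Ck_on k S g \<Longrightarrow> Ck_on k S (\<lambda>x. f x + g x)"
proof (induction k arbitrary: f g)
  case (Suc k)
  show ?case
    by (rule Ck_on_SucI[OF Suc.prems(1) has_derivative_add[OF Ck_on_SucD Ck_on_SucD]])
      (use Suc in auto)
qed (simp add: continuous_on_add)

text \<open>The product rule gives two terms of the same shape, so the induction hypothesis applies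
  to each. One statement covers products, scalings and inner products.\<close>

lemma Ck_on_bilinear:
  assumes "bounded_bilinear B" "open S" "Ck_on k S f" "Ck_on k S g"
  shows "Ck_on k S (\<lambda>x. B (f x) (g x))"
  using assms(3,4)
proof (induction k arbitrary: f g)
  case 0
  then show ?case by (simp add: bounded_bilinear.continuous_on[OF assms(1)])
next
  case (Suc k)
  show ?case
  proof (rule Ck_on_SucI[OF assms(2) bounded_bilinear.FDERIV[OF assms(1) Ck_on_SucD Ck_on_SucD]])
    fix v
    show "Ck_on k S (\<lambda>x. B (f x) (frechet_derivative g (at x) v) + B (frechet_derivative f (at x) v) (g x))"
      using Suc.prems Ck_on_Suc_imp[OF Suc.prems(1)] Ck_on_Suc_imp[OF Suc.prems(2)]
      by (intro Ck_on_add Suc.IH assms) auto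
  qed (use Suc in auto)
qed

lemma Ck_on_sum:
  "open S \<Longrightarrow> (\<And>i. i \<in> I \<Longrightarrow> Ck_on k S (f i)) \<Longrightarrow> Ck_on k S (\<lambda>x. \<Sum>i\<in>I. f i x)"
  by (induction I rule: infinite_finite_induct) (auto intro: Ck_on_add)

lemmas Ck_on_mult = Ck_on_bilinear[OF bounded_bilinear_mult]
lemmas Ck_on_scaleR = Ck_on_bilinear[OF bounded_bilinear_scaleR]
lemmas Ck_on_inner = Ck_on_bilinear[OF bounded_bilinear_inner]

lemma Ck_on_prod:
  fixes f :: "_ \<Rightarrow> _ \<Rightarrow> real"
  shows "open S \<Longrightarrow> (\<And>i. i \<in> I \<Longrightarrow> Ck_on k S (f i)) \<Longrightarrow> Ck_on k S (\<lambda>x. \<Prod>i\<in>I. f i x)"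
  by (induction I rule: infinite_finite_induct) (auto intro: Ck_on_mult)

lemma Ck_on_minus:
  fixes f g :: "_ \<Rightarrow> real"
  assumes "open S" "Ck_on k S f" "Ck_on k S g"
  shows "Ck_on k S (\<lambda>x. f x - g x)"
  using Ck_on_add[OF assms(1,2) Ck_on_mult[OF assms(1) Ck_on_const[OF assms(1), of k "-1"] assms(3)]]
  by simp

text \<open>The derivative of 1/f is a polynomial in 1/f and the derivative of f, and 1/f itself is
  covered by the induction hypothesis. The square root and the exponential are treated by the same
  bootstrapping.\<close>

lemma Ck_on_inverse:
  fixes f :: "_ \<Rightarrow> real"
  assumes "open S" "Ck_on k S f" "\<And>x. x \<in> S \<Longrightarrow> f x \<noteq> 0"
  shows "Ck_on k S (\<lambda>x. inverse (f x))"
  using assms(2)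
proof (induction k)
  case (Suc k)
  note IH = Suc.IH[OF Ck_on_Suc_imp[OF Suc.prems]]
  show ?case
  proof (rule Ck_on_SucI[OF assms(1) Deriv.has_derivative_inverse[OF _ Ck_on_SucD[OF Suc.prems]]])
    fix v
    show "Ck_on k S (\<lambda>x. - (inverse (f x) * frechet_derivative f (at x) v * inverse (f x)))"
      using Ck_on_mult[OF assms(1) Ck_on_const[OF assms(1), of k "-1"]
          Ck_on_mult[OF assms(1) Ck_on_mult[OF assms(1) IH, of "\<lambda>x. frechet_derivative f (at x) v"] IH]]
        Suc.prems by simp
  qed (use assms in auto)
qed (use assms(3) in \<open>auto intro!: continuous_intros\<close>)

lemma Ck_on_divide:
  fixes f :: "_ \<Rightarrow> real"
  assumes "open S" "Ck_on k S f" "Ck_on k S g" "\<And>x. x \<in> S \<Longrightarrow> g x \<noteq> 0"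
  shows "Ck_on k S (\<lambda>x. f x / g x)"
  unfolding divide_inverse by (intro Ck_on_mult Ck_on_inverse assms)

lemma Ck_on_sqrt:
  fixes f :: "_ \<Rightarrow> real"
  assumes "open S" "Ck_on k S f" "\<And>x. x \<in> S \<Longrightarrow> f x > 0"
  shows "Ck_on k S (\<lambda>x. sqrt (f x))"
  using assms(2)
proof (induction k)
  case (Suc k)
  note IH = Suc.IH[OF Ck_on_Suc_imp[OF Suc.prems]]
  show ?case
  proof (rule Ck_on_SucI[OF assms(1)])
    fix x assume "x \<in> S"
    show "((\<lambda>x. sqrt (f x)) has_derivative
        (\<lambda>v. frechet_derivative f (at x) v * (inverse (sqrt (f x)) / 2))) (at x)"
      by (rule has_derivative_real_sqrt[OF _ Ck_on_SucD[OF Suc.prems \<open>x \<in> S\<close>], THEN has_derivative_eq_rhs])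
        (use assms(3)[OF \<open>x \<in> S\<close>] in auto)
  next
    fix v
    show "Ck_on k S (\<lambda>x. frechet_derivative f (at x) v * (inverse (sqrt (f x)) / 2))"
      using Suc.prems assms(3) by (intro Ck_on_mult Ck_on_divide Ck_on_inverse Ck_on_const assms IH) force+
  qed
qed (auto intro!: continuous_intros)

lemma Ck_on_exp:
  fixes f :: "_ \<Rightarrow> real"
  assumes "open S" "Ck_on k S f"
  shows "Ck_on k S (\<lambda>x. exp (f x))"
  using assms(2)
proof (induction k)
  case (Suc k)
  note IH = Suc.IH[OF Ck_on_Suc_imp[OF Suc.prems]]
  show ?case
    by (rule Ck_on_SucI[OF assms(1) has_derivative_exp[OF Ck_on_SucD[OF Suc.prems]]])
      (use Suc.prems in \<open>auto intro!: Ck_on_mult assms IH\<close>)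
qed (auto intro!: continuous_intros)

text \<open>The functions \<open>bump m t = t\<^sup>-\<^sup>m exp (-1/t)\<close> are closed under differentiation, which makes
  the flat function \<open>bump 0\<close> smooth.\<close>

definition bump :: "nat \<Rightarrow> real \<Rightarrow> real" where
  "bump m t = (if t > 0 then (1 / t) ^ m * exp (- 1 / t) else 0)"

text \<open>The substitution x = 1/t turns the right-hand limit into the decay of x^m / exp x at
  infinity.\<close>

lemma bump_tendsto_0: "(bump m \<longlongrightarrow> 0) (at 0)"
proof -
  have "((\<lambda>t. (1 / t) ^ m * exp (- 1 / t)) \<longlongrightarrow> 0) (at_right (0::real))"
  proof -
    have "((\<lambda>x. x ^ m / exp x) \<longlongrightarrow> 0) (at_top :: real filter)"
      by (rule tendsto_power_div_exp_0)
    then have "((\<lambda>t. inverse t ^ m / exp (inverse t)) \<longlongrightarrow> 0) (at_right (0::real))"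
      by (rule filterlim_compose[OF _ filterlim_inverse_at_top_right])
    then show ?thesis by (simp add: exp_minus field_simps)
  qed
  then have "(bump m \<longlongrightarrow> 0) (at_right 0)"
    by (rule Lim_transform_eventually) (auto simp: eventually_at_filter bump_def)
  moreover have "(bump m \<longlongrightarrow> 0) (at_left 0)"
    by (rule tendsto_eventually) (auto simp: eventually_at_filter bump_def)
  ultimately show ?thesis by (simp add: filterlim_split_at)
qed

lemma has_real_derivative_bump:
  "(bump m has_real_derivative bump (m + 2) t - m * bump (m + 1) t) (at t)"
proof -
  consider "t > 0" | "t < 0" | "t = 0" by linarith
  then show ?thesis
  proof cases
    case 1
    have aux: "t * t ^ (k - Suc 0) = t ^ k" if "k \<noteq> 0" for k
      using that by (cases k) auto
    have "((\<lambda>t. (1 / t) ^ m * exp (- 1 / t)) has_real_derivative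
       bump (m + 2) t - m * bump (m + 1) t) (at t)"
      using 1 by (cases m)
        (auto intro!: derivative_eq_intros simp: bump_def field_simps power2_eq_square, metis aux)
    then show ?thesis
      by (rule has_field_derivative_transform_within_open[of _ _ _ "{0<..}"]) (use 1 in \<open>auto simp: bump_def\<close>)
  next
    case 2
    have "((\<lambda>t. 0) has_real_derivative bump (m + 2) t - m * bump (m + 1) t) (at t)"
      using 2 by (simp add: bump_def)
    then show ?thesis
      by (rule has_field_derivative_transform_within_open[of _ _ _ "{..<0}"]) (use 2 in \<open>auto simp: bump_def\<close>)
  next
    case 3
    \<comment> \<open>The difference quotient of \<open>bump m\<close> at 0 is
      \<open>bump (Suc m)\<close>, whose limit is already known.\<close>
    have "((\<lambda>h. (bump m (0 + h) - bump m 0) / h) \<longlongrightarrow> 0) (at 0)"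
      by (rule Lim_transform_eventually[OF bump_tendsto_0[of "Suc m"]])
        (auto simp: eventually_at_filter bump_def)
    then show ?thesis using 3 by (simp add: DERIV_def) (simp add: bump_def)
  qed
qed

lemma Ck_on_bump:
  assumes "open S" "Ck_on k S f"
  shows "Ck_on k S (\<lambda>x. bump m (f x))"
  using assms(2)
proof (induction k arbitrary: m)
  case 0
  have "continuous_on UNIV (bump m)"
    using has_real_derivative_bump by (intro continuous_at_imp_continuous_on) (auto intro: DERIV_isCont)
  then show ?case using 0 continuous_on_compose2 by (auto; blast)
next
  case (Suc k)
  note IH = Suc.IH[OF Ck_on_Suc_imp[OF Suc.prems]]
  show ?case
  proof (rule Ck_on_SucI[OF assms(1)])
    fix x assume "x \<in> S"
    show "((\<lambda>x. bump m (f x)) has_derivative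
       (\<lambda>v. (bump (m + 2) (f x) - m * bump (m + 1) (f x)) * frechet_derivative f (at x) v)) (at x)"
      using has_derivative_compose[OF Ck_on_SucD[OF Suc.prems \<open>x \<in> S\<close>]
          has_real_derivative_bump[of m "f x", unfolded has_field_derivative_def]] by simp
  next
    fix v
    show "Ck_on k S (\<lambda>x. (bump (m + 2) (f x) - m * bump (m + 1) (f x)) * frechet_derivative f (at x) v)"
      using Suc.prems by (intro Ck_on_mult Ck_on_minus Ck_on_const assms IH) auto
  qed
qed

section \<open>Change of variables for Borel sets\<close>

text \<open>The library proves the change of variables formula only for index types of class
  \<open>wellorder\<close>. Every finite index type is therefore replaced by the well-ordered type \<open>'n rank\<close> of
  the same cardinality.\<close>

typedef (overloaded) ('n::finite) rank = "{..<CARD('n)}"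
  by (rule exI[of _ 0]) simp

instantiation rank :: (finite) wellorder
begin

definition less_eq_rank :: "'a rank \<Rightarrow> 'a rank \<Rightarrow> bool" where
  "x \<le> y \<longleftrightarrow> Rep_rank x \<le> Rep_rank y"

definition less_rank :: "'a rank \<Rightarrow> 'a rank \<Rightarrow> bool" where
  "x < y \<longleftrightarrow> Rep_rank x < Rep_rank y"

instance
proof
  fix P :: "'a rank \<Rightarrow> bool" and a
  assume step: "\<And>x. (\<And>y. y < x \<Longrightarrow> P y) \<Longrightarrow> P x"
  show "P a"
    by (induction a rule: measure_induct_rule[of Rep_rank]) (auto intro: step simp: less_rank_def)
qed (auto simp: less_eq_rank_def less_rank_def Rep_rank_inject)

end

instance rank :: (finite) finite
proof
  have "(UNIV :: 'a rank set) = Abs_rank ` {..<CARD('a)}"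
    by (rule type_definition.Abs_image[OF type_definition_rank, symmetric])
  then show "finite (UNIV :: 'a rank set)"
    by (metis finite_imageI finite_lessThan)
qed

lemma card_rank: "CARD('n::finite rank) = CARD('n)"
  using type_definition.card[OF type_definition_rank[where 'n = 'n]] by simp

definition to_rank :: "'n::finite \<Rightarrow> 'n rank" where
  "to_rank = (SOME f. bij f)"

lemma bij_to_rank: "bij (to_rank :: 'n::finite \<Rightarrow> 'n rank)"
proof -
  have "\<exists>f :: 'n \<Rightarrow> 'n rank. bij f"
    by (intro finite_same_card_bij) (simp_all add: card_rank)
  then show ?thesis unfolding to_rank_def by (rule someI_ex)
qed

definition of_rank :: "'n::finite rank \<Rightarrow> 'n" where
  "of_rank = inv to_rank"

lemma of_rank_to_rank [simp]: "of_rank (to_rank i) = i"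
  and to_rank_of_rank [simp]: "to_rank (of_rank k) = k"
  by (simp_all add: of_rank_def inv_f_f[OF bij_is_inj[OF bij_to_rank]]
      surj_f_inv_f[OF bij_is_surj[OF bij_to_rank]])

lemma bij_of_rank: "bij (of_rank :: 'n::finite rank \<Rightarrow> 'n)"
  by (metis bij_to_rank bij_imp_bij_inv of_rank_def)

definition reindex :: "real ^ 'n::finite \<Rightarrow> real ^ 'n rank" where
  "reindex x = (\<chi> i. x $ of_rank i)"

definition unreindex :: "real ^ 'n::finite rank \<Rightarrow> real ^ 'n" where
  "unreindex x = (\<chi> i. x $ to_rank i)"

lemma unreindex_reindex [simp]: "unreindex (reindex x) = x"
  and reindex_unreindex [simp]: "reindex (unreindex y) = y"
  by (simp_all add: reindex_def unreindex_def)

lemma bounded_linear_reindex: "bounded_linear reindex"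
  by (intro linear_conv_bounded_linear[THEN iffD1] linearI)
    (auto simp: reindex_def vec_eq_iff)

lemma bounded_linear_unreindex: "bounded_linear unreindex"
  by (intro linear_conv_bounded_linear[THEN iffD1] linearI)
    (auto simp: unreindex_def vec_eq_iff)

lemma continuous_on_reindex: "continuous_on S reindex"
  by (rule linear_continuous_on[OF bounded_linear_reindex])

lemma continuous_on_unreindex: "continuous_on S unreindex"
  by (rule linear_continuous_on[OF bounded_linear_unreindex])

lemma measurable_reindex [measurable]: "reindex \<in> borel \<rightarrow>\<^sub>M borel"
  by (intro borel_measurable_continuous_onI continuous_on_reindex)

lemma measurable_unreindex [measurable]: "unreindex \<in> borel \<rightarrow>\<^sub>M borel"
  by (intro borel_measurable_continuous_onI continuous_on_unreindex)

lemma prod_Basis_vec: "(\<Prod>b\<in>(Basis :: (real ^ 'n::finite) set). f b) = (\<Prod>i\<in>UNIV. f (axis i 1))"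
proof -
  have eq: "(Basis :: (real ^ 'n) set) = (\<lambda>i. axis i 1) ` UNIV"
    by (auto simp: Basis_vec_def)
  show ?thesis
    unfolding eq by (subst prod.reindex) (auto simp: inj_on_def axis_eq_axis)
qed

text \<open>A renaming of the coordinates maps boxes to boxes with the same side lengths, and
  Lebesgue measure is determined by its values on boxes.\<close>

lemma distr_reindex: "distr lborel borel reindex = (lborel :: (real ^ 'n::finite rank) measure)"
proof (rule lborel_eqI[symmetric])
  fix l u :: "real ^ 'n rank"
  assume le: "\<And>b. b \<in> Basis \<Longrightarrow> l \<bullet> b \<le> u \<bullet> b"
  have le': "l $ k \<le> u $ k" for k
    using le[of "axis k 1"] by (simp add: inner_axis axis_in_Basis_iff)
  have "reindex -` box l u = box (unreindex l) (unreindex u)"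
    by (auto simp: mem_box_cart reindex_def unreindex_def) (metis to_rank_of_rank of_rank_to_rank)+
  moreover have "emeasure lborel (box (unreindex l) (unreindex u)) =
      (\<Prod>b\<in>Basis. (unreindex u - unreindex l) \<bullet> b)"
    using le' by (intro emeasure_lborel_box) (auto simp: Basis_vec_def inner_axis unreindex_def)
  moreover have "(\<Prod>b\<in>Basis. (unreindex u - unreindex l) \<bullet> b) = (\<Prod>b\<in>Basis. (u - l) \<bullet> b)"
    unfolding prod_Basis_vec
    using prod.reindex_bij_betw[OF bij_to_rank, of "\<lambda>k. (u - l) $ k"]
    by (simp add: inner_axis unreindex_def)
  ultimately show "emeasure (distr lborel borel reindex) (box l u) = (\<Prod>b\<in>Basis. (u - l) \<bullet> b)"
    by (subst emeasure_distr) auto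
qed simp

text \<open>Conjugation by the bijection of the index types matches the two Leibniz sums; it
  preserves signs.\<close>

lemma det_reindex:
  fixes A :: "real ^ 'n::finite ^ 'n"
  shows "det (\<chi> i j. A $ of_rank i $ of_rank j) = det A"
proof -
  have inj: "inj_on (to_rank :: 'n \<Rightarrow> _) UNIV" "inj_on (of_rank :: _ \<Rightarrow> 'n) UNIV"
    by (rule bij_is_inj[OF bij_to_rank] bij_is_inj[OF bij_of_rank])+
  have bij: "bij_betw (to_rank :: 'n \<Rightarrow> _) UNIV UNIV" "bij_betw (of_rank :: _ \<Rightarrow> 'n) UNIV UNIV"
    by (rule bij_to_rank bij_of_rank)+
  have "(\<Sum>p | p permutes UNIV. of_int (sign p) * (\<Prod>i\<in>UNIV. A $ i $ p i)) =
    (\<Sum>p | p permutes (UNIV :: 'n rank set). of_int (sign p) *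
      (\<Prod>i\<in>UNIV. A $ of_rank i $ of_rank (p i)))"
  proof (rule sum.reindex_bij_witness[where j = "map_permutation UNIV to_rank"
        and i = "map_permutation UNIV of_rank"])
    fix p :: "'n \<Rightarrow> 'n" assume p: "p \<in> {p. p permutes UNIV}"
    show "map_permutation UNIV of_rank (map_permutation UNIV to_rank p) = p"
      using p by (intro map_permutation_compose_inv[OF bij(1)]) auto
    show "map_permutation UNIV to_rank p \<in> {p. p permutes UNIV}"
      using map_permutation_permutes[OF bij(1)] p by simp
    have "(\<Prod>i\<in>UNIV. A $ of_rank i $ of_rank (map_permutation UNIV to_rank p i)) = (\<Prod>i\<in>UNIV. A $ i $ p i)"
      using prod.reindex_bij_betw[OF bij(1),
          of "\<lambda>i. A $ of_rank i $ of_rank (map_permutation UNIV to_rank p i)"]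
      by (simp add: map_permutation_apply[OF inj(1)])
    moreover have "sign (map_permutation UNIV to_rank p) = sign p"
      using p by (intro sign_map_permutation inj) auto
    ultimately show "of_int (sign (map_permutation UNIV to_rank p)) *
        (\<Prod>i\<in>UNIV. A $ of_rank i $ of_rank (map_permutation UNIV to_rank p i)) =
        of_int (sign p) * (\<Prod>i\<in>UNIV. A $ i $ p i)" by simp
  next
    fix p :: "'n rank \<Rightarrow> 'n rank" assume p: "p \<in> {p. p permutes UNIV}"
    show "map_permutation UNIV to_rank (map_permutation UNIV of_rank p) = p"
      using p by (intro map_permutation_compose_inv[OF bij(2)]) auto
    show "map_permutation UNIV of_rank p \<in> {p. p permutes UNIV}"
      using map_permutation_permutes[OF bij(2)] p by simp
  qed
  then show ?thesis by (simp add: det_def)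
qed

text \<open>\<open>has_measure_differentiable_image\<close> is an equivalence about finite measures
  and gauge integrals. If the nonnegative integral is finite, it yields the measure of the image; if
  it is infinite, the same equivalence rules out a finite measure for the image.\<close>

lemma emeasure_differentiable_image_wellorder:
  fixes \<tau> :: "real ^ 'n::{finite,wellorder} \<Rightarrow> real ^ 'n::_"
  assumes der: "\<And>x. x \<in> B \<Longrightarrow> (\<tau> has_derivative \<tau>' x) (at x)"
    and inj: "inj_on \<tau> B"
    and cont: "continuous_on B (\<lambda>x. det (matrix (\<tau>' x)))"
    and B: "B \<in> sets borel" "\<tau> ` B \<in> sets borel"
  shows "emeasure lborel (\<tau> ` B) = (\<integral>\<^sup>+ y. ennreal \<bar>det (matrix (\<tau>' y))\<bar> * indicator B y \<partial>lborel)"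
proof -
  let ?d = "\<lambda>y. \<bar>det (matrix (\<tau>' y))\<bar>"
  let ?f = "\<lambda>y. if y \<in> B then ?d y else 0"
  have B': "B \<in> sets lebesgue" "\<tau> ` B \<in> sets lebesgue"
    using B by auto
  note iff = has_measure_differentiable_image[OF B'(1) has_derivative_at_withinI[OF der] inj]
  have "(\<lambda>y. indicator B y *\<^sub>R ?d y) \<in> borel_measurable borel"
    using cont by (intro borel_measurable_continuous_on_indicator B continuous_on_rabs)
  also have "(\<lambda>y. indicator B y *\<^sub>R ?d y) = ?f" by (auto simp: indicator_def)
  finally have m: "?f \<in> borel_measurable borel" .
  have eq: "(\<integral>\<^sup>+ y. ennreal (?d y) * indicator B y \<partial>lborel) = (\<integral>\<^sup>+ y. ennreal (?f y) \<partial>lborel)"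
    by (intro nn_integral_cong) (auto simp: indicator_def)
  have em: "emeasure lborel (\<tau> ` B) = emeasure lebesgue (\<tau> ` B)"
    using B by simp
  show ?thesis
  proof (cases "(\<integral>\<^sup>+ y. ennreal (?f y) \<partial>lborel)")
    case (real r)
    then have "(?f has_integral r) UNIV"
      using m by (intro nn_integral_has_integral) auto
    then have "(?d has_integral r) B"
      by (simp add: has_integral_restrict_UNIV)
    then have "\<tau> ` B \<in> lmeasurable" "measure lebesgue (\<tau> ` B) = r"
      using iff[of r] by auto
    then have "emeasure lborel (\<tau> ` B) = ennreal r"
      unfolding em by (simp add: emeasure_eq_measure2)
    then show ?thesis using eq real by simp
  next
    case top
    have "\<tau> ` B \<notin> lmeasurable"
    proof
      assume "\<tau> ` B \<in> lmeasurable"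
      then have "(?d has_integral measure lebesgue (\<tau> ` B)) B"
        using iff by blast
      then have "(?f has_integral measure lebesgue (\<tau> ` B)) UNIV"
        by (simp add: has_integral_restrict_UNIV)
      then have "(\<integral>\<^sup>+ y. ennreal (?f y) \<partial>lborel) = ennreal (measure lebesgue (\<tau> ` B))"
        using m by (intro nn_integral_has_integral_lborel) auto
      with top show False by simp
    qed
    then have "emeasure lebesgue (\<tau> ` B) = \<infinity>"
      using B' by (auto simp: fmeasurable_def less_top[symmetric] simp del: emeasure_completion)
    then show ?thesis using eq top em by simp
  qed
qed

lemma matrix_reindex:
  assumes "linear L"
  shows "matrix (\<lambda>v. reindex (L (unreindex v))) = (\<chi> i j. matrix L $ of_rank i $ of_rank j)"
proof -
  have "unreindex (axis j 1) = axis (of_rank j) 1" for j :: "'a rank"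
    by (auto simp: unreindex_def vec_eq_iff axis_def)
  then show ?thesis
    by (simp add: matrix_def reindex_def)
qed

lemma emeasure_differentiable_image:
  fixes \<tau> :: "real ^ 'n::finite \<Rightarrow> real ^ 'n"
  assumes der: "\<And>x. x \<in> B \<Longrightarrow> (\<tau> has_derivative \<tau>' x) (at x)"
    and inj: "inj_on \<tau> B"
    and cont: "continuous_on B (\<lambda>x. det (matrix (\<tau>' x)))"
    and B: "B \<in> sets borel" "\<tau> ` B \<in> sets borel"
  shows "emeasure lborel (\<tau> ` B) = (\<integral>\<^sup>+ y. ennreal \<bar>det (matrix (\<tau>' y))\<bar> * indicator B y \<partial>lborel)"
proof -
  let ?R = "reindex :: real ^ 'n \<Rightarrow> _" and ?D = "unreindex :: _ \<Rightarrow> real ^ 'n"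
  let ?t = "\<lambda>y. ?R (\<tau> (?D y))"
  let ?t' = "\<lambda>y v. ?R (\<tau>' (?D y) (?D v))"
  have vim: "?R ` C = ?D -` C" for C
    by (auto simp: image_iff) (metis reindex_unreindex)
  have meas: "?R ` C \<in> sets borel" if "C \<in> sets borel" for C
    unfolding vim using measurable_sets[OF measurable_unreindex that] by simp
  have em: "emeasure lborel (?R ` C) = emeasure lborel C" if "C \<in> sets borel" for C
  proof -
    have "emeasure lborel (?R ` C) = emeasure (distr lborel borel ?R) (?R ` C)"
      by (simp add: distr_reindex)
    also have "\<dots> = emeasure lborel (?R -` (?R ` C))"
      using meas[OF that] by (subst emeasure_distr) auto
    also have "?R -` (?R ` C) = C"
      by (auto simp: vim)
    finally show ?thesis .
  qed
  have det: "det (matrix (?t' y)) = det (matrix (\<tau>' (?D y)))" if "?D y \<in> B" for y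
  proof -
    have "linear (\<tau>' (?D y))" using der[OF that] by (rule has_derivative_linear)
    from matrix_reindex[OF this] show ?thesis by (simp add: det_reindex)
  qed
  have "emeasure lborel (\<tau> ` B) = emeasure lborel (?t ` (?R ` B))"
    using em[OF B(2)] by (simp add: image_image)
  also have "\<dots> = (\<integral>\<^sup>+ y. ennreal \<bar>det (matrix (?t' y))\<bar> * indicator (?R ` B) y \<partial>lborel)"
  proof (rule emeasure_differentiable_image_wellorder)
    show "(?t has_derivative ?t' x) (at x)" if "x \<in> ?R ` B" for x
    proof -
      have x: "?D x \<in> B" using that by auto
      have "((\<lambda>x. \<tau> (?D x)) has_derivative (\<lambda>v. \<tau>' (?D x) (?D v))) (at x)"
        by (rule has_derivative_compose[OF bounded_linear_imp_has_derivative[OF bounded_linear_unreindex] der[OF x]])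
      then show ?thesis
        by (rule bounded_linear.has_derivative[OF bounded_linear_reindex])
    qed
    show "inj_on ?t (?R ` B)"
      using inj by (auto simp: inj_on_def) (metis unreindex_reindex)
    have "continuous_on (?R ` B) (\<lambda>y. det (matrix (\<tau>' (?D y))))"
      by (rule continuous_on_compose2[OF cont continuous_on_unreindex]) auto
    then show "continuous_on (?R ` B) (\<lambda>x. det (matrix (?t' x)))"
      by (rule continuous_on_eq) (rule det[symmetric], auto)
    show "?R ` B \<in> sets borel" "?t ` ?R ` B \<in> sets borel"
      using meas[OF B(1)] meas[OF B(2)] by (simp_all add: image_image)
  qed
  also have "\<dots> = (\<integral>\<^sup>+ y. ennreal \<bar>det (matrix (\<tau>' (?D y)))\<bar> * indicator B (?D y) \<partial>lborel)"
    by (intro nn_integral_cong) (auto simp: indicator_def vim det)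
  also have "\<dots> = (\<integral>\<^sup>+ y. ennreal \<bar>det (matrix (\<tau>' (?D y)))\<bar> * indicator B (?D y) \<partial>distr lborel borel ?R)"
    by (simp add: distr_reindex)
  also have "\<dots> = (\<integral>\<^sup>+ y. ennreal \<bar>det (matrix (\<tau>' y))\<bar> * indicator B y \<partial>lborel)"
  proof -
    have m: "(\<lambda>y. indicator B y *\<^sub>R \<bar>det (matrix (\<tau>' y))\<bar>) \<in> borel_measurable borel"
      using cont by (intro borel_measurable_continuous_on_indicator B continuous_on_rabs)
    have "(\<lambda>y. ennreal \<bar>det (matrix (\<tau>' y))\<bar> * indicator B y) =
        (\<lambda>y. ennreal (indicator B y *\<^sub>R \<bar>det (matrix (\<tau>' y))\<bar>))"
      by (auto simp: indicator_def)
    also have "\<dots> \<in> borel_measurable borel" using m by measurable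
    finally have [measurable]: "(\<lambda>y. ennreal \<bar>det (matrix (\<tau>' y))\<bar> * indicator B y) \<in> borel_measurable borel" .
    have "(\<lambda>y. ennreal \<bar>det (matrix (\<tau>' (?D y)))\<bar> * indicator B (?D y)) \<in> borel_measurable borel"
      using measurable_compose[OF measurable_unreindex
          \<open>(\<lambda>y. ennreal \<bar>det (matrix (\<tau>' y))\<bar> * indicator B y) \<in> borel_measurable borel\<close>] .
    then show ?thesis by (subst nn_integral_distr) simp_all
  qed
  finally show ?thesis .
qed

text \<open>The formula for sets identifies the image under \<tau> of the measure with density |det
  \<tau>'| on B with Lebesgue measure on the image of B. Integrating f against both measures gives
  the formula for functions.\<close>

lemma nn_integral_change_of_variables:
  fixes \<tau> :: "real ^ 'n::finite \<Rightarrow> real ^ 'n" and f :: "real ^ 'n \<Rightarrow> ennreal"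
  assumes der: "\<And>x. x \<in> B \<Longrightarrow> (\<tau> has_derivative \<tau>' x) (at x)"
    and inj: "inj_on \<tau> B"
    and cont: "continuous_on B (\<lambda>x. det (matrix (\<tau>' x)))"
    and B: "B \<in> sets borel" "\<tau> ` B \<in> sets borel"
    and f [measurable]: "f \<in> borel_measurable borel"
  shows "(\<integral>\<^sup>+ z. f z * indicator (\<tau> ` B) z \<partial>lborel) =
    (\<integral>\<^sup>+ y. f (\<tau> y) * (ennreal \<bar>det (matrix (\<tau>' y))\<bar> * indicator B y) \<partial>lborel)"
proof -
  define J where "J = (\<lambda>y. ennreal \<bar>det (matrix (\<tau>' y))\<bar> * indicator B y)"
  \<comment> \<open>The extension by 0 is Borel on the whole space; its values outside B are
    irrelevant because the density \<open>J\<close> vanishes there.\<close>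
  define t where "t = (\<lambda>x. if x \<in> B then \<tau> x else 0)"
  note B [measurable]
  have contt: "continuous_on B \<tau>"
    using der by (meson continuous_at_imp_continuous_on has_derivative_continuous)
  have "(\<lambda>x. indicator B x *\<^sub>R \<tau> x) \<in> borel_measurable borel"
    using contt by (intro borel_measurable_continuous_on_indicator B)
  also have "(\<lambda>x. indicator B x *\<^sub>R \<tau> x) = t" by (auto simp: t_def indicator_def)
  finally have t [measurable]: "t \<in> borel_measurable borel" .
  have "(\<lambda>y. indicator B y *\<^sub>R \<bar>det (matrix (\<tau>' y))\<bar>) \<in> borel_measurable borel"
    using cont by (intro borel_measurable_continuous_on_indicator B continuous_on_rabs)
  moreover have "J = (\<lambda>y. ennreal (indicator B y *\<^sub>R \<bar>det (matrix (\<tau>' y))\<bar>))"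
    by (auto simp: J_def indicator_def)
  ultimately have J [measurable]: "J \<in> borel_measurable borel" by simp
  have eq: "distr (density lborel J) borel t = density lborel (indicator (\<tau> ` B))"
  proof (rule measure_eqI)
    fix E assume "E \<in> sets (distr (density lborel J) borel t)"
    then have E [measurable]: "E \<in> sets borel" by simp
    let ?C = "B \<inter> t -` E"
    have C [measurable]: "?C \<in> sets borel"
      using measurable_sets[OF t E] by auto
    have im: "\<tau> ` ?C = \<tau> ` B \<inter> E"
      by (auto simp: t_def)
    have "emeasure (distr (density lborel J) borel t) E = (\<integral>\<^sup>+ y. J y * indicator (t -` E) y \<partial>lborel)"
      using measurable_sets[OF t E] by (simp add: emeasure_distr emeasure_density)
    also have "\<dots> = (\<integral>\<^sup>+ y. ennreal \<bar>det (matrix (\<tau>' y))\<bar> * indicator ?C y \<partial>lborel)"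
      by (intro nn_integral_cong) (auto simp: J_def indicator_def)
    also have "\<dots> = emeasure lborel (\<tau> ` ?C)"
      using der inj cont C B(2) im
      by (intro emeasure_differentiable_image[symmetric])
        (auto intro: inj_on_subset continuous_on_subset)
    also have "\<dots> = emeasure (density lborel (indicator (\<tau> ` B))) E"
      unfolding im by (simp add: emeasure_density indicator_inter_arith[symmetric])
    finally show "emeasure (distr (density lborel J) borel t) E =
        emeasure (density lborel (indicator (\<tau> ` B))) E" .
  qed simp
  have "(\<integral>\<^sup>+ z. f z * indicator (\<tau> ` B) z \<partial>lborel) = (\<integral>\<^sup>+ z. f z \<partial>density lborel (indicator (\<tau> ` B)))"
    by (simp add: nn_integral_density mult.commute)
  also have "\<dots> = (\<integral>\<^sup>+ y. J y * f (t y) \<partial>lborel)"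
    unfolding eq[symmetric] by (simp add: nn_integral_distr nn_integral_density)
  also have "\<dots> = (\<integral>\<^sup>+ y. f (\<tau> y) * (ennreal \<bar>det (matrix (\<tau>' y))\<bar> * indicator B y) \<partial>lborel)"
    by (intro nn_integral_cong) (auto simp: J_def t_def indicator_def mult.commute)
  finally show ?thesis .
qed

section \<open>Gram matrices\<close>

lemma matrix_inv_right:
  fixes A :: "real ^ 'n::finite ^ 'n"
  assumes "invertible A"
  shows "A ** matrix_inv A = mat 1"
  using assms unfolding invertible_def matrix_inv_def by (rule someI_ex[THEN conjunct1])

lemma matrix_inv_left:
  fixes A :: "real ^ 'n::finite ^ 'n"
  assumes "invertible A"
  shows "matrix_inv A ** A = mat 1"
  using assms unfolding invertible_def matrix_inv_def by (rule someI_ex[THEN conjunct2])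

lemma continuous_on_det:
  fixes A :: "'a::topological_space \<Rightarrow> real ^ 'n::finite ^ 'n"
  assumes "\<And>i j. continuous_on S (\<lambda>x. A x $ i $ j)"
  shows "continuous_on S (\<lambda>x. det (A x))"
  unfolding det_def by (intro continuous_intros assms)

text \<open>All matrices on the segment from the identity to A have a positive quadratic form and
  hence are invertible. So the determinant keeps the sign it has at the identity.\<close>

lemma det_pos_def:
  fixes A :: "real ^ 'n::finite ^ 'n"
  assumes pos: "\<And>v. v \<noteq> 0 \<Longrightarrow> 0 < v \<bullet> (A *v v)"
  shows "0 < det A"
proof (rule ccontr)
  assume "\<not> 0 < det A"
  define M where "M t = (\<chi> i j. t * A $ i $ j + (1 - t) * mat 1 $ i $ j)" for t :: real
  have M: "M t *v v = t *\<^sub>R (A *v v) + (1 - t) *\<^sub>R v" for t v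
  proof -
    have "M t = t *\<^sub>R A + (1 - t) *\<^sub>R mat 1"
      by (simp add: M_def vec_eq_iff)
    then show ?thesis
      by (simp add: matrix_vector_mult_add_rdistrib scaleR_matrix_vector_assoc[symmetric])
  qed
  have nz: "det (M t) \<noteq> 0" if "0 \<le> t" "t \<le> 1" for t
  proof -
    have "v = 0" if "M t *v v = 0" for v
    proof (rule ccontr)
      assume v: "v \<noteq> 0"
      have "0 = v \<bullet> (M t *v v)" using that by simp
      also have "\<dots> = t * (v \<bullet> (A *v v)) + (1 - t) * (v \<bullet> v)"
        by (simp add: M inner_add_right)
      also have "\<dots> > 0"
      proof (cases "t = 0")
        case False
        then have "0 < t * (v \<bullet> (A *v v))" using pos[OF v] \<open>0 \<le> t\<close> by simp
        moreover have "0 \<le> (1 - t) * (v \<bullet> v)" using \<open>t \<le> 1\<close> by simp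
        ultimately show ?thesis by linarith
      qed (use v in simp)
      finally show False by simp
    qed
    then have "invertible (M t)"
      unfolding invertible_left_inverse matrix_left_invertible_ker by blast
    then show ?thesis by (simp add: invertible_det_nz)
  qed
  have "M 0 = mat 1" "M 1 = A" by (simp_all add: M_def vec_eq_iff)
  then have "det (M 1) \<le> 0" "0 \<le> det (M 0)" using \<open>\<not> 0 < det A\<close> by simp_all
  moreover have "continuous_on {0..1} (\<lambda>t. det (M t))"
    by (intro continuous_on_det) (auto simp: M_def intro!: continuous_intros)
  ultimately obtain t where "0 \<le> t" "t \<le> 1" "det (M t) = 0"
    using IVT2'[of "\<lambda>t. det (M t)" 1 0 0] by auto
  with nz show False by blast
qed

definition gram :: "('n::finite \<Rightarrow> 'v::real_inner) \<Rightarrow> real ^ 'n ^ 'n" where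
  "gram b = (\<chi> i j. b i \<bullet> b j)"

definition lin_comb :: "('n::finite \<Rightarrow> 'v::real_inner) \<Rightarrow> real ^ 'n \<Rightarrow> 'v" where
  "lin_comb b v = (\<Sum>i\<in>UNIV. v $ i *\<^sub>R b i)"

definition frame :: "('n::finite \<Rightarrow> 'v::real_inner) \<Rightarrow> bool" where
  "frame b \<longleftrightarrow> (\<forall>v. lin_comb b v = 0 \<longrightarrow> v = 0)"

definition gram_inv :: "('n::finite \<Rightarrow> 'v::real_inner) \<Rightarrow> real ^ 'n ^ 'n" where
  "gram_inv b = matrix_inv (gram b)"

text \<open>The vector of the span of \<open>b\<close> with prescribed inner products \<open>\<xi> i\<close> with \<open>b i\<close>: the
  index of the covector \<open>\<xi>\<close> is raised.\<close>

definition raise :: "('n::finite \<Rightarrow> 'v::real_inner) \<Rightarrow> ('n \<Rightarrow> real) \<Rightarrow> 'v" where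
  "raise b \<xi> = (\<Sum>i\<in>UNIV. \<Sum>j\<in>UNIV. (gram_inv b $ i $ j * \<xi> i) *\<^sub>R b j)"

lemma lin_comb_inner: "lin_comb b v \<bullet> w = (\<Sum>i\<in>UNIV. v $ i * (b i \<bullet> w))"
  by (simp add: lin_comb_def inner_sum_left)

lemma lin_comb_axis [simp]: "lin_comb b (axis i 1) = b i"
proof -
  have "lin_comb b (axis i 1) = (\<Sum>j\<in>UNIV. if j = i then b j else 0)"
    unfolding lin_comb_def by (intro sum.cong) (auto simp: axis_def)
  then show ?thesis by simp
qed

lemma gram_mult: "(gram b *v v) $ i = b i \<bullet> lin_comb b v"
  by (simp add: gram_def matrix_vector_mult_def lin_comb_def inner_sum_right mult.commute)

lemma gram_quadratic: "v \<bullet> (gram b *v v) = (norm (lin_comb b v))\<^sup>2"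
proof -
  have "v \<bullet> (gram b *v v) = lin_comb b v \<bullet> lin_comb b v"
    unfolding lin_comb_inner by (simp add: inner_vec_def gram_mult)
  then show ?thesis by (simp add: dot_square_norm)
qed

lemma det_gram_pos: "frame b \<Longrightarrow> 0 < det (gram b)"
  by (intro det_pos_def) (auto simp: gram_quadratic frame_def)

lemma invertible_gram: "frame b \<Longrightarrow> invertible (gram b)"
  using det_gram_pos[of b] by (simp add: invertible_det_nz)

lemma gram_inv_sym: "frame b \<Longrightarrow> gram_inv b $ i $ j = gram_inv b $ j $ i"
proof -
  assume "frame b"
  then have inv: "invertible (gram b)" by (rule invertible_gram)
  have sym: "transpose (gram b) = gram b"
    by (simp add: gram_def transpose_def vec_eq_iff inner_commute)
  let ?N = "gram_inv b"
  have "transpose ?N ** gram b = mat 1"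
    using arg_cong[OF matrix_inv_right[OF inv], of transpose]
    by (simp add: matrix_transpose_mul sym transpose_mat gram_inv_def)
  then have "transpose ?N ** gram b ** ?N = ?N"
    by (simp add: matrix_mul_lid)
  then have "transpose ?N = ?N"
    using matrix_inv_right[OF inv]
    by (simp add: matrix_mul_assoc[symmetric] matrix_mul_rid gram_inv_def)
  then show ?thesis by (metis transpose_def vec_lambda_beta)
qed

lemma gram_inv_gram:
  assumes "frame b"
  shows "(\<Sum>k\<in>UNIV. gram_inv b $ i $ k * (b k \<bullet> b j)) = (if i = j then 1 else 0)"
    and "(\<Sum>k\<in>UNIV. (b i \<bullet> b k) * gram_inv b $ k $ j) = (if i = j then 1 else 0)"
  using arg_cong[OF matrix_inv_left[OF invertible_gram[OF assms]], of "\<lambda>M. M $ i $ j"]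
    arg_cong[OF matrix_inv_right[OF invertible_gram[OF assms]], of "\<lambda>M. M $ i $ j"]
  by (simp_all add: matrix_matrix_mult_def gram_inv_def gram_def mat_def)

lemma raise_inner:
  assumes "frame b"
  shows "raise b \<xi> \<bullet> b k = \<xi> k"
proof -
  have "raise b \<xi> \<bullet> b k = (\<Sum>i\<in>UNIV. \<xi> i * (\<Sum>j\<in>UNIV. gram_inv b $ i $ j * (b j \<bullet> b k)))"
    by (simp add: raise_def inner_sum_left sum_distrib_left mult_ac)
  also have "\<dots> = (\<Sum>i\<in>UNIV. if i = k then \<xi> i else 0)"
    by (intro sum.cong) (auto simp: gram_inv_gram[OF assms])
  finally show ?thesis by simp
qed

lemma raise_in_range: "raise b \<xi> \<in> range (lin_comb b)"
proof -
  have "raise b \<xi> = lin_comb b (\<chi> j. \<Sum>i\<in>UNIV. gram_inv b $ i $ j * \<xi> i)"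
    unfolding raise_def lin_comb_def by (subst sum.swap) (simp add: scaleR_sum_left)
  then show ?thesis by blast
qed

lemma lin_comb_linear: "linear (lin_comb b)"
  by (intro linearI)
    (auto simp: lin_comb_def sum.distrib scaleR_left_distrib scaleR_sum_right)

lemma range_lin_comb_eqI:
  assumes "w \<in> range (lin_comb b)" "w' \<in> range (lin_comb b)" "\<And>k. w \<bullet> b k = w' \<bullet> b k"
  shows "w = w'"
proof -
  obtain v v' where v: "w = lin_comb b v" "w' = lin_comb b v'" using assms by auto
  have d: "w - w' = lin_comb b (v - v')"
    using v by (simp add: linear_diff[OF lin_comb_linear])
  have "(w - w') \<bullet> (w - w') = (\<Sum>i\<in>UNIV. (v - v') $ i * (b i \<bullet> (w - w')))"
    by (subst d) (rule lin_comb_inner)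
  also have "\<dots> = 0"
    using assms(3) by (simp add: inner_diff_right inner_commute)
  finally show ?thesis by simp
qed

text \<open>A vector of the span is determined by its inner products with the frame. Identities for
  gradients and projections are checked on these products, so that no entry of an inverse matrix has
  to be transformed.\<close>

lemma raise_unique:
  assumes "frame b" "w \<in> range (lin_comb b)" "\<And>k. w \<bullet> b k = \<xi> k"
  shows "w = raise b \<xi>"
  by (rule range_lin_comb_eqI) (use assms raise_in_range raise_inner[OF assms(1)] in auto)

definition proj :: "('n::finite \<Rightarrow> 'v::real_inner) \<Rightarrow> 'v \<Rightarrow> 'v" where
  "proj b v = raise b (\<lambda>i. v \<bullet> b i)"

lemma raise_dot: "raise b \<xi> \<bullet> v = (\<Sum>i\<in>UNIV. \<Sum>j\<in>UNIV. gram_inv b $ i $ j * \<xi> i * (b j \<bullet> v))"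
  by (simp add: raise_def inner_sum_left)

text \<open>Behind the identity between the inner product of x^T with x and |x^T|^2.\<close>

lemma raise_dot_proj:
  assumes "frame b"
  shows "raise b \<xi> \<bullet> v = raise b \<xi> \<bullet> proj b v"
proof -
  obtain u where u: "raise b \<xi> = lin_comb b u" using raise_in_range[of b \<xi>] by auto
  have "b i \<bullet> v = b i \<bullet> proj b v" for i
    using raise_inner[OF assms, of "\<lambda>i. v \<bullet> b i" i] by (simp add: proj_def inner_commute)
  then show ?thesis by (simp add: u lin_comb_inner)
qed

section \<open>Gram matrices under a change of frame\<close>

definition change_frame :: "real ^ 'n ^ 'n \<Rightarrow> ('n::finite \<Rightarrow> 'v::real_inner) \<Rightarrow> 'n \<Rightarrow> 'v" where
  "change_frame T b j = (\<Sum>l\<in>UNIV. T $ l $ j *\<^sub>R b l)"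

lemma lin_comb_change_frame: "lin_comb (change_frame T b) v = lin_comb b (T *v v)"
proof -
  have "lin_comb (change_frame T b) v = (\<Sum>j\<in>UNIV. \<Sum>l\<in>UNIV. (v $ j * T $ l $ j) *\<^sub>R b l)"
    by (simp add: lin_comb_def change_frame_def scaleR_sum_right)
  also have "\<dots> = lin_comb b (T *v v)"
    by (subst sum.swap) (simp add: lin_comb_def matrix_vector_mult_def scaleR_sum_left mult.commute)
  finally show ?thesis .
qed

lemma range_change_frame: "range (lin_comb (change_frame T b)) \<subseteq> range (lin_comb b)"
  by (auto simp: lin_comb_change_frame)

lemma gram_change_frame: "gram (change_frame T b) = transpose T ** gram b ** T"
proof -
  have "gram (change_frame T b) $ i $ j = (transpose T ** gram b ** T) $ i $ j" for i j
  proof -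
    have "gram (change_frame T b) $ i $ j = (\<Sum>l\<in>UNIV. \<Sum>m\<in>UNIV. T $ l $ i * (T $ m $ j * (b l \<bullet> b m)))"
    proof -
      have "gram (change_frame T b) $ i $ j = change_frame T b i \<bullet> change_frame T b j"
        by (simp add: gram_def)
      also have "\<dots> = (\<Sum>l\<in>UNIV. T $ l $ i * (b l \<bullet> change_frame T b j))"
        by (simp add: change_frame_def[of T b i] inner_sum_left)
      finally show ?thesis
        by (simp add: change_frame_def inner_sum_right sum_distrib_left)
    qed
    also have "\<dots> = (\<Sum>m\<in>UNIV. \<Sum>l\<in>UNIV. T $ l $ i * (T $ m $ j * (b l \<bullet> b m)))"
      by (rule sum.swap)
    also have "\<dots> = (transpose T ** gram b ** T) $ i $ j"
      by (simp add: matrix_matrix_mult_def transpose_def gram_def sum_distrib_right sum_distrib_left mult_ac)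
    finally show ?thesis .
  qed
  then show ?thesis by (simp add: vec_eq_iff)
qed

lemma sqrt_det_gram_change_frame:
  "sqrt (det (gram (change_frame T b))) = \<bar>det T\<bar> * sqrt (det (gram b))"
  by (simp add: gram_change_frame det_mul real_sqrt_mult mult_ac)

text \<open>The inverse Gram matrices N and N' satisfy T N' T^t = N, and the trace is cyclic. It
  will be applied with B the matrix of second derivatives paired with a normal vector, which makes
  the mean curvature independent of the parametrization.\<close>

lemma trace_gram_inv_change_frame:
  fixes B B' :: "real ^ 'n::finite ^ 'n"
  assumes b: "frame b" and b': "frame (change_frame T b)"
    and B': "B' = transpose T ** B ** T"
  shows "(\<Sum>i\<in>UNIV. \<Sum>j\<in>UNIV. gram_inv (change_frame T b) $ i $ j * B' $ i $ j) =
    (\<Sum>i\<in>UNIV. \<Sum>j\<in>UNIV. gram_inv b $ i $ j * B $ i $ j)"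
proof -
  let ?N = "gram_inv b" and ?N' = "gram_inv (change_frame T b)" and ?g = "gram b"
  have tr: "(\<Sum>i\<in>UNIV. \<Sum>j\<in>UNIV. M $ i $ j * C $ i $ j) = trace (M ** transpose C)"
    for M C :: "real ^ 'n ^ 'n"
    by (simp add: trace_def matrix_matrix_mult_def transpose_def)
  have "det (gram (change_frame T b)) \<noteq> 0"
    using det_gram_pos[OF b'] by simp
  then have T: "invertible T"
    by (auto simp: gram_change_frame det_mul invertible_det_nz)
  have "?N' ** (transpose T ** ?g ** T) = mat 1"
    using matrix_inv_left[OF invertible_gram[OF b']] by (simp add: gram_inv_def gram_change_frame)
  then have "T ** (?N' ** (transpose T ** ?g ** T)) ** (matrix_inv T ** ?N) = T ** matrix_inv T ** ?N"
    by (simp add: matrix_mul_rid matrix_mul_assoc)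
  also have "T ** (?N' ** (transpose T ** ?g ** T)) ** (matrix_inv T ** ?N)
      = T ** ?N' ** transpose T ** (?g ** ((T ** matrix_inv T) ** ?N))"
    by (simp add: matrix_mul_assoc)
  also have "?g ** ((T ** matrix_inv T) ** ?N) = mat 1"
    using matrix_inv_right[OF invertible_gram[OF b]]
    by (simp add: matrix_inv_right[OF T] matrix_mul_lid gram_inv_def)
  finally have N: "T ** ?N' ** transpose T = ?N"
    by (simp add: matrix_inv_right[OF T] matrix_mul_lid matrix_mul_rid)
  have "trace (?N' ** transpose B') = trace ((?N' ** transpose T ** transpose B) ** T)"
    by (simp add: B' matrix_transpose_mul matrix_mul_assoc)
  also have "\<dots> = trace (T ** (?N' ** transpose T ** transpose B))"
    by (rule trace_mul_sym)
  also have "\<dots> = trace (?N ** transpose B)"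
    by (simp add: matrix_mul_assoc N)
  finally show ?thesis by (simp add: tr)
qed

section \<open>Derivatives of determinants and inverse matrices\<close>

text \<open>Jacobi's formula. Differentiating the Leibniz expansion yields, for each i, the
  determinant with row i replaced by its derivative, and Cramer's rule evaluates it.\<close>

lemma has_derivative_det:
  fixes A :: "'a::real_normed_vector \<Rightarrow> real ^ 'n::finite ^ 'n"
  assumes der: "\<And>i j. ((\<lambda>x. A x $ i $ j) has_derivative A' i j) (at x)"
    and N: "N ** A x = mat 1"
  shows "((\<lambda>x. det (A x)) has_derivative
    (\<lambda>v. det (A x) * (\<Sum>i\<in>UNIV. \<Sum>k\<in>UNIV. A' i k v * N $ k $ i))) (at x)"
proof -
  have row: "(\<Sum>p | p permutes UNIV. of_int (sign p) *
      (C $ p i * (\<Prod>r\<in>UNIV - {i}. A x $ r $ p r))) =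
      det (\<chi> r. if r = i then C else row r (A x))" for i and C :: "real ^ 'n"
  proof -
    have "(\<Prod>r\<in>UNIV. (\<chi> r. if r = i then C else row r (A x)) $ r $ p r) =
        C $ p i * (\<Prod>r\<in>UNIV - {i}. A x $ r $ p r)" for p
      by (subst prod.remove[of UNIV i]) (auto simp: row_def intro!: prod.cong)
    then show ?thesis by (simp add: det_def)
  qed
  have expand: "det (\<chi> r. if r = i then C else row r (A x)) = (\<Sum>k\<in>UNIV. C $ k * N $ k $ i) * det (A x)"
    for i and C :: "real ^ 'n"
  proof -
    \<comment> \<open>The row C is the combination of the rows of A with coefficients C N, since N A
      is the identity; this is the form in which Cramer's lemma applies.\<close>
    have eq: "(\<Sum>r\<in>UNIV. (C v* N) $ r *s row r (A x)) = C"
    proof -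
      have "(\<Sum>r\<in>UNIV. (C v* N) $ r *s row r (A x)) = (C v* N) v* A x"
        by (simp add: vec_eq_iff vector_matrix_mult_def row_def mult.commute)
      also have "\<dots> = C" by (simp add: vector_matrix_mul_assoc N)
      finally show ?thesis .
    qed
    have "det (\<chi> r. if r = i then C else row r (A x)) = (C v* N) $ i * det (A x)"
      using cramer_lemma_transpose[of i "C v* N" "A x"] unfolding eq .
    then show ?thesis by (simp add: vector_matrix_mult_def mult.commute)
  qed
  have "((\<lambda>x. det (A x)) has_derivative
    (\<lambda>v. \<Sum>p | p permutes UNIV. of_int (sign p) *
       (\<Sum>i\<in>UNIV. A' i (p i) v * (\<Prod>r\<in>UNIV - {i}. A x $ r $ p r)))) (at x)"
    unfolding det_def by (intro has_derivative_sum has_derivative_mult_right has_derivative_prod der)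
  moreover have "(\<Sum>p | p permutes UNIV. of_int (sign p) *
       (\<Sum>i\<in>UNIV. A' i (p i) v * (\<Prod>r\<in>UNIV - {i}. A x $ r $ p r))) =
     det (A x) * (\<Sum>i\<in>UNIV. \<Sum>k\<in>UNIV. A' i k v * N $ k $ i)" for v
  proof -
    have "(\<Sum>p | p permutes UNIV. of_int (sign p) *
       (\<Sum>i\<in>UNIV. A' i (p i) v * (\<Prod>r\<in>UNIV - {i}. A x $ r $ p r))) =
      (\<Sum>i\<in>UNIV. \<Sum>p | p permutes UNIV. of_int (sign p) *
       ((\<chi> k. A' i k v) $ p i * (\<Prod>r\<in>UNIV - {i}. A x $ r $ p r)))"
      by (subst sum.swap) (simp add: sum_distrib_left)
    also have "\<dots> = (\<Sum>i\<in>UNIV. (\<Sum>k\<in>UNIV. (\<chi> k. A' i k v) $ k * N $ k $ i) * det (A x))"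
      unfolding row expand ..
    finally show ?thesis by (simp add: sum_distrib_left mult_ac)
  qed
  ultimately show ?thesis by simp
qed

text \<open>Differentiate N A = 1 and multiply by N from the right.\<close>

lemma derivative_inverse_matrix:
  fixes A N :: "'a::real_normed_vector \<Rightarrow> real ^ 'n::finite ^ 'n"
  assumes derA: "\<And>i j. ((\<lambda>x. A x $ i $ j) has_derivative A' i j) (at x)"
    and derN: "\<And>i j. ((\<lambda>x. N x $ i $ j) has_derivative N' i j) (at x)"
    and S: "open S" "x \<in> S" and inv: "\<And>y. y \<in> S \<Longrightarrow> N y ** A y = mat 1"
  shows "N' i j v = - (\<Sum>k\<in>UNIV. \<Sum>l\<in>UNIV. N x $ i $ k * A' k l v * N x $ l $ j)"
proof -
  have AN1: "A x ** N x = mat 1"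
    using inv[OF S(2)] matrix_left_right_inverse by blast
  have AN: "(\<Sum>l\<in>UNIV. A x $ k $ l * N x $ l $ j) = (if k = j then 1 else 0)" for k
    using arg_cong[OF AN1, of "\<lambda>M. M $ k $ j"] by (simp add: matrix_matrix_mult_def mat_def)
  have zero: "(\<Sum>k\<in>UNIV. N x $ i $ k * A' k l v + N' i k v * A x $ k $ l) = 0" for l
  proof -
    have eq: "(\<Sum>k\<in>UNIV. N y $ i $ k * A y $ k $ l) = mat 1 $ i $ l" if "y \<in> S" for y
      using arg_cong[OF inv[OF that], of "\<lambda>M. M $ i $ l"] by (simp add: matrix_matrix_mult_def)
    have "((\<lambda>y. \<Sum>k\<in>UNIV. N y $ i $ k * A y $ k $ l) has_derivative
        (\<lambda>v. \<Sum>k\<in>UNIV. N x $ i $ k * A' k l v + N' i k v * A x $ k $ l)) (at x)"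
      by (intro has_derivative_sum has_derivative_mult derA derN)
    from has_derivative_transform_within_open[OF this S eq]
    have "((\<lambda>y. mat 1 $ i $ l) has_derivative
        (\<lambda>v. \<Sum>k\<in>UNIV. N x $ i $ k * A' k l v + N' i k v * A x $ k $ l)) (at x)" .
    from has_derivative_unique[OF this has_derivative_const] show ?thesis
      by (rule fun_cong)
  qed
  have "0 = (\<Sum>l\<in>UNIV. (\<Sum>k\<in>UNIV. N x $ i $ k * A' k l v + N' i k v * A x $ k $ l) * N x $ l $ j)"
    by (simp add: zero)
  also have "\<dots> = (\<Sum>l\<in>UNIV. \<Sum>k\<in>UNIV. N x $ i $ k * A' k l v * N x $ l $ j) +
      (\<Sum>l\<in>UNIV. \<Sum>k\<in>UNIV. N' i k v * (A x $ k $ l * N x $ l $ j))"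
    by (simp add: sum_distrib_right sum_distrib_left sum.distrib distrib_right distrib_left mult_ac)
  also have "(\<Sum>l\<in>UNIV. \<Sum>k\<in>UNIV. N' i k v * (A x $ k $ l * N x $ l $ j)) =
      (\<Sum>k\<in>UNIV. N' i k v * (\<Sum>l\<in>UNIV. A x $ k $ l * N x $ l $ j))"
    by (subst sum.swap) (simp add: sum_distrib_left)
  also have "\<dots> = N' i j v"
    by (simp add: AN if_distrib[of "(*) _"] cong: if_cong)
  also have "(\<Sum>l\<in>UNIV. \<Sum>k\<in>UNIV. N x $ i $ k * A' k l v * N x $ l $ j) =
      (\<Sum>k\<in>UNIV. \<Sum>l\<in>UNIV. N x $ i $ k * A' k l v * N x $ l $ j)"
    by (rule sum.swap)
  finally show ?thesis by simp
qed

section \<open>The mean curvature vector in coordinates\<close>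

text \<open>With \<open>b i = \<partial>\<^sub>i G\<close> and \<open>c i j = \<partial>\<^sub>i \<partial>\<^sub>j G\<close>, the left-hand side is
  \<open>(\<Sum>i j. \<partial>\<^sub>i (sqrt (det g) g\<^sup>i\<^sup>j b j)) / sqrt (det g)\<close>. It is normal, and it differs from
  \<open>\<Sum>i j. g\<^sup>i\<^sup>j c i j\<close> by a tangent vector.\<close>

lemma coordinate_laplacian_eq:
  fixes b :: "'n::finite \<Rightarrow> 'v::real_inner" and c :: "'n \<Rightarrow> 'n \<Rightarrow> 'v"
  assumes b: "frame b" and sym: "\<And>i j. c i j = c j i"
  defines "N \<equiv> gram_inv b"
  defines "g' \<equiv> (\<lambda>i k l. c i k \<bullet> b l + b k \<bullet> c i l)"
  shows "(\<Sum>i\<in>UNIV. \<Sum>j\<in>UNIV. ((\<Sum>k\<in>UNIV. \<Sum>l\<in>UNIV. g' i k l * N $ l $ k) / 2 * N $ i $ j) *\<^sub>R b j)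
     - (\<Sum>i\<in>UNIV. \<Sum>j\<in>UNIV. (\<Sum>k\<in>UNIV. \<Sum>l\<in>UNIV. N $ i $ k * g' i k l * N $ l $ j) *\<^sub>R b j)
     + (\<Sum>i\<in>UNIV. \<Sum>j\<in>UNIV. N $ i $ j *\<^sub>R c i j)
     = (\<Sum>i\<in>UNIV. \<Sum>j\<in>UNIV. N $ i $ j *\<^sub>R (c i j - proj b (c i j)))"
    (is "?P - ?Q + ?C = ?W")
proof -
  note Nsym = gram_inv_sym[OF b, folded N_def]
  define S where "S m = (\<Sum>k\<in>UNIV. \<Sum>l\<in>UNIV. N $ k $ l * (c m k \<bullet> b l))" for m
  have tau: "(\<Sum>k\<in>UNIV. \<Sum>l\<in>UNIV. g' m k l * N $ l $ k) = 2 * S m" for m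
  proof -
    have "(\<Sum>k\<in>UNIV. \<Sum>l\<in>UNIV. (b k \<bullet> c m l) * N $ l $ k) = S m"
      unfolding S_def by (subst sum.swap) (simp add: mult.commute inner_commute)
    moreover have "(\<Sum>k\<in>UNIV. \<Sum>l\<in>UNIV. (c m k \<bullet> b l) * N $ l $ k) = S m"
      unfolding S_def by (intro sum.cong refl) (simp add: Nsym mult.commute)
    ultimately show ?thesis
      by (simp add: g'_def distrib_right sum.distrib)
  qed
  have P: "?P = raise b S"
    by (simp add: tau raise_def N_def[symmetric] mult.commute)
  define R where "R = (\<lambda>l. \<Sum>i\<in>UNIV. \<Sum>k\<in>UNIV. N $ i $ k * g' i k l)"
  have Q: "?Q = raise b R"
  proof -
    have "?Q = (\<Sum>j\<in>UNIV. \<Sum>i\<in>UNIV. \<Sum>k\<in>UNIV. \<Sum>l\<in>UNIV. (N $ i $ k * g' i k l * N $ l $ j) *\<^sub>R b j)"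
      by (subst sum.swap) (simp add: scaleR_sum_left)
    also have "\<dots> = (\<Sum>j\<in>UNIV. \<Sum>l\<in>UNIV. \<Sum>i\<in>UNIV. \<Sum>k\<in>UNIV. (N $ i $ k * g' i k l * N $ l $ j) *\<^sub>R b j)"
    proof (rule sum.cong[OF refl])
      fix j
      have "(\<Sum>i\<in>UNIV. \<Sum>k\<in>UNIV. \<Sum>l\<in>UNIV. (N $ i $ k * g' i k l * N $ l $ j) *\<^sub>R b j)
        = (\<Sum>i\<in>UNIV. \<Sum>l\<in>UNIV. \<Sum>k\<in>UNIV. (N $ i $ k * g' i k l * N $ l $ j) *\<^sub>R b j)"
        by (intro sum.cong refl sum.swap)
      also have "\<dots> = (\<Sum>l\<in>UNIV. \<Sum>i\<in>UNIV. \<Sum>k\<in>UNIV. (N $ i $ k * g' i k l * N $ l $ j) *\<^sub>R b j)"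
        by (rule sum.swap)
      finally show "(\<Sum>i\<in>UNIV. \<Sum>k\<in>UNIV. \<Sum>l\<in>UNIV. (N $ i $ k * g' i k l * N $ l $ j) *\<^sub>R b j)
        = (\<Sum>l\<in>UNIV. \<Sum>i\<in>UNIV. \<Sum>k\<in>UNIV. (N $ i $ k * g' i k l * N $ l $ j) *\<^sub>R b j)" .
    qed
    also have "\<dots> = raise b R"
      unfolding raise_def R_def N_def[symmetric]
      by (subst sum.swap) (simp add: scaleR_sum_left[symmetric] sum_distrib_left mult_ac)
    finally show ?thesis .
  qed
  define Z where "Z = (\<lambda>m. \<Sum>i\<in>UNIV. \<Sum>j\<in>UNIV. N $ i $ j * (c i j \<bullet> b m))"
  have pr: "(\<Sum>i\<in>UNIV. \<Sum>j\<in>UNIV. N $ i $ j *\<^sub>R proj b (c i j)) = raise b Z"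
  proof (rule raise_unique[OF b])
    show "(\<Sum>i\<in>UNIV. \<Sum>j\<in>UNIV. N $ i $ j *\<^sub>R proj b (c i j)) \<in> range (lin_comb b)"
      unfolding proj_def
      by (intro subspace_sum subspace_scale raise_in_range)
        (auto intro: linear_subspace_image lin_comb_linear)
    show "(\<Sum>i\<in>UNIV. \<Sum>j\<in>UNIV. N $ i $ j *\<^sub>R proj b (c i j)) \<bullet> b m = Z m" for m
      by (simp add: inner_sum_left proj_def raise_inner[OF b] Z_def)
  qed
  \<comment> \<open>The cancellation behind the identity. Here \<open>2 * S m\<close> is the
    derivative of log (det g) and \<open>raise b Z\<close> is the tangential part of the traced
    second derivatives. Contracting \<open>g' i k m\<close> over i and k produces \<open>Z m\<close>
    from its first summand and, by the symmetry of \<open>c\<close>, \<open>S m\<close> from the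
    second.\<close>
  have "S m + Z m = R m" for m
  proof -
    have "R m = Z m + (\<Sum>i\<in>UNIV. \<Sum>k\<in>UNIV. N $ i $ k * (b k \<bullet> c i m))"
      by (simp add: R_def Z_def g'_def distrib_left sum.distrib)
    moreover have "(\<Sum>i\<in>UNIV. \<Sum>k\<in>UNIV. N $ i $ k * (b k \<bullet> c i m)) = S m"
      unfolding S_def by (intro sum.cong refl) (simp add: sym[of _ m] inner_commute)
    ultimately show ?thesis by simp
  qed
  then have "raise b R = raise b S + raise b Z"
    by (intro raise_unique[OF b, symmetric] subspace_add raise_in_range)
      (auto intro: linear_subspace_image lin_comb_linear simp: inner_add_left raise_inner[OF b])
  then show ?thesis
    unfolding P Q by (simp add: pr sum_subtractf scaleR_diff_right)
qed

section \<open>Second derivatives and integrals of derivatives\<close>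

lemma has_real_derivative_along_line:
  fixes f :: "'a::real_normed_vector \<Rightarrow> real"
  assumes "(f has_derivative f') (at (p + s *\<^sub>R u))"
  shows "((\<lambda>s. f (p + s *\<^sub>R u)) has_real_derivative f' u) (at s)"
proof -
  have lin: "linear f'" using assms by (rule has_derivative_linear)
  have "((\<lambda>s. p + s *\<^sub>R u) has_derivative (\<lambda>h. h *\<^sub>R u)) (at s)"
    by (auto intro!: derivative_eq_intros)
  from has_derivative_compose[OF this assms]
  show ?thesis
    by (simp add: has_field_derivative_def linear_scale[OF lin] mult_commute_abs)
qed

text \<open>The mean value theorem along u, applied to f(y + t v) - f(y), and then along v, applied
  to the derivative in direction u, turns the second difference into t^2 times the mixed derivative
  at a nearby point; this derivative is continuous.\<close>

lemma second_difference_quotient: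
  fixes f :: "'a::euclidean_space \<Rightarrow> real"
  assumes S: "open S" "x \<in> S" and f: "Ck_on 2 S f" and "e > 0"
  shows "\<exists>d>0. \<forall>t. 0 < t \<and> t < d \<longrightarrow>
    \<bar>(f (x + t *\<^sub>R u + t *\<^sub>R v) - f (x + t *\<^sub>R u) - f (x + t *\<^sub>R v) + f x)
      - t\<^sup>2 * frechet_derivative (\<lambda>y. frechet_derivative f (at y) u) (at x) v\<bar> \<le> e * t\<^sup>2"
proof -
  let ?D = "\<lambda>y. frechet_derivative f (at y) u"
  let ?D2 = "\<lambda>y. frechet_derivative ?D (at y) v"
  have f2: "Ck_on (Suc (Suc 0)) S f" using f by (simp add: numeral_2_eq_2)
  have d1: "(f has_derivative frechet_derivative f (at y)) (at y)" if "y \<in> S" for y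
    by (rule Ck_on_SucD[OF f2 that])
  have D1: "Ck_on (Suc 0) S ?D" using f2 by simp
  have d2: "(?D has_derivative frechet_derivative ?D (at y)) (at y)" if "y \<in> S" for y
    by (rule Ck_on_SucD[OF D1 that])
  have "continuous_on S ?D2" using D1 by simp
  then have "continuous (at x) ?D2"
    using S by (simp add: continuous_on_eq_continuous_at)
  then obtain r1 where r1: "r1 > 0" "\<And>y. dist y x < r1 \<Longrightarrow> dist (?D2 y) (?D2 x) < e"
    using \<open>e > 0\<close> unfolding continuous_at_eps_delta by blast
  obtain r2 where r2: "r2 > 0" "ball x r2 \<subseteq> S"
    using S open_contains_ball by blast
  define r where "r = min r1 r2"
  \<comment> \<open>Keeps the whole parallelogram spanned at x by t u and t v inside the ball of
    radius r.\<close>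
  define d where "d = r / (norm u + norm v + 1)"
  have pos: "norm u + norm v + 1 > 0" by (simp add: add_nonneg_pos)
  have "r > 0" using r1 r2 by (simp add: r_def)
  then have "d > 0" using pos by (simp add: d_def)
  moreover have "\<bar>(f (x + t *\<^sub>R u + t *\<^sub>R v) - f (x + t *\<^sub>R u) - f (x + t *\<^sub>R v) + f x)
      - t\<^sup>2 * ?D2 x\<bar> \<le> e * t\<^sup>2" if t: "0 < t" "t < d" for t
  proof -
    have near: "dist (x + s *\<^sub>R u + s' *\<^sub>R v) x < r" if "0 \<le> s" "s \<le> t" "0 \<le> s'" "s' \<le> t" for s s'
    proof -
      have "norm (s *\<^sub>R u + s' *\<^sub>R v) \<le> s * norm u + s' * norm v"
        using norm_triangle_ineq[of "s *\<^sub>R u" "s' *\<^sub>R v"] that by simp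
      also have "\<dots> \<le> t * norm u + t * norm v"
        using that by (intro add_mono mult_right_mono) auto
      also have "\<dots> \<le> t * (norm u + norm v + 1)"
        using t by (simp add: algebra_simps)
      also have "\<dots> < r"
        using t pos by (simp add: d_def field_simps)
      finally show ?thesis by (simp add: dist_norm algebra_simps)
    qed
    have inS: "x + s *\<^sub>R u + s' *\<^sub>R v \<in> S" if "0 \<le> s" "s \<le> t" "0 \<le> s'" "s' \<le> t" for s s'
      using near[OF that] r2 by (auto simp: r_def dist_commute)
    have "((\<lambda>s. f (x + t *\<^sub>R v + s *\<^sub>R u) - f (x + s *\<^sub>R u)) has_real_derivative
        (?D (x + t *\<^sub>R v + s *\<^sub>R u) - ?D (x + s *\<^sub>R u))) (at s)" if "0 \<le> s" "s \<le> t" for s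
      using inS[of s t] inS[of s 0] that t
      by (intro DERIV_diff has_real_derivative_along_line d1) (simp_all add: add_ac)
    from MVT2[OF t(1), OF this]
    obtain s where s: "0 < s" "s < t" and
      1: "f (x + t *\<^sub>R v + t *\<^sub>R u) - f (x + t *\<^sub>R u) - (f (x + t *\<^sub>R v) - f x)
        = t * (?D (x + t *\<^sub>R v + s *\<^sub>R u) - ?D (x + s *\<^sub>R u))"
      by auto
    have "((\<lambda>s'. ?D (x + s *\<^sub>R u + s' *\<^sub>R v)) has_real_derivative
        ?D2 (x + s *\<^sub>R u + s' *\<^sub>R v)) (at s')" if "0 \<le> s'" "s' \<le> t" for s'
      using inS[of s s'] that s
      by (intro has_real_derivative_along_line d2) simp_all
    from MVT2[OF t(1), OF this]
    obtain s' where s': "0 < s'" "s' < t" and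
      2: "?D (x + s *\<^sub>R u + t *\<^sub>R v) - ?D (x + s *\<^sub>R u) = t * ?D2 (x + s *\<^sub>R u + s' *\<^sub>R v)"
      by auto
    let ?y = "x + s *\<^sub>R u + s' *\<^sub>R v"
    have "(f (x + t *\<^sub>R u + t *\<^sub>R v) - f (x + t *\<^sub>R u) - f (x + t *\<^sub>R v) + f x) - t\<^sup>2 * ?D2 x
        = t\<^sup>2 * (?D2 ?y - ?D2 x)"
      using 1 2 by (simp add: add_ac power2_eq_square algebra_simps)
    also have "\<bar>\<dots>\<bar> = t\<^sup>2 * \<bar>?D2 ?y - ?D2 x\<bar>" by (simp add: abs_mult)
    also have "\<dots> \<le> t\<^sup>2 * e"
      using r1(2)[of ?y] near[of s s'] s s' by (intro mult_left_mono) (auto simp: r_def dist_real_def)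
    finally show ?thesis by (simp add: mult.commute)
  qed
  ultimately show ?thesis by blast
qed

text \<open>The second difference is symmetric in u and v, and divided by t^2 it tends to either of
  the mixed derivatives.\<close>

lemma symmetric_second_derivative_real:
  fixes f :: "'a::euclidean_space \<Rightarrow> real"
  assumes S: "open S" "x \<in> S" and f: "Ck_on 2 S f"
  shows "frechet_derivative (\<lambda>y. frechet_derivative f (at y) u) (at x) v =
    frechet_derivative (\<lambda>y. frechet_derivative f (at y) v) (at x) u"
    (is "?p = ?q")
proof (rule ccontr)
  assume "?p \<noteq> ?q"
  define e where "e = \<bar>?p - ?q\<bar> / 3"
  have e: "e > 0" using \<open>?p \<noteq> ?q\<close> by (simp add: e_def)
  obtain d where d: "d > 0" "\<And>t. 0 < t \<and> t < d \<Longrightarrow>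
      \<bar>(f (x + t *\<^sub>R u + t *\<^sub>R v) - f (x + t *\<^sub>R u) - f (x + t *\<^sub>R v) + f x) - t\<^sup>2 * ?p\<bar> \<le> e * t\<^sup>2"
    using second_difference_quotient[OF S f e] by blast
  obtain d' where d': "d' > 0" "\<And>t. 0 < t \<and> t < d' \<Longrightarrow>
      \<bar>(f (x + t *\<^sub>R v + t *\<^sub>R u) - f (x + t *\<^sub>R v) - f (x + t *\<^sub>R u) + f x) - t\<^sup>2 * ?q\<bar> \<le> e * t\<^sup>2"
    using second_difference_quotient[OF S f e] by blast
  define t where "t = min d d' / 2"
  have t: "0 < t" "t < d" "t < d'" using d(1) d'(1) by (auto simp: t_def)
  have eq: "x + t *\<^sub>R v + t *\<^sub>R u = x + t *\<^sub>R u + t *\<^sub>R v" by (simp add: add_ac)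
  have "\<bar>t\<^sup>2 * ?p - t\<^sup>2 * ?q\<bar> \<le> e * t\<^sup>2 + e * t\<^sup>2"
    using d(2)[OF conjI[OF t(1,2)]] d'(2)[OF conjI[OF t(1,3)], unfolded eq] by linarith
  then have "t\<^sup>2 * \<bar>?p - ?q\<bar> \<le> t\<^sup>2 * (2 * e)"
    by (simp add: abs_mult right_diff_distrib[symmetric] mult_ac)
  then have "\<bar>?p - ?q\<bar> \<le> 2 * e" using t by simp
  then show False using e by (simp add: e_def)
qed

lemma frechet_derivative_inner_right:
  assumes "f differentiable (at x)"
  shows "frechet_derivative (\<lambda>y. f y \<bullet> e) (at x) u = frechet_derivative f (at x) u \<bullet> e"
proof -
  have "((\<lambda>y. f y \<bullet> e) has_derivative (\<lambda>u. frechet_derivative f (at x) u \<bullet> e)) (at x)"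
    using assms by (intro has_derivative_inner_left) (simp add: frechet_derivative_works)
  from frechet_derivative_at[OF this] show ?thesis by metis
qed

lemma symmetric_second_derivative:
  fixes f :: "'a::euclidean_space \<Rightarrow> 'v::real_inner"
  assumes S: "open S" "x \<in> S" and f: "Ck_on 2 S f"
  shows "frechet_derivative (\<lambda>y. frechet_derivative f (at y) u) (at x) v =
    frechet_derivative (\<lambda>y. frechet_derivative f (at y) v) (at x) u"
proof -
  have f2: "Ck_on (Suc (Suc 0)) S f" using f by (simp add: numeral_2_eq_2)
  have red: "frechet_derivative (\<lambda>y. frechet_derivative (\<lambda>y. f y \<bullet> e) (at y) u) (at x) v
      = frechet_derivative (\<lambda>y. frechet_derivative f (at y) u) (at x) v \<bullet> e" for e u v
  proof -
    have dif: "(\<lambda>y. frechet_derivative f (at y) u) differentiable (at x)"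
      using f2 S by simp
    have "frechet_derivative (\<lambda>y. frechet_derivative f (at y) u \<bullet> e) (at x)
      = frechet_derivative (\<lambda>y. frechet_derivative (\<lambda>y. f y \<bullet> e) (at y) u) (at x)"
      by (rule frechet_derivative_transform_within_open[OF _ S])
        (use f2 dif in \<open>auto simp: frechet_derivative_inner_right\<close>)
    then show ?thesis
      using frechet_derivative_inner_right[OF dif, of e v] by simp
  qed
  have "frechet_derivative (\<lambda>y. frechet_derivative f (at y) u) (at x) v \<bullet> e =
    frechet_derivative (\<lambda>y. frechet_derivative f (at y) v) (at x) u \<bullet> e" for e
    using symmetric_second_derivative_real[OF S, of "\<lambda>y. f y \<bullet> e" u v]
      Ck_on_inner[OF S(1) f Ck_on_const[OF S(1)]]
    by (simp add: red)
  then show ?thesis by (metis vector_eq_rdot)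
qed

text \<open>By translation invariance the integral of every difference quotient vanishes.\<close>

lemma integral_derivative_zero:
  fixes h :: "'a::euclidean_space \<Rightarrow> real"
  assumes der: "\<And>x. (h has_derivative h' x) (at x)"
    and cont: "continuous_on UNIV (\<lambda>x. h' x v)"
    and K: "compact K" "\<And>x. x \<notin> K \<Longrightarrow> h x = 0"
  shows "integrable lborel (\<lambda>x. h' x v)" "(LINT x|lborel. h' x v) = 0"
proof -
  have zero: "h' x v = 0" if "x \<notin> K" for x
  proof -
    have "((\<lambda>x. 0) has_derivative h' x) (at x)"
      by (rule has_derivative_transform_within_open[OF der, of "- K"])
        (use K that compact_imp_closed in auto)
    from has_derivative_unique[OF this has_derivative_const] show ?thesis by (simp add: fun_eq_iff)
  qed
  have contK: "continuous_on K (\<lambda>x. h' x v)"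
    using cont continuous_on_subset by blast
  have ind: "(\<lambda>x. indicator K x *\<^sub>R h' x v) = (\<lambda>x. h' x v)"
    by (rule ext) (auto simp: indicator_def zero)
  show int: "integrable lborel (\<lambda>x. h' x v)"
    using borel_integrable_compact[OF K(1) contK] by (simp only: ind)
  have "bounded ((\<lambda>x. h' x v) ` K)"
    by (intro compact_imp_bounded compact_continuous_image contK K)
  then obtain C0 where C0: "\<And>x. x \<in> K \<Longrightarrow> \<bar>h' x v\<bar> \<le> C0"
    by (auto simp: bounded_iff)
  define C where "C = max C0 0"
  have C: "\<bar>h' x v\<bar> \<le> C" "0 \<le> C" for x
    using C0[of x] zero[of x] by (cases "x \<in> K") (auto simp: C_def)
  obtain B where B: "\<And>x. x \<in> K \<Longrightarrow> norm x \<le> B"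
    using compact_imp_bounded[OF K(1)] by (auto simp: bounded_iff)
  have conth: "continuous_on UNIV h"
    by (meson continuous_at_imp_continuous_on der has_derivative_continuous)
  have "(\<lambda>x. indicator K x *\<^sub>R h x) = h"
    by (rule ext) (auto simp: indicator_def K(2))
  then have inth: "integrable lborel h"
    using borel_integrable_compact[OF K(1), of h] conth continuous_on_subset by fastforce
  have [measurable]: "h \<in> borel_measurable borel" using conth by (rule borel_measurable_continuous_onI)
  define t where "t m = inverse (real (Suc m))" for m
  have t: "0 < t m" "t m \<le> 1" for m
    by (auto simp: t_def field_simps)
  define q where "q m x = (h (t m *\<^sub>R v + x) - h x) / t m" for m x
  have [measurable]: "q m \<in> borel_measurable borel" for m
    unfolding q_def by measurable
  have shift: "integrable lborel (\<lambda>x. h (a + x))" "(LINT x|lborel. h (a + x)) = (LINT x|lborel. h x)" for a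
    using integrable_distr[of "(+) a" lborel borel h] integral_distr[of "(+) a" lborel borel h] inth
    by (simp_all add: lborel_distr_plus)
  have q0: "(LINT x|lborel. q m x) = 0" for m
    unfolding q_def using shift inth by simp
  \<comment> \<open>Domination: the mean value theorem bounds each quotient by the supremum of |h'|.
    As \<open>t m\<close> is at most 1, outside the ball of radius B + |v| neither x nor its
    translate meets K.\<close>
  have bound: "norm (q m x) \<le> C * indicator (cball 0 (B + norm v)) x" for m x
  proof (cases "x \<in> cball 0 (B + norm v)")
    case True
    have "\<And>s. ((\<lambda>s. h (x + s *\<^sub>R v)) has_real_derivative h' (x + s *\<^sub>R v) v) (at s)"
      by (intro has_real_derivative_along_line der)
    then obtain s where "h (x + t m *\<^sub>R v) - h (x + 0 *\<^sub>R v) = (t m - 0) * h' (x + s *\<^sub>R v) v"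
      using MVT2[OF t(1)[of m], of "\<lambda>s. h (x + s *\<^sub>R v)" "\<lambda>s. h' (x + s *\<^sub>R v) v"] by blast
    then have "q m x = h' (x + s *\<^sub>R v) v"
      using t(1)[of m] by (simp add: q_def add.commute)
    then show ?thesis using C True by simp
  next
    case False
    have "x \<notin> K" "t m *\<^sub>R v + x \<notin> K"
    proof -
      have "norm x > B + norm v" using False by simp
      moreover have "norm (t m *\<^sub>R v) \<le> norm v" using t[of m] by (simp add: mult_left_le_one_le)
      moreover have "norm x \<le> norm (t m *\<^sub>R v + x) + norm (t m *\<^sub>R v)"
        using norm_triangle_ineq4[of "t m *\<^sub>R v + x" "t m *\<^sub>R v"] by simp
      ultimately have "norm (t m *\<^sub>R v + x) > B" "norm x > B"
        using norm_ge_zero[of v] by linarith+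
      then show "x \<notin> K" "t m *\<^sub>R v + x \<notin> K" using B by force+
    qed
    then show ?thesis using False K(2) by (simp add: q_def)
  qed
  have lim: "(\<lambda>m. q m x) \<longlonglongrightarrow> h' x v" for x
  proof -
    have "((\<lambda>s. h (x + s *\<^sub>R v)) has_real_derivative h' x v) (at 0)"
      using has_real_derivative_along_line[of h "h' x" x 0 v] der[of x] by simp
    then have "((\<lambda>s. (h (x + s *\<^sub>R v) - h x) / s) \<longlongrightarrow> h' x v) (at 0)"
      by (simp add: DERIV_def)
    moreover have "filterlim t (at 0) sequentially"
      unfolding t_def using LIMSEQ_inverse_real_of_nat by (intro filterlim_atI) auto
    ultimately show ?thesis
      unfolding q_def by (subst add.commute) (rule filterlim_compose)
  qed
  have "(\<lambda>m. LINT x|lborel. q m x) \<longlonglongrightarrow> (LINT x|lborel. h' x v)"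
  proof (rule integral_dominated_convergence[where w = "\<lambda>x. C * indicator (cball 0 (B + norm v)) x"])
    show "(\<lambda>x. h' x v) \<in> borel_measurable lborel" using int by simp
    show "integrable lborel (\<lambda>x. C * indicator (cball 0 (B + norm v)) x)"
      by (intro integrable_mult_right integrable_real_indicator)
        (use emeasure_bounded_finite[of "cball 0 (B + norm v)"] in auto)
  qed (use lim bound in auto)
  then show "(LINT x|lborel. h' x v) = 0"
    unfolding q0 by (simp add: LIMSEQ_const_iff)
qed

section \<open>The divergence theorem in a coordinate domain\<close>

lemma Ck_on_det:
  fixes A :: "'a::euclidean_space \<Rightarrow> real ^ 'n::finite ^ 'n"
  assumes "open S" "\<And>i j. Ck_on k S (\<lambda>x. A x $ i $ j)"
  shows "Ck_on k S (\<lambda>x. det (A x))"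
  unfolding det_def
  by (intro Ck_on_sum Ck_on_mult Ck_on_prod Ck_on_const assms)

lemma Ck_on_gram:
  fixes b :: "'a::euclidean_space \<Rightarrow> 'n::finite \<Rightarrow> 'v::real_inner"
  assumes "open S" "\<And>j. Ck_on k S (\<lambda>x. b x j)"
  shows "Ck_on k S (\<lambda>x. gram (b x) $ i $ j)"
  using Ck_on_inner[OF assms(1) assms(2)[of i] assms(2)[of j]] by (simp add: gram_def)

text \<open>Cramer's rule writes each entry of the inverse as a quotient of determinants with C^k
  entries and positive denominator.\<close>

lemma Ck_on_gram_inv:
  fixes b :: "'a::euclidean_space \<Rightarrow> 'n::finite \<Rightarrow> 'v::real_inner"
  assumes S: "open S" and b: "\<And>j. Ck_on k S (\<lambda>x. b x j)" and fr: "\<And>x. x \<in> S \<Longrightarrow> frame (b x)"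
  shows "Ck_on k S (\<lambda>x. gram_inv (b x) $ i $ j)"
proof -
  let ?M = "\<lambda>x. (\<chi> r l. if l = i then axis j 1 $ r else gram (b x) $ r $ l) :: real ^ 'n ^ 'n"
  have eq: "det (?M x) / det (gram (b x)) = gram_inv (b x) $ i $ j" if "x \<in> S" for x
  proof -
    have "gram (b x) *v (gram_inv (b x) *v axis j 1) = axis j 1"
      using matrix_inv_right[OF invertible_gram[OF fr[OF that]]]
      by (simp add: matrix_vector_mul_assoc gram_inv_def matrix_vector_mul_lid)
    moreover have "det (gram (b x)) \<noteq> 0" using det_gram_pos[OF fr[OF that]] by simp
    ultimately have "gram_inv (b x) *v axis j 1 =
        (\<chi> k. det (\<chi> r l. if l = k then axis j 1 $ r else gram (b x) $ r $ l) / det (gram (b x)))"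
      by (simp add: cramer)
    then have "(gram_inv (b x) *v axis j 1) $ i = det (?M x) / det (gram (b x))" by simp
    then show ?thesis by (simp add: matrix_vector_mult_basis column_def)
  qed
  have M: "Ck_on k S (\<lambda>x. ?M x $ r $ l)" for r l
    by (cases "l = i") (simp_all add: Ck_on_gram[OF S b] Ck_on_const[OF S])
  have "Ck_on k S (\<lambda>x. det (?M x) / det (gram (b x)))"
    by (intro Ck_on_divide Ck_on_det Ck_on_gram S b M) (auto dest!: fr det_gram_pos)
  moreover have "Ck_on k S (\<lambda>x. det (?M x) / det (gram (b x))) \<longleftrightarrow> Ck_on k S (\<lambda>x. gram_inv (b x) $ i $ j)"
    by (rule Ck_on_cong[OF S eq])
  ultimately show ?thesis by blast
qed

definition partial :: "(real ^ 'n::finite \<Rightarrow> 'v::real_normed_vector) \<Rightarrow> real ^ 'n \<Rightarrow> 'n \<Rightarrow> 'v" where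
  "partial G y i = frechet_derivative G (at y) (axis i 1)"

text \<open>The trace of the second fundamental form: \<open>proj\<close> removes the tangential
  part of the second derivatives of G.\<close>

definition coord_mcv :: "(real ^ 'n::finite \<Rightarrow> 'v::real_inner) \<Rightarrow> real ^ 'n \<Rightarrow> 'v" where
  "coord_mcv G y = (\<Sum>i\<in>UNIV. \<Sum>j\<in>UNIV. gram_inv (partial G y) $ i $ j *\<^sub>R
     (partial (\<lambda>y. partial G y j) y i - proj (partial G y) (partial (\<lambda>y. partial G y j) y i)))"

locale parametrization =
  fixes U :: "(real ^ 'n::finite) set" and G :: "real ^ 'n \<Rightarrow> 'v::euclidean_space"
  assumes open_U: "open U"
    and smooth_G: "smooth_on U G"
    and frame_G: "\<And>y. y \<in> U \<Longrightarrow> frame (partial G y)"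
begin

definition density :: "real ^ 'n \<Rightarrow> real" where
  "density y = sqrt (det (gram (partial G y)))"

lemma Ck_G: "Ck_on k U G"
  using smooth_G by (simp add: smooth_on_def)

lemma Ck_partial: "Ck_on k U (\<lambda>y. partial G y j)"
  using Ck_G[of "Suc k"] by (simp add: partial_def)

lemma Ck_partial2: "Ck_on k U (\<lambda>y. partial (\<lambda>y. partial G y j) y i)"
  using Ck_partial[of "Suc k" j] by (simp add: partial_def)

lemma Ck_gram_inv: "Ck_on k U (\<lambda>y. gram_inv (partial G y) $ i $ j)"
  by (intro Ck_on_gram_inv open_U Ck_partial frame_G)

lemma density_pos: "y \<in> U \<Longrightarrow> 0 < density y"
  using det_gram_pos[OF frame_G] by (simp add: density_def)

lemma Ck_density: "Ck_on k U density"
  unfolding density_def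
  by (intro Ck_on_sqrt Ck_on_det Ck_on_gram open_U Ck_partial det_gram_pos frame_G)

lemma has_derivative_G: "y \<in> U \<Longrightarrow> (G has_derivative frechet_derivative G (at y)) (at y)"
  by (rule Ck_on_SucD[OF Ck_G])

lemma has_derivative_partial:
  "y \<in> U \<Longrightarrow> ((\<lambda>y. partial G y j) has_derivative frechet_derivative (\<lambda>y. partial G y j) (at y)) (at y)"
  by (rule Ck_on_SucD[OF Ck_partial])

lemma partial_partial_sym:
  assumes "y \<in> U"
  shows "partial (\<lambda>y. partial G y j) y i = partial (\<lambda>y. partial G y i) y j"
  unfolding partial_def by (rule symmetric_second_derivative[OF open_U assms Ck_G])

text \<open>The components of the tangential field u x^T multiplied by the volume density. With this
  factor the ordinary divergence in coordinates is the Riemannian divergence times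
  \<open>density\<close>.\<close>

definition flux :: "(real ^ 'n \<Rightarrow> real) \<Rightarrow> 'n \<Rightarrow> real ^ 'n \<Rightarrow> real" where
  "flux u i y = u y * (density y * (\<Sum>j\<in>UNIV. gram_inv (partial G y) $ i $ j * (partial G y j \<bullet> G y)))"

lemma Ck_flux: "Ck_on k U u \<Longrightarrow> Ck_on k U (flux u i)"
  unfolding flux_def
  by (intro Ck_on_mult Ck_on_sum Ck_on_inner Ck_density Ck_gram_inv Ck_partial Ck_G open_U)

lemma has_derivative_flux:
  assumes y: "y \<in> U" and u: "(u has_derivative u') (at y)"
  defines "b \<equiv> partial G y" and "N \<equiv> gram_inv (partial G y)"
    and "Db \<equiv> (\<lambda>j. frechet_derivative (\<lambda>y. partial G y j) (at y))"
    and "DG \<equiv> frechet_derivative G (at y)"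
  defines "A' \<equiv> (\<lambda>k l v. b k \<bullet> Db l v + Db k v \<bullet> b l)"
  shows "(flux u i has_derivative (\<lambda>v.
     u y * (density y * (\<Sum>j\<in>UNIV. N $ i $ j * (b j \<bullet> DG v + Db j v \<bullet> G y)
          + - (\<Sum>k\<in>UNIV. \<Sum>l\<in>UNIV. N $ i $ k * A' k l v * N $ l $ j) * (b j \<bullet> G y))
        + density y * ((\<Sum>k\<in>UNIV. \<Sum>l\<in>UNIV. A' k l v * N $ l $ k) / 2)
          * (\<Sum>j\<in>UNIV. N $ i $ j * (b j \<bullet> G y)))
      + u' v * (density y * (\<Sum>j\<in>UNIV. N $ i $ j * (b j \<bullet> G y))))) (at y)"
proof -
  have hb: "((\<lambda>y. partial G y j) has_derivative Db j) (at y)" for j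
    unfolding Db_def by (rule has_derivative_partial[OF y])
  have hG: "(G has_derivative DG) (at y)"
    unfolding DG_def by (rule has_derivative_G[OF y])
  have hA: "((\<lambda>y. gram (partial G y) $ k $ l) has_derivative A' k l) (at y)" for k l
    unfolding A'_def b_def using has_derivative_inner[OF hb[of k] hb[of l]] by (simp add: gram_def)
  define N' where "N' = (\<lambda>i j. frechet_derivative (\<lambda>y. gram_inv (partial G y) $ i $ j) (at y))"
  have hN: "((\<lambda>y. gram_inv (partial G y) $ i $ j) has_derivative N' i j) (at y)" for i j
    unfolding N'_def by (rule Ck_on_SucD[OF Ck_gram_inv y])
  have inv: "gram_inv (partial G z) ** gram (partial G z) = mat 1" if "z \<in> U" for z
    using matrix_inv_left[OF invertible_gram[OF frame_G[OF that]]] by (simp add: gram_inv_def)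
  have N': "N' i j v = - (\<Sum>k\<in>UNIV. \<Sum>l\<in>UNIV. N $ i $ k * A' k l v * N $ l $ j)" for i j v
    unfolding N_def by (rule derivative_inverse_matrix[OF hA hN open_U y inv])
  have hd: "(density has_derivative
     (\<lambda>v. density y * ((\<Sum>k\<in>UNIV. \<Sum>l\<in>UNIV. A' k l v * N $ l $ k) / 2))) (at y)"
  proof -
    have pos: "det (gram b) > 0" using det_gram_pos[OF frame_G[OF y]] by (simp add: b_def)
    have "((\<lambda>y. sqrt (det (gram (partial G y)))) has_derivative
      (\<lambda>v. det (gram b) * (\<Sum>k\<in>UNIV. \<Sum>l\<in>UNIV. A' k l v * N $ l $ k) *
         (inverse (sqrt (det (gram b))) / 2))) (at y)"
      unfolding b_def
      by (rule has_derivative_real_sqrt[OF _ has_derivative_det[OF hA inv[OF y], folded N_def]])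
        (use pos in \<open>simp add: b_def\<close>)
    moreover have "det (gram b) * s * (inverse (sqrt (det (gram b))) / 2) = density y * (s / 2)" for s
    proof -
      have "det (gram b) = sqrt (det (gram b)) * sqrt (det (gram b))" using pos by simp
      then show ?thesis using pos unfolding density_def b_def[symmetric]
        by (simp add: field_simps)
    qed
    ultimately show ?thesis by (simp only: density_def[abs_def])
  qed
  have "((\<lambda>y. u y * (density y * (\<Sum>j\<in>UNIV. gram_inv (partial G y) $ i $ j * (partial G y j \<bullet> G y))))
    has_derivative (\<lambda>v.
     u y * (density y * (\<Sum>j\<in>UNIV. gram_inv (partial G y) $ i $ j * (partial G y j \<bullet> DG v + Db j v \<bullet> G y)
          + N' i j v * (partial G y j \<bullet> G y))
        + density y * ((\<Sum>k\<in>UNIV. \<Sum>l\<in>UNIV. A' k l v * N $ l $ k) / 2)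
          * (\<Sum>j\<in>UNIV. gram_inv (partial G y) $ i $ j * (partial G y j \<bullet> G y)))
      + u' v * (density y * (\<Sum>j\<in>UNIV. gram_inv (partial G y) $ i $ j * (partial G y j \<bullet> G y))))) (at y)"
    by (intro has_derivative_mult u hd has_derivative_sum hN has_derivative_inner hb hG)
  then show ?thesis
    by (simp only: flux_def[abs_def] N' N_def b_def)
qed

text \<open>Three sources: differentiating u gives the gradient term; differentiating the factor G
  gives the trace of the metric with its inverse, which is the dimension; differentiating the
  density, the inverse metric and the frame gives, by \<open>coordinate_laplacian_eq\<close>, the
  mean curvature vector paired with G.\<close>

lemma divergence_flux:
  assumes y: "y \<in> U" and u: "(u has_derivative u') (at y)"
  shows "(\<Sum>i\<in>UNIV. frechet_derivative (flux u i) (at y) (axis i 1)) =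
    density y * (u y * (real CARD('n) + coord_mcv G y \<bullet> G y)
      + raise (partial G y) (\<lambda>i. u' (axis i 1)) \<bullet> G y)"
proof -
  define b where "b = partial G y"
  define N where "N = gram_inv b"
  define c where "c i j = partial (\<lambda>y. partial G y j) y i" for i j
  define g' where "g' i k l = c i k \<bullet> b l + b k \<bullet> c i l" for i k l
  have fr: "frame b" unfolding b_def by (rule frame_G[OF y])
  have sym: "c i j = c j i" for i j unfolding c_def by (rule partial_partial_sym[OF y])
  let ?e = "\<lambda>i. \<Sum>j\<in>UNIV. N $ i $ j * (b j \<bullet> G y)"
  let ?t = "\<lambda>i. \<Sum>k\<in>UNIV. \<Sum>l\<in>UNIV. g' i k l * N $ l $ k"
  let ?q = "\<lambda>i j. \<Sum>k\<in>UNIV. \<Sum>l\<in>UNIV. N $ i $ k * g' i k l * N $ l $ j"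
  have fd: "frechet_derivative (flux u i) (at y) (axis i 1) =
     u y * (density y * (\<Sum>j\<in>UNIV. N $ i $ j * (b j \<bullet> b i + c i j \<bullet> G y) + - ?q i j * (b j \<bullet> G y))
        + density y * (?t i / 2) * ?e i) + u' (axis i 1) * (density y * ?e i)" for i
    using frechet_derivative_at[OF has_derivative_flux[OF y u, of i], THEN fun_cong, of "axis i 1"]
    by (simp add: b_def N_def g'_def c_def partial_def add.commute)
  have tr: "(\<Sum>i\<in>UNIV. \<Sum>j\<in>UNIV. N $ i $ j * (b j \<bullet> b i)) = real CARD('n)"
    by (simp add: N_def gram_inv_gram[OF fr])
  have W: "(\<Sum>i\<in>UNIV. ?t i / 2 * ?e i) - (\<Sum>i\<in>UNIV. \<Sum>j\<in>UNIV. ?q i j * (b j \<bullet> G y))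
      + (\<Sum>i\<in>UNIV. \<Sum>j\<in>UNIV. N $ i $ j * (c i j \<bullet> G y)) = coord_mcv G y \<bullet> G y"
  proof -
    have "coord_mcv G y = (\<Sum>i\<in>UNIV. \<Sum>j\<in>UNIV. N $ i $ j *\<^sub>R (c i j - proj b (c i j)))"
      by (simp add: coord_mcv_def N_def b_def c_def)
    also have "\<dots> = (\<Sum>i\<in>UNIV. \<Sum>j\<in>UNIV. (?t i / 2 * N $ i $ j) *\<^sub>R b j)
     - (\<Sum>i\<in>UNIV. \<Sum>j\<in>UNIV. ?q i j *\<^sub>R b j) + (\<Sum>i\<in>UNIV. \<Sum>j\<in>UNIV. N $ i $ j *\<^sub>R c i j)"
      using coordinate_laplacian_eq[OF fr, of c, OF sym] by (simp only: N_def g'_def)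
    finally have "coord_mcv G y \<bullet> G y = ((\<Sum>i\<in>UNIV. \<Sum>j\<in>UNIV. (?t i / 2 * N $ i $ j) *\<^sub>R b j)
     - (\<Sum>i\<in>UNIV. \<Sum>j\<in>UNIV. ?q i j *\<^sub>R b j) + (\<Sum>i\<in>UNIV. \<Sum>j\<in>UNIV. N $ i $ j *\<^sub>R c i j)) \<bullet> G y"
      by (simp only:)
    then show ?thesis
      by (simp only: inner_add_left inner_diff_left inner_sum_left inner_scaleR_left
          sum_distrib_left mult.assoc)
  qed
  have ra: "raise b (\<lambda>i. u' (axis i 1)) \<bullet> G y = (\<Sum>i\<in>UNIV. u' (axis i 1) * ?e i)"
    by (simp add: raise_dot N_def sum_distrib_left mult_ac)
  have "(\<Sum>i\<in>UNIV. frechet_derivative (flux u i) (at y) (axis i 1)) =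
    (\<Sum>i\<in>UNIV. density y * (u y * ((\<Sum>j\<in>UNIV. N $ i $ j * (b j \<bullet> b i))
       + ((?t i / 2) * ?e i - (\<Sum>j\<in>UNIV. ?q i j * (b j \<bullet> G y)) + (\<Sum>j\<in>UNIV. N $ i $ j * (c i j \<bullet> G y))))
       + u' (axis i 1) * ?e i))"
  proof (rule sum.cong[OF refl])
    fix i
    have "(\<Sum>j\<in>UNIV. N $ i $ j * (b j \<bullet> b i + c i j \<bullet> G y) + - ?q i j * (b j \<bullet> G y)) =
      (\<Sum>j\<in>UNIV. N $ i $ j * (b j \<bullet> b i)) - (\<Sum>j\<in>UNIV. ?q i j * (b j \<bullet> G y))
        + (\<Sum>j\<in>UNIV. N $ i $ j * (c i j \<bullet> G y))"
      by (simp add: distrib_left sum.distrib sum_negf sum_subtractf)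
    moreover have alg: "u y * (density y * (s1 - s2 + s3) + density y * (t / 2) * e) + w * (density y * e) =
       density y * (u y * (s1 + ((t / 2) * e - s2 + s3)) + w * e)" for s1 s2 s3 t e w :: real
      by (simp add: algebra_simps)
    ultimately show "frechet_derivative (flux u i) (at y) (axis i 1) = density y * (u y * ((\<Sum>j\<in>UNIV. N $ i $ j * (b j \<bullet> b i))
       + ((?t i / 2) * ?e i - (\<Sum>j\<in>UNIV. ?q i j * (b j \<bullet> G y)) + (\<Sum>j\<in>UNIV. N $ i $ j * (c i j \<bullet> G y))))
       + u' (axis i 1) * ?e i)"
      unfolding fd by (simp only: alg)
  qed
  also have "\<dots> = density y * (u y * ((\<Sum>i\<in>UNIV. \<Sum>j\<in>UNIV. N $ i $ j * (b j \<bullet> b i))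
       + ((\<Sum>i\<in>UNIV. (?t i / 2) * ?e i) - (\<Sum>i\<in>UNIV. \<Sum>j\<in>UNIV. ?q i j * (b j \<bullet> G y))
       + (\<Sum>i\<in>UNIV. \<Sum>j\<in>UNIV. N $ i $ j * (c i j \<bullet> G y)))) + (\<Sum>i\<in>UNIV. u' (axis i 1) * ?e i))"
    by (simp only: sum_distrib_left[symmetric] sum.distrib sum_subtractf)
  finally show ?thesis
    unfolding tr W ra[symmetric] by (simp only: b_def)
qed

text \<open>The flux vanishes off the compact set K inside U, so it is of class C^1 on the whole
  space and each of its partial derivatives integrates to zero.\<close>

theorem local_divergence:
  assumes u: "Ck_on 1 U u" and K: "compact K" "K \<subseteq> U" "\<And>y. y \<notin> K \<Longrightarrow> u y = 0"
  defines "I \<equiv> (\<lambda>y. indicator U y * (density y * (u y * (real CARD('n) + coord_mcv G y \<bullet> G y)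
      + raise (partial G y) (partial u y) \<bullet> G y)))"
  shows "integrable lborel I" "(LINT y|lborel. I y) = 0"
proof -
  have open_K: "open (- K)" using K compact_imp_closed by auto
  have flux0: "flux u i y = 0" if "y \<notin> K" for i y using K(3)[OF that] by (simp add: flux_def)
  have "Ck_on 1 (U \<union> - K) (flux u i)" for i
  proof (rule Ck_on_Un[OF open_U open_K Ck_flux[OF u]])
    show "Ck_on 1 (- K) (flux u i)"
      using Ck_on_cong[OF open_K, of "flux u i" "\<lambda>_. 0" 1] Ck_on_const[OF open_K] flux0 by simp
  qed
  moreover have "U \<union> - K = UNIV" using K by auto
  ultimately have C1: "Ck_on (Suc 0) UNIV (flux u i)" for i by simp
  have der: "(flux u i has_derivative frechet_derivative (flux u i) (at y)) (at y)" for i y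
    using Ck_on_SucD[OF C1] by simp
  have cont: "continuous_on UNIV (\<lambda>y. frechet_derivative (flux u i) (at y) v)" for i v
    using C1 by simp
  note int = integral_derivative_zero[OF der cont K(1) flux0]
  have I: "I = (\<lambda>y. \<Sum>i\<in>UNIV. frechet_derivative (flux u i) (at y) (axis i 1))"
  proof
    fix y
    show "I y = (\<Sum>i\<in>UNIV. frechet_derivative (flux u i) (at y) (axis i 1))"
    proof (cases "y \<in> U")
      case True
      have "(u has_derivative frechet_derivative u (at y)) (at y)"
        using Ck_on_SucD[of 0 U u y] u True by simp
      from divergence_flux[OF True this] show ?thesis
        using True by (simp add: I_def partial_def[of u, abs_def])
    next
      case False
      then have "y \<in> - K" using K by auto
      have "frechet_derivative (flux u i) (at y) = (\<lambda>v. 0)" for i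
      proof -
        have "((\<lambda>y. 0) has_derivative frechet_derivative (flux u i) (at y)) (at y)"
          by (rule has_derivative_transform_within_open[OF der open_K \<open>y \<in> - K\<close>]) (use flux0 in auto)
        from has_derivative_unique[OF this has_derivative_const] show ?thesis .
      qed
      then show ?thesis using False by (simp add: I_def)
    qed
  qed
  show "integrable lborel I" unfolding I by (intro Bochner_Integration.integrable_sum int)
  show "(LINT y|lborel. I y) = 0"
    unfolding I using int by (simp add: Bochner_Integration.integral_sum)
qed

end

section \<open>Independence of the chart\<close>

lemma differentiable_imp_lin_comb_partial:
  assumes "G differentiable (at y)"
  shows "frechet_derivative G (at y) v = lin_comb (partial G y) v"
proof -
  have "linear (frechet_derivative G (at y))"
    using assms by (rule linear_frechet_derivative)
  then have "frechet_derivative G (at y) (\<Sum>i\<in>UNIV. v $ i *\<^sub>R axis i 1) = lin_comb (partial G y) v"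
    by (simp add: linear_sum linear_scale lin_comb_def partial_def)
  then show ?thesis
    using basis_expansion[of v] by (simp add: scalar_mult_eq_scaleR)
qed

lemma partial_eqI:
  assumes "(G has_derivative G') (at y)"
  shows "partial G y i = G' (axis i 1)"
  using frechet_derivative_at[OF assms] by (simp add: partial_def)

lemma partial_transform:
  assumes "open S" "y \<in> S" "f differentiable (at y)" "\<And>z. z \<in> S \<Longrightarrow> f z = g z"
  shows "partial g y = partial f y"
  using frechet_derivative_transform_within_open[OF assms(3,1,2,4)] by (simp add: partial_def[abs_def])

lemma partial_compose:
  fixes f :: "real ^ 'n::finite \<Rightarrow> 'b::real_inner" and \<tau> :: "real ^ 'n \<Rightarrow> real ^ 'n"
  assumes W: "open W" "y \<in> W" and "\<tau> differentiable (at y)" "f differentiable (at (\<tau> y))"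
    and eq: "\<And>z. z \<in> W \<Longrightarrow> f' z = f (\<tau> z)"
  shows "f' differentiable (at y)"
    and "partial f' y j = (\<Sum>l\<in>UNIV. partial \<tau> y j $ l *\<^sub>R partial f (\<tau> y) l)"
proof -
  have "((\<lambda>z. f (\<tau> z)) has_derivative
      (\<lambda>v. frechet_derivative f (at (\<tau> y)) (frechet_derivative \<tau> (at y) v))) (at y)"
    by (rule has_derivative_compose) (use assms in \<open>simp_all add: frechet_derivative_works[symmetric]\<close>)
  then have d: "(f' has_derivative (\<lambda>v. frechet_derivative f (at (\<tau> y)) (frechet_derivative \<tau> (at y) v))) (at y)"
    by (rule has_derivative_transform_within_open[OF _ W]) (simp add: eq)
  then show "f' differentiable (at y)" by (auto simp: differentiable_def)
  show "partial f' y j = (\<Sum>l\<in>UNIV. partial \<tau> y j $ l *\<^sub>R partial f (\<tau> y) l)"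
    using partial_eqI[OF d, of j]
    unfolding differentiable_imp_lin_comb_partial[OF assms(4)] lin_comb_def partial_def[of \<tau>] .
qed

lemma coord_mcv_inner_normal:
  fixes G :: "real ^ 'n::finite \<Rightarrow> 'v::real_inner"
  assumes fr: "frame (partial G y)" and normal: "\<And>k. partial G y k \<bullet> w = 0"
  shows "coord_mcv G y \<bullet> w =
    (\<Sum>i\<in>UNIV. \<Sum>j\<in>UNIV. gram_inv (partial G y) $ i $ j * (partial (\<lambda>y. partial G y j) y i \<bullet> w))"
proof -
  have "proj (partial G y) z \<bullet> w = 0" for z
    using normal by (simp add: proj_def raise_dot)
  then show ?thesis
    by (simp add: coord_mcv_def inner_sum_left inner_diff_left)
qed

lemma coord_mcv_normal:
  fixes G :: "real ^ 'n::finite \<Rightarrow> 'v::real_inner"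
  assumes fr: "frame (partial G y)"
  shows "coord_mcv G y \<bullet> partial G y k = 0"
  by (simp add: coord_mcv_def inner_sum_left inner_diff_left proj_def raise_inner[OF fr])

text \<open>By the chain rule the second derivatives of G' are those of G, transformed by the
  Jacobian, plus a combination of frame vectors. Both mean curvature vectors are normal to the
  common tangent space, hence so is their difference w. Paired with w the additional term drops out
  and the trace is invariant, which gives w \<bullet> w = 0.\<close>

lemma reparametrization:
  fixes G G' :: "real ^ 'n::finite \<Rightarrow> 'v::euclidean_space"
  assumes P: "parametrization U G" and P': "parametrization U' G'"
    and W: "open W" "W \<subseteq> U'" and \<tau>: "smooth_on W \<tau>" "\<tau> ` W \<subseteq> U"
    and eq: "\<And>z. z \<in> W \<Longrightarrow> G' z = G (\<tau> z)" and y: "y \<in> W"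
  shows "partial G' y = change_frame (\<chi> l j. partial \<tau> y j $ l) (partial G (\<tau> y))"
    and "coord_mcv G' y = coord_mcv G (\<tau> y)"
proof -
  interpret G: parametrization U G by fact
  interpret G': parametrization U' G' by fact
  let ?T = "\<lambda>z. (\<chi> l j. partial \<tau> z j $ l) :: real ^ 'n ^ 'n"
  have inU: "\<tau> z \<in> U" "z \<in> U'" if "z \<in> W" for z using that W \<tau> by auto
  have d\<tau>: "(\<tau> has_derivative frechet_derivative \<tau> (at z)) (at z)" if "z \<in> W" for z
    by (rule Ck_on_SucD[of 0 W]) (use \<tau>(1) that in \<open>simp_all add: smooth_on_def del: Ck_on.simps\<close>)
  have p: "partial G' z j = (\<Sum>l\<in>UNIV. partial \<tau> z j $ l *\<^sub>R partial G (\<tau> z) l)" if "z \<in> W" for z j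
    using partial_compose(2)[OF W(1) that, of \<tau> G G' j] d\<tau>[OF that] G.has_derivative_G[OF inU(1)[OF that]] eq
    by (auto simp: differentiable_def)
  then show ch: "partial G' y = change_frame (?T y) (partial G (\<tau> y))"
    using y by (auto simp: change_frame_def)
  let ?b = "partial G (\<tau> y)"
  let ?c = "\<lambda>i j. partial (\<lambda>z. partial G z j) (\<tau> y) i"
  have second: "partial (\<lambda>z. partial G' z j) y i =
      (\<Sum>l\<in>UNIV. partial \<tau> y j $ l *\<^sub>R (\<Sum>m\<in>UNIV. partial \<tau> y i $ m *\<^sub>R ?c m l)
        + frechet_derivative (\<lambda>z. partial \<tau> z j $ l) (at y) (axis i 1) *\<^sub>R ?b l)" for i j
  proof -
    have C1: "Ck_on 1 W (\<lambda>z. partial \<tau> z j $ l)" for l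
    proof -
      have "Ck_on (Suc 1) W \<tau>" using \<tau>(1) by (simp add: smooth_on_def)
      then have "Ck_on 1 W (\<lambda>z. partial \<tau> z j)" by (simp add: partial_def)
      from Ck_on_inner[OF W(1) this Ck_on_const[OF W(1), of 1 "axis l 1"]]
      show ?thesis by (simp add: inner_axis)
    qed
    have d1: "((\<lambda>z. partial \<tau> z j $ l) has_derivative frechet_derivative (\<lambda>z. partial \<tau> z j $ l) (at y)) (at y)" for l
      using Ck_on_SucD[of 0 W "\<lambda>z. partial \<tau> z j $ l" y] C1 y by simp
    have d2: "((\<lambda>z. partial G (\<tau> z) l) has_derivative
        (\<lambda>v. frechet_derivative (\<lambda>z. partial G z l) (at (\<tau> y)) (frechet_derivative \<tau> (at y) v))) (at y)" for l
      by (rule has_derivative_compose[OF d\<tau>[OF y] G.has_derivative_partial[OF inU(1)[OF y]]])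
    have "((\<lambda>z. \<Sum>l\<in>UNIV. partial \<tau> z j $ l *\<^sub>R partial G (\<tau> z) l) has_derivative
      (\<lambda>v. \<Sum>l\<in>UNIV. partial \<tau> y j $ l *\<^sub>R
          frechet_derivative (\<lambda>z. partial G z l) (at (\<tau> y)) (frechet_derivative \<tau> (at y) v)
        + frechet_derivative (\<lambda>z. partial \<tau> z j $ l) (at y) v *\<^sub>R ?b l)) (at y)"
      by (intro has_derivative_sum has_derivative_scaleR d1 d2)
    then have "((\<lambda>z. partial G' z j) has_derivative
      (\<lambda>v. \<Sum>l\<in>UNIV. partial \<tau> y j $ l *\<^sub>R
          frechet_derivative (\<lambda>z. partial G z l) (at (\<tau> y)) (frechet_derivative \<tau> (at y) v)
        + frechet_derivative (\<lambda>z. partial \<tau> z j $ l) (at y) v *\<^sub>R ?b l)) (at y)"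
      by (rule has_derivative_transform_within_open[OF _ W(1) y]) (simp add: p)
    from partial_eqI[OF this, of i]
    have "partial (\<lambda>z. partial G' z j) y i = (\<Sum>l\<in>UNIV. partial \<tau> y j $ l *\<^sub>R
          frechet_derivative (\<lambda>z. partial G z l) (at (\<tau> y)) (frechet_derivative \<tau> (at y) (axis i 1))
        + frechet_derivative (\<lambda>z. partial \<tau> z j $ l) (at y) (axis i 1) *\<^sub>R ?b l)" .
    moreover have "frechet_derivative (\<lambda>z. partial G z l) (at (\<tau> y)) v =
        (\<Sum>m\<in>UNIV. v $ m *\<^sub>R ?c m l)" for l v
      using differentiable_imp_lin_comb_partial[of "\<lambda>z. partial G z l" "\<tau> y" v]
        G.has_derivative_partial[OF inU(1)[OF y], of l]
      by (auto simp: differentiable_def lin_comb_def)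
    moreover have "frechet_derivative \<tau> (at y) (axis i 1) = partial \<tau> y i"
      by (simp add: partial_def)
    ultimately show ?thesis by (simp only:)
  qed
  have frb: "frame ?b" "frame (partial G' y)"
    using G.frame_G G'.frame_G inU[OF y] by auto
  define w where "w = coord_mcv G' y - coord_mcv G (\<tau> y)"
  have n': "coord_mcv G (\<tau> y) \<bullet> partial G' y k = 0" for k
    by (simp add: ch change_frame_def inner_sum_right coord_mcv_normal[OF frb(1)])
  have n: "coord_mcv G' y \<bullet> ?b k = 0" for k
  proof -
    have "?b k \<in> range (lin_comb (partial G' y))"
    proof -
      have "det (gram (partial G' y)) \<noteq> 0" using det_gram_pos[OF frb(2)] by simp
      \<comment> \<open>The new Gram determinant is nonzero and equals (det T)^2 times the old one.
        So the old frame vectors are combinations of the new ones.\<close>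
      then have T: "invertible (?T y)" by (auto simp: ch gram_change_frame det_mul invertible_det_nz)
      have "lin_comb (partial G' y) v = lin_comb ?b (?T y *v v)" for v
        unfolding ch by (rule lin_comb_change_frame)
      then have "lin_comb (partial G' y) (matrix_inv (?T y) *v axis k 1) = ?b k"
        by (simp add: matrix_vector_mul_assoc matrix_inv_right[OF T] matrix_vector_mul_lid)
      then show ?thesis by (metis rangeI)
    qed
    then obtain v where "?b k = lin_comb (partial G' y) v" by blast
    then show ?thesis
      by (simp add: lin_comb_def inner_sum_right coord_mcv_normal[OF frb(2)])
  qed
  have wb: "?b k \<bullet> w = 0" and wb': "partial G' y k \<bullet> w = 0" for k
    unfolding w_def
    using n n' coord_mcv_normal[OF frb(1)] coord_mcv_normal[OF frb(2)]
    by (simp_all add: inner_diff_right inner_commute)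
  have B: "partial (\<lambda>z. partial G' z j) y i \<bullet> w =
      (transpose (?T y) ** (\<chi> m l. ?c m l \<bullet> w) ** ?T y) $ i $ j" for i j
  proof -
    have "partial (\<lambda>z. partial G' z j) y i \<bullet> w =
       (\<Sum>l\<in>UNIV. partial \<tau> y j $ l * (\<Sum>m\<in>UNIV. partial \<tau> y i $ m * (?c m l \<bullet> w)))"
      by (simp add: second inner_sum_left inner_add_left wb)
    then show ?thesis
      by (simp add: matrix_matrix_mult_def transpose_def mult.commute)
  qed
  have "coord_mcv G' y \<bullet> w = (\<Sum>i\<in>UNIV. \<Sum>j\<in>UNIV. gram_inv (change_frame (?T y) ?b) $ i $ j *
      (transpose (?T y) ** (\<chi> m l. ?c m l \<bullet> w) ** ?T y) $ i $ j)"
    by (simp add: coord_mcv_inner_normal[OF frb(2) wb'] B ch)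
  also have "\<dots> = (\<Sum>i\<in>UNIV. \<Sum>j\<in>UNIV. gram_inv ?b $ i $ j * (\<chi> m l. ?c m l \<bullet> w) $ i $ j)"
    by (rule trace_gram_inv_change_frame[OF frb(1) _ refl]) (use frb(2) ch in simp)
  also have "\<dots> = coord_mcv G (\<tau> y) \<bullet> w"
    by (simp add: coord_mcv_inner_normal[OF frb(1) wb])
  finally have "w \<bullet> w = 0"
    by (subst (1) w_def) (simp add: inner_diff_left)
  then show "coord_mcv G' y = coord_mcv G (\<tau> y)" by (simp add: w_def)
qed

section \<open>Geometric quantities of the immersion, computed in an arbitrary chart\<close>

locale immersed_manifold =
  fixes A :: "('m::{t2_space, second_countable_topology}, 'n::finite) chart set"
    and F :: "'m \<Rightarrow> 'v::euclidean_space"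
  assumes atlas: "smooth_atlas A" and immersion: "immersion A F"
begin

abbreviation coord_dom :: "('m, 'n) chart \<Rightarrow> (real ^ 'n) set" where
  "coord_dom c \<equiv> snd c ` fst c"

abbreviation rep :: "('m, 'n) chart \<Rightarrow> real ^ 'n \<Rightarrow> 'v" where
  "rep c \<equiv> F \<circ> chart_inv c"

lemma chart:
  assumes "c \<in> A"
  shows "open (fst c)" "open (coord_dom c)" "continuous_on (fst c) (snd c)" "continuous_on (coord_dom c) (chart_inv c)"
    "\<And>p. p \<in> fst c \<Longrightarrow> chart_inv c (snd c p) = p"
    "\<And>y. y \<in> coord_dom c \<Longrightarrow> snd c (chart_inv c y) = y" "\<And>y. y \<in> coord_dom c \<Longrightarrow> chart_inv c y \<in> fst c"
  using assms atlas unfolding smooth_atlas_def is_chart_def homeomorphism_def by (auto 4 4)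

lemma chart_at: "chart_at A p \<in> A" "p \<in> fst (chart_at A p)"
proof -
  have "p \<in> (\<Union>c\<in>A. fst c)" using atlas by (simp add: smooth_atlas_def)
  then have "\<exists>c. c \<in> A \<and> p \<in> fst c" by blast
  then have "chart_at A p \<in> A \<and> p \<in> fst (chart_at A p)"
    unfolding chart_at_def by (rule someI_ex)
  then show "chart_at A p \<in> A" "p \<in> fst (chart_at A p)" by auto
qed

lemma smooth_map_D: "smooth_map A u \<Longrightarrow> c \<in> A \<Longrightarrow> Ck_on k (coord_dom c) (u \<circ> chart_inv c)"
  by (simp add: smooth_map_def smooth_on_def)

lemma smooth_map_differentiable:
  assumes "smooth_map A u" "c \<in> A" "y \<in> coord_dom c"
  shows "(u \<circ> chart_inv c) differentiable (at y)"
  using Ck_on_SucD[OF smooth_map_D[OF assms(1,2), of "Suc 0"] assms(3)] by (auto simp: differentiable_def)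

lemma smooth_map_F: "smooth_map A F"
  using immersion by (simp add: immersion_def)

lemma chart_deriv_eq:
  assumes "smooth_map A u" "c \<in> A" "p \<in> fst c"
  shows "chart_deriv c u p v = lin_comb (partial (u \<circ> chart_inv c) (snd c p)) v"
  unfolding chart_deriv_def
  by (rule differentiable_imp_lin_comb_partial) (use smooth_map_differentiable assms in blast)

lemma parametrization_rep:
  assumes c: "c \<in> A"
  shows "parametrization (coord_dom c) (rep c)"
proof
  show "open (coord_dom c)" by (rule chart[OF c])
  show "smooth_on (coord_dom c) (rep c)"
    using smooth_map_F c by (simp add: smooth_map_def)
  fix y assume y: "y \<in> coord_dom c"
  define p where "p = chart_inv c y"
  have p: "p \<in> fst c" "snd c p = y" using chart[OF c] y by (auto simp: p_def)
  have "inj (chart_deriv c F p)" using immersion c p(1) by (simp add: immersion_def)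
  moreover have "chart_deriv c F p = lin_comb (partial (rep c) y)"
    using chart_deriv_eq[OF smooth_map_F c p(1)] p(2) by auto
  ultimately have "inj (lin_comb (partial (rep c) y))" by simp
  then show "frame (partial (rep c) y)"
    using linear_injective_0[OF lin_comb_linear] by (auto simp: frame_def)
qed

definition tframe :: "('m, 'n) chart \<Rightarrow> 'm \<Rightarrow> 'n \<Rightarrow> 'v" where
  "tframe c p = partial (rep c) (snd c p)"

lemma frame_tframe: "c \<in> A \<Longrightarrow> p \<in> fst c \<Longrightarrow> frame (tframe c p)"
  unfolding tframe_def by (rule parametrization.frame_G[OF parametrization_rep]) auto

lemma coord_field_eq: "coord_field c F i p = tframe c p i"
  by (simp add: coord_field_def chart_deriv_def tframe_def partial_def)

lemma metric_matrix_eq: "metric_matrix c F p = gram (tframe c p)"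
  by (simp add: metric_matrix_def coord_field_eq gram_def)

abbreviation overlap :: "('m, 'n) chart \<Rightarrow> ('m, 'n) chart \<Rightarrow> (real ^ 'n) set" where
  "overlap d c \<equiv> snd d ` (fst d \<inter> fst c)"

abbreviation transition :: "('m, 'n) chart \<Rightarrow> ('m, 'n) chart \<Rightarrow> real ^ 'n \<Rightarrow> real ^ 'n" where
  "transition d c \<equiv> snd c \<circ> chart_inv d"

lemma overlap_eq: "d \<in> A \<Longrightarrow> overlap d c = coord_dom d \<inter> chart_inv d -` fst c"
  using chart[of d] by (auto simp: image_iff)

lemma open_overlap: "d \<in> A \<Longrightarrow> c \<in> A \<Longrightarrow> open (overlap d c)"
  unfolding overlap_eq
  using chart(2,4)[of d] chart(1)[of c] by (metis continuous_on_open_vimage Int_commute)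

lemma transition:
  assumes "d \<in> A" "c \<in> A"
  shows "smooth_on (overlap d c) (transition d c)" "transition d c ` overlap d c \<subseteq> coord_dom c"
    "\<And>z. z \<in> overlap d c \<Longrightarrow> chart_inv c (transition d c z) = chart_inv d z"
  using assms atlas chart[OF assms(1)] chart[OF assms(2)] by (auto simp: smooth_atlas_def)

lemma change_of_chart:
  assumes "d \<in> A" "c \<in> A" "p \<in> fst d" "p \<in> fst c"
  defines "T \<equiv> (\<chi> l j. partial (transition d c) (snd d p) j $ l)"
  shows "tframe d p = change_frame T (tframe c p)"
    and "coord_mcv (rep d) (snd d p) = coord_mcv (rep c) (snd c p)"
    and "\<And>u. smooth_map A u \<Longrightarrow> partial (u \<circ> chart_inv d) (snd d p) j =
      (\<Sum>l\<in>UNIV. T $ l $ j * partial (u \<circ> chart_inv c :: _ \<Rightarrow> real) (snd c p) l)"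
proof -
  have y: "snd d p \<in> overlap d c" "transition d c (snd d p) = snd c p"
    using assms chart[OF assms(1)] by auto
  have sub: "overlap d c \<subseteq> coord_dom d" by auto
  have eq: "rep d z = rep c (transition d c z)" if "z \<in> overlap d c" for z
    using transition(3)[OF assms(1,2) that] by simp
  note re = reparametrization[where G = "rep c" and G' = "rep d" and \<tau> = "transition d c", OF parametrization_rep[OF assms(2)] parametrization_rep[OF assms(1)]
      open_overlap[OF assms(1,2)] sub transition(1,2)[OF assms(1,2)] eq y(1)]
  show "tframe d p = change_frame T (tframe c p)"
    using re(1) y(2) by (simp add: tframe_def T_def)
  show "coord_mcv (rep d) (snd d p) = coord_mcv (rep c) (snd c p)"
    using re(2) y(2) by simp
  fix u :: "'m \<Rightarrow> real" assume u: "smooth_map A u"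
  have d: "transition d c differentiable (at (snd d p))"
  proof -
    have "Ck_on (Suc 0) (overlap d c) (transition d c)"
      using transition(1)[OF assms(1,2)] unfolding smooth_on_def by blast
    from Ck_on_SucD[OF this y(1)] show ?thesis by (auto simp: differentiable_def)
  qed
  have d': "(u \<circ> chart_inv c) differentiable (at (transition d c (snd d p)))"
    unfolding y(2) using smooth_map_differentiable[OF u assms(2)] assms(4) by blast
  have equ: "(u \<circ> chart_inv d) z = (u \<circ> chart_inv c) (transition d c z)" if "z \<in> overlap d c" for z
    using transition(3)[OF assms(1,2) that] by simp
  show "partial (u \<circ> chart_inv d) (snd d p) j =
      (\<Sum>l\<in>UNIV. T $ l $ j * partial (u \<circ> chart_inv c) (snd c p) l)"
    using partial_compose(2)[where f = "u \<circ> chart_inv c" and f' = "u \<circ> chart_inv d"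
        and \<tau> = "transition d c", OF open_overlap[OF assms(1,2)] y(1) d d' equ, of j] y(2)
    by (simp add: T_def)
qed

lemma range_tframe:
  assumes "d \<in> A" "c \<in> A" "p \<in> fst d" "p \<in> fst c"
  shows "range (lin_comb (tframe d p)) = range (lin_comb (tframe c p))"
  using change_of_chart(1)[OF assms] change_of_chart(1)[OF assms(2,1,4,3)] range_change_frame
  by (metis subset_antisym)

text \<open>Replaces the chosen chart \<open>chart_at A p\<close> by any chart around p, as a
  computation over a fixed coordinate domain requires.\<close>

lemma tangent_space_eq:
  assumes "c \<in> A" "p \<in> fst c"
  shows "tangent_space A F p = range (lin_comb (tframe c p))"
proof -
  have "chart_deriv (chart_at A p) F p = lin_comb (tframe (chart_at A p) p)"
    using chart_deriv_eq[OF smooth_map_F chart_at] by (auto simp: tframe_def)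
  then show ?thesis
    unfolding tangent_space_def using range_tframe[OF chart_at(1) assms(1) chart_at(2) assms(2)] by simp
qed

lemma tangent_part_eq:
  assumes "c \<in> A" "p \<in> fst c"
  shows "tangent_part A F p v = proj (tframe c p) v"
  unfolding tangent_part_def tangent_space_eq[OF assms]
proof (rule the_equality)
  let ?b = "tframe c p"
  note fr = frame_tframe[OF assms]
  have "orthogonal (v - proj ?b v) (lin_comb ?b z)" for z
    by (simp add: orthogonal_def inner_commute[of _ "lin_comb ?b z"] lin_comb_inner inner_diff_right)
      (simp add: proj_def inner_commute[of "?b _"] raise_inner[OF fr])
  then show "proj ?b v \<in> range (lin_comb ?b) \<and> (\<forall>z\<in>range (lin_comb ?b). orthogonal (v - proj ?b v) z)"
    by (auto simp: proj_def raise_in_range)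
  fix w assume w: "w \<in> range (lin_comb ?b) \<and> (\<forall>z\<in>range (lin_comb ?b). orthogonal (v - w) z)"
  then have "orthogonal (v - w) (lin_comb ?b (axis k 1))" for k by blast
  then have "w \<bullet> ?b k = v \<bullet> ?b k" for k
    by (simp add: orthogonal_def inner_diff_left)
  with w show "w = proj ?b v" unfolding proj_def by (intro raise_unique fr) auto
qed

text \<open>By \<open>raise_unique\<close> only the inner products with the frame of the new chart
  matter; these are the partial derivatives of u, which transform with the same matrix as the
  frame.\<close>

lemma gradient_eq:
  assumes c: "c \<in> A" "p \<in> fst c" and u: "smooth_map A u"
  shows "gradient A F u p = raise (tframe c p) (partial (u \<circ> chart_inv c) (snd c p))"
proof -
  let ?d = "chart_at A p"
  let ?\<xi> = "partial (u \<circ> chart_inv ?d) (snd ?d p)"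
  have g: "gradient A F u p = raise (tframe ?d p) ?\<xi>"
    by (simp add: gradient_def Let_def raise_def gram_inv_def metric_matrix_eq coord_field_eq
        chart_deriv_def partial_def)
  show ?thesis
  proof (rule raise_unique[OF frame_tframe[OF c]])
    show "gradient A F u p \<in> range (lin_comb (tframe c p))"
      unfolding g range_tframe[OF c(1) chart_at(1) c(2) chart_at(2)] by (rule raise_in_range)
    show "gradient A F u p \<bullet> tframe c p k = partial (u \<circ> chart_inv c) (snd c p) k" for k
      unfolding g change_of_chart(1)[OF c(1) chart_at(1) c(2) chart_at(2)]
        change_of_chart(3)[OF c(1) chart_at(1) c(2) chart_at(2) u]
      by (simp add: change_frame_def inner_sum_right raise_inner[OF frame_tframe[OF chart_at]])
  qed
qed

lemma mean_curvature_vector_eq: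
  assumes c: "c \<in> A" "p \<in> fst c"
  shows "mean_curvature_vector A F p = coord_mcv (rep c) (snd c p)"
proof -
  let ?d = "chart_at A p"
  interpret d: parametrization "coord_dom ?d" "rep ?d" by (rule parametrization_rep[OF chart_at(1)])
  have y: "snd ?d p \<in> coord_dom ?d" using chart_at(2) by blast
  have "chart_deriv ?d (coord_field ?d F j) p (axis i 1) = partial (\<lambda>y. partial (rep ?d) y j) (snd ?d p) i" for i j
  proof -
    have "partial (coord_field ?d F j \<circ> chart_inv ?d) (snd ?d p) = partial (\<lambda>y. partial (rep ?d) y j) (snd ?d p)"
    proof (rule partial_transform[OF d.open_U y])
      show "(\<lambda>y. partial (rep ?d) y j) differentiable (at (snd ?d p))"
        using d.has_derivative_partial[OF y] by (auto simp: differentiable_def)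
    qed (simp add: coord_field_eq tframe_def chart[OF chart_at(1)])
    then show ?thesis by (simp add: chart_deriv_def partial_def fun_eq_iff)
  qed
  then have "mean_curvature_vector A F p = coord_mcv (rep ?d) (snd ?d p)"
    by (simp add: mean_curvature_vector_def second_fundamental_form_def Let_def normal_part_def
        tangent_part_eq[OF chart_at] coord_mcv_def metric_matrix_eq gram_inv_def tframe_def)
  then show ?thesis
    using change_of_chart(2)[OF chart_at(1) c(1) chart_at(2) c(2)] by simp
qed

end

section \<open>The Riemannian measure\<close>

text \<open>A series is an integral for the counting measure, and a nonnegative series may be
  integrated term by term.\<close>

lemma suminf_ennreal_swap:
  fixes f :: "nat \<Rightarrow> nat \<Rightarrow> ennreal"
  shows "(\<Sum>i. \<Sum>j. f i j) = (\<Sum>j. \<Sum>i. f i j)"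
  using nn_integral_suminf[of "\<lambda>j i. f i j" "count_space UNIV"]
  by (simp add: nn_integral_count_space_nat)

lemma disjoint_family_Int: "disjoint_family P \<Longrightarrow> disjoint_family (\<lambda>k. B \<inter> P k)"
  unfolding disjoint_family_on_def by blast

context immersed_manifold
begin

abbreviation dens :: "('m, 'n) chart \<Rightarrow> real ^ 'n \<Rightarrow> real" where
  "dens c \<equiv> parametrization.density (rep c)"

lemma dens_pos: "c \<in> A \<Longrightarrow> y \<in> coord_dom c \<Longrightarrow> 0 < dens c y"
  using parametrization.density_pos[OF parametrization_rep] .

lemma continuous_on_dens: "c \<in> A \<Longrightarrow> continuous_on (coord_dom c) (dens c)"
  using Ck_on_imp_continuous_on[OF parametrization.Ck_density[OF parametrization_rep]] .

lemma dens_eq: "c \<in> A \<Longrightarrow> y \<in> coord_dom c \<Longrightarrow> sqrt (det (metric_matrix c F (chart_inv c y))) = dens c y"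
  by (auto simp: metric_matrix_eq tframe_def parametrization.density_def[OF parametrization_rep] chart)

definition chart_volume :: "('m, 'n) chart \<Rightarrow> 'm set \<Rightarrow> ennreal" where
  "chart_volume c B = (\<integral>\<^sup>+ y. ennreal (dens c y) * indicator (snd c ` B) y \<partial>lborel)"

lemma chart_volume_eq:
  assumes "c \<in> A" "B \<subseteq> fst c"
  shows "(\<integral>\<^sup>+ y. ennreal (sqrt (det (metric_matrix c F (chart_inv c y)))) * indicator (snd c ` B) y \<partial>lborel)
    = chart_volume c B"
  unfolding chart_volume_def
proof (intro nn_integral_cong)
  fix y
  show "ennreal (sqrt (det (metric_matrix c F (chart_inv c y)))) * indicator (snd c ` B) y =
      ennreal (dens c y) * indicator (snd c ` B) y"
    using assms dens_eq[OF assms(1), of y] by (cases "y \<in> snd c ` B") auto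
qed

lemma borel_dom: "c \<in> A \<Longrightarrow> coord_dom c \<in> sets borel"
  using chart(2) by (rule borel_open)

lemma measurable_chart_inv:
  "c \<in> A \<Longrightarrow> chart_inv c \<in> restrict_space borel (coord_dom c) \<rightarrow>\<^sub>M borel"
  by (intro borel_measurable_continuous_on_restrict chart)

lemma chart_image_eq:
  assumes "c \<in> A" "B \<subseteq> fst c"
  shows "snd c ` B = chart_inv c -` B \<inter> coord_dom c"
  using assms(2) chart[OF assms(1)] by (auto simp: image_iff)

lemma borel_chart_image:
  assumes "c \<in> A" "B \<in> sets borel" "B \<subseteq> fst c"
  shows "snd c ` B \<in> sets borel"
proof -
  have "chart_inv c -` B \<inter> space (restrict_space borel (coord_dom c)) \<in> sets (restrict_space borel (coord_dom c))"
    by (rule measurable_sets[OF measurable_chart_inv[OF assms(1)] assms(2)])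
  then show ?thesis
    using borel_dom[OF assms(1)]
    by (simp add: chart_image_eq[OF assms(1,3)] space_restrict_space sets_restrict_space_iff)
qed

text \<open>Outside the coordinate domain \<open>dens c\<close> carries no meaning; the extension by
  zero is Borel on the whole space.\<close>

definition dens0 :: "('m, 'n) chart \<Rightarrow> real ^ 'n \<Rightarrow> real" where
  "dens0 c y = (if y \<in> coord_dom c then dens c y else 0)"

lemma measurable_dens0: "c \<in> A \<Longrightarrow> dens0 c \<in> borel_measurable borel"
proof -
  assume c: "c \<in> A"
  have "(\<lambda>y. indicator (coord_dom c) y *\<^sub>R dens c y) \<in> borel_measurable borel"
    by (intro borel_measurable_continuous_on_indicator borel_dom continuous_on_dens c)
  also have "(\<lambda>y. indicator (coord_dom c) y *\<^sub>R dens c y) = dens0 c"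
    by (rule ext) (auto simp: dens0_def indicator_def)
  finally show ?thesis .
qed

lemma dens0_nonneg: "c \<in> A \<Longrightarrow> 0 \<le> dens0 c y"
  using dens_pos[of c y] by (auto simp: dens0_def)

lemma chart_volume_alt:
  assumes "c \<in> A" "B \<subseteq> fst c"
  shows "chart_volume c B = (\<integral>\<^sup>+ y. ennreal (dens0 c y) * indicator (snd c ` B) y \<partial>lborel)"
  unfolding chart_volume_def
proof (intro nn_integral_cong)
  fix y
  show "ennreal (dens c y) * indicator (snd c ` B) y = ennreal (dens0 c y) * indicator (snd c ` B) y"
    using assms(2) by (cases "y \<in> snd c ` B") (auto simp: dens0_def)
qed

text \<open>The Jacobian factor in the change of variables by the transition map is the factor by
  which the square roots of the two Gram determinants differ.\<close>

lemma chart_volume_change: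
  assumes d: "d \<in> A" and c: "c \<in> A" and B: "B \<in> sets borel" "B \<subseteq> fst d" "B \<subseteq> fst c"
  shows "chart_volume c B = chart_volume d B"
proof -
  let ?t = "transition d c" and ?t' = "\<lambda>y. frechet_derivative (transition d c) (at y)"
  let ?D = "snd d ` B"
  have sub: "?D \<subseteq> overlap d c" using B by auto
  have im: "?t ` ?D = snd c ` B"
    using B chart[OF d] by (auto simp: image_image intro!: image_cong)
  have C2: "Ck_on (Suc k) (overlap d c) ?t" for k
    using transition(1)[OF d c] unfolding smooth_on_def by blast
  have der: "(?t has_derivative ?t' y) (at y)" if "y \<in> overlap d c" for y
    by (rule Ck_on_SucD[OF C2 that])
  have inj: "inj_on ?t ?D"
  proof (rule inj_onI)
    fix y z assume yz: "y \<in> ?D" "z \<in> ?D" "?t y = ?t z"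
    then have "chart_inv c (?t y) = chart_inv c (?t z)" by simp
    then have "chart_inv d y = chart_inv d z"
      using transition(3)[OF d c subsetD[OF sub yz(1)]] transition(3)[OF d c subsetD[OF sub yz(2)]]
      by (simp del: o_apply)
    then have "snd d (chart_inv d y) = snd d (chart_inv d z)" by simp
    moreover have "y \<in> coord_dom d" "z \<in> coord_dom d" using yz B by auto
    ultimately show "y = z" using chart(6)[OF d] by simp
  qed
  have cont: "continuous_on (overlap d c) (\<lambda>y. det (matrix (?t' y)))"
  proof (rule continuous_on_det)
    fix i j
    have "continuous_on (overlap d c) (\<lambda>y. ?t' y (axis j 1))"
      using C2[of 0] by simp
    then show "continuous_on (overlap d c) (\<lambda>y. matrix (?t' y) $ i $ j)"
      by (simp add: matrix_def continuous_on_component)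
  qed
  have meas: "?D \<in> sets borel" "snd c ` B \<in> sets borel"
    using borel_chart_image d c B by auto
  have "chart_volume c B = (\<integral>\<^sup>+ y. ennreal (dens0 c y) * indicator (?t ` ?D) y \<partial>lborel)"
    using chart_volume_alt[OF c B(3)] by (simp only: im)
  also have "\<dots> = (\<integral>\<^sup>+ y. ennreal (dens0 c (?t y)) *
      (ennreal \<bar>det (matrix (?t' y))\<bar> * indicator ?D y) \<partial>lborel)"
  proof (rule nn_integral_change_of_variables)
    show "continuous_on ?D (\<lambda>y. det (matrix (?t' y)))"
      using cont sub continuous_on_subset by blast
    show "(\<lambda>y. ennreal (dens0 c y)) \<in> borel_measurable borel"
      using measurable_dens0[OF c] by measurable
  qed (use der inj sub meas im in auto)
  also have "\<dots> = (\<integral>\<^sup>+ y. ennreal (dens d y) * indicator ?D y \<partial>lborel)"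
  proof (intro nn_integral_cong)
    fix y
    show "ennreal (dens0 c (?t y)) * (ennreal \<bar>det (matrix (?t' y))\<bar> * indicator ?D y) =
        ennreal (dens d y) * indicator ?D y"
    proof (cases "y \<in> ?D")
      case True
      then obtain p where p: "p \<in> B" "y = snd d p" by auto
      have pd: "p \<in> fst d" "p \<in> fst c" using p B by auto
      have ty: "?t y = snd c p" using p pd chart[OF d] by simp
      have M: "matrix (?t' y) = (\<chi> l j. partial (transition d c) (snd d p) j $ l)"
        by (simp add: matrix_def partial_def p(2))
      have "dens d y = \<bar>det (matrix (?t' y))\<bar> * dens c (snd c p)"
        using sqrt_det_gram_change_frame[of "matrix (?t' y)" "tframe c p"]
          change_of_chart(1)[OF d c pd] M
        by (simp add: parametrization.density_def[OF parametrization_rep] d c tframe_def p(2))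
      moreover have "dens0 c (?t y) = dens c (snd c p)" using pd ty by (simp add: dens0_def)
      ultimately have "dens d y = dens0 c (?t y) * \<bar>det (matrix (?t' y))\<bar>" by (simp add: mult.commute)
      then have "ennreal (dens d y) = ennreal (dens0 c (?t y)) * ennreal \<bar>det (matrix (?t' y))\<bar>"
        by (simp add: ennreal_mult dens0_nonneg[OF c])
      then show ?thesis using True by simp
    qed simp
  qed
  finally show ?thesis by (simp add: chart_volume_def)
qed

lemma chart_volume_suminf:
  assumes c: "c \<in> A" and B: "\<And>i::nat. B i \<in> sets borel" "\<And>i. B i \<subseteq> fst c" and dis: "disjoint_family B"
  shows "chart_volume c (\<Union>i. B i) = (\<Sum>i. chart_volume c (B i))"
proof -
  have inj: "inj_on (snd c) (fst c)"
    using chart(5)[OF c] by (metis inj_onI)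
  have dis': "disjoint_family (\<lambda>i. snd c ` B i)"
    using dis inj_on_image_Int[OF inj B(2) B(2)] unfolding disjoint_family_on_def by (metis image_empty)
  have "(\<Sum>i. chart_volume c (B i)) =
      (\<Sum>i. \<integral>\<^sup>+ y. ennreal (dens0 c y) * indicator (snd c ` B i) y \<partial>lborel)"
    using chart_volume_alt[OF c B(2)] by simp
  also have "\<dots> = (\<integral>\<^sup>+ y. (\<Sum>i. ennreal (dens0 c y) * indicator (snd c ` B i) y) \<partial>lborel)"
  proof (intro nn_integral_suminf[symmetric])
    fix i
    have "snd c ` B i \<in> sets lborel" using borel_chart_image[OF c B] by simp
    then show "(\<lambda>y. ennreal (dens0 c y) * indicator (snd c ` B i) y) \<in> borel_measurable lborel"
      using measurable_dens0[OF c] by simp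
  qed
  also have "\<dots> = (\<integral>\<^sup>+ y. ennreal (dens0 c y) * indicator (snd c ` (\<Union>i. B i)) y \<partial>lborel)"
    using suminf_indicator[OF dis'] by (simp add: ennreal_suminf_cmult image_UN)
  also have "\<dots> = chart_volume c (\<Union>i. B i)"
    using B(2) by (intro chart_volume_alt[symmetric] c) auto
  finally show ?thesis by simp
qed

lemma countable_charts:
  obtains cs :: "nat \<Rightarrow> ('m, 'n) chart" where "range cs \<subseteq> A" "(\<Union>k. fst (cs k)) = UNIV"
proof -
  obtain \<F> where \<F>: "\<F> \<subseteq> fst ` A" "countable \<F>" "\<Union>\<F> = \<Union>(fst ` A)"
    using Lindelof[of "fst ` A"] chart(1) by blast
  have cov: "\<Union>\<F> = UNIV" using \<F>(3) atlas by (simp add: smooth_atlas_def)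
  then have ne: "\<F> \<noteq> {}" by auto
  have "\<forall>k. \<exists>c\<in>A. fst c = from_nat_into \<F> k"
    using \<F>(1) from_nat_into[OF ne] by (metis imageE subsetD)
  then obtain cs where cs: "\<And>k. cs k \<in> A" "\<And>k. fst (cs k) = from_nat_into \<F> k" by metis
  have "(\<Union>k. fst (cs k)) = UNIV"
    using cov range_from_nat_into[OF ne \<F>(2)] by (simp add: cs(2))
  with cs(1) show ?thesis by (intro that) auto
qed

text \<open>By the Lindelof property countably many charts suffice. Cutting their domains into
  disjoint Borel pieces allows the measure to be assembled as a series.\<close>

lemma disjoint_charts:
  obtains cs :: "nat \<Rightarrow> ('m, 'n) chart" and P :: "nat \<Rightarrow> 'm set"
  where "\<And>k. cs k \<in> A" "\<And>k. P k \<in> sets borel" "\<And>k. P k \<subseteq> fst (cs k)"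
    "disjoint_family P" "(\<Union>k. P k) = UNIV"
proof -
  obtain cs :: "nat \<Rightarrow> ('m, 'n) chart" where cs: "range cs \<subseteq> A" "(\<Union>k. fst (cs k)) = UNIV"
    using countable_charts .
  let ?P = "disjointed (\<lambda>k. fst (cs k))"
  have csA: "cs k \<in> A" for k using cs(1) by auto
  have meas: "?P k \<in> sets borel" for k
    using sets.range_disjointed_sets[of "\<lambda>k. fst (cs k)" borel] chart(1)[OF csA]
    by (auto simp: image_subset_iff)
  show ?thesis
    by (rule that[OF csA meas disjointed_subset disjoint_family_disjointed])
      (simp add: UN_disjointed_eq cs(2))
qed

section \<open>Existence and uniqueness of the Riemannian measure\<close>

definition is_volume :: "'m measure \<Rightarrow> bool" where
  "is_volume \<mu> \<longleftrightarrow> sets \<mu> = sets borel \<and>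
     (\<forall>c\<in>A. \<forall>B\<in>sets borel. B \<subseteq> fst c \<longrightarrow> emeasure \<mu> B = chart_volume c B)"

text \<open>The measure of a Borel set is the sum over its pieces in the sets \<open>P k\<close>,
  and on each piece, lying in one chart, it is prescribed.\<close>

lemma is_volume_unique:
  assumes "is_volume \<mu>" "is_volume \<mu>'"
  shows "\<mu> = \<mu>'"
proof -
  obtain cs :: "nat \<Rightarrow> ('m, 'n) chart" and P where P: "\<And>k. cs k \<in> A" "\<And>k. P k \<in> sets borel"
    "\<And>k. P k \<subseteq> fst (cs k)" "disjoint_family P" "(\<Union>k. P k) = UNIV"
    by (rule disjoint_charts) blast
  have eq: "emeasure \<nu> B = (\<Sum>k. chart_volume (cs k) (B \<inter> P k))"
    if \<nu>: "is_volume \<nu>" and B: "B \<in> sets borel" for \<nu> B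
  proof -
    have chart: "emeasure \<nu> (B \<inter> P k) = chart_volume (cs k) (B \<inter> P k)" for k
    proof -
      have "B \<inter> P k \<in> sets borel" "B \<inter> P k \<subseteq> fst (cs k)"
        using B P(2,3)[of k] by auto
      then show ?thesis using \<nu> P(1) by (simp add: is_volume_def)
    qed
    have "emeasure \<nu> B = emeasure \<nu> (\<Union>k. B \<inter> P k)"
      using P(5) by (simp add: Int_UN_distrib[symmetric])
    also have "\<dots> = (\<Sum>k. emeasure \<nu> (B \<inter> P k))"
      using \<nu> B P
      by (intro suminf_emeasure[symmetric] disjoint_family_Int) (auto simp: is_volume_def)
    also have "\<dots> = (\<Sum>k. chart_volume (cs k) (B \<inter> P k))"
      by (simp only: chart)
    finally show ?thesis .
  qed
  show ?thesis
    using assms eq by (intro measure_eqI) (auto simp: is_volume_def)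
qed

text \<open>The sum over the pieces is taken as definition. Its agreement with the prescription in
  every other chart is the content of \<open>chart_volume_change\<close>.\<close>

lemma is_volume_exists: "\<exists>\<mu>. is_volume \<mu>"
proof -
  obtain cs :: "nat \<Rightarrow> ('m, 'n) chart" and P where P: "\<And>k. cs k \<in> A" "\<And>k. P k \<in> sets borel"
    "\<And>k. P k \<subseteq> fst (cs k)" "disjoint_family P" "(\<Union>k. P k) = UNIV"
    by (rule disjoint_charts) blast
  define m where "m B = (\<Sum>k. chart_volume (cs k) (B \<inter> P k))" for B
  define \<mu> where "\<mu> = measure_of UNIV (sets borel) m"
  have "positive (sets borel) m"
    by (simp add: positive_def m_def chart_volume_def)
  moreover have "countably_additive (sets borel) m"
    unfolding countably_additive_def
  proof (intro allI impI)
    fix B :: "nat \<Rightarrow> 'm set"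
    assume B: "range B \<subseteq> sets borel" "disjoint_family B"
    have "chart_volume (cs k) ((\<Union>i. B i) \<inter> P k) = (\<Sum>i. chart_volume (cs k) (B i \<inter> P k))" for k
    proof -
      have "(\<Union>i. B i) \<inter> P k = (\<Union>i. B i \<inter> P k)" by auto
      moreover have "chart_volume (cs k) (\<Union>i. B i \<inter> P k) = (\<Sum>i. chart_volume (cs k) (B i \<inter> P k))"
        using B P(2,3)[of k] by (intro chart_volume_suminf P(1)) (auto simp: disjoint_family_on_def)
      ultimately show ?thesis by simp
    qed
    then show "(\<Sum>i. m (B i)) = m (\<Union> (range B))"
      unfolding m_def by (subst suminf_ennreal_swap) simp
  qed
  ultimately have em: "emeasure \<mu> B = m B" if "B \<in> sets borel" for B
    using that sets.sigma_algebra_axioms[of "borel :: 'm measure"]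
    unfolding \<mu>_def by (intro emeasure_measure_of_sigma) simp_all
  have sets: "sets \<mu> = sets borel"
    unfolding \<mu>_def using sets.sigma_sets_eq[of "borel :: 'm measure"] by simp
  have "emeasure \<mu> B = chart_volume c B" if "c \<in> A" "B \<in> sets borel" "B \<subseteq> fst c" for c B
  proof -
    \<comment> \<open>Each \<open>B \<inter> P k\<close> lies in the domains of both c and
      \<open>cs k\<close>, so the chart may be exchanged there.\<close>
    have "m B = (\<Sum>k. chart_volume c (B \<inter> P k))"
      unfolding m_def using that P
      by (intro suminf_cong chart_volume_change) (auto dest: subsetD[OF P(3)])
    also have "\<dots> = chart_volume c (\<Union>k. B \<inter> P k)"
      using that P by (intro chart_volume_suminf[symmetric] disjoint_family_Int) auto
    also have "(\<Union>k. B \<inter> P k) = B" using P(5) by auto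
    finally show ?thesis using em that by simp
  qed
  then show ?thesis using sets unfolding is_volume_def by blast
qed

abbreviation vol :: "'m measure" where
  "vol \<equiv> volume_measure A F"

lemma is_volume_vol: "is_volume vol"
proof -
  have "volume_measure A F = (THE \<mu>. is_volume \<mu>)"
    unfolding volume_measure_def is_volume_def
    by (rule arg_cong[where f = The]) (auto simp: fun_eq_iff chart_volume_eq)
  also have "is_volume \<dots>"
    using is_volume_exists is_volume_unique by (metis (mono_tags) theI)
  finally show ?thesis .
qed

lemma sets_vol [simp, measurable_cong]: "sets vol = sets borel"
  using is_volume_vol by (simp add: is_volume_def)

lemma space_vol [simp]: "space vol = UNIV"
  using sets_eq_imp_space_eq[OF sets_vol] by simp

lemma emeasure_vol: "c \<in> A \<Longrightarrow> B \<in> sets borel \<Longrightarrow> B \<subseteq> fst c \<Longrightarrow> emeasure vol B = chart_volume c B"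
  using is_volume_vol by (simp add: is_volume_def)

text \<open>Carries integrals over a chart domain to coordinates. The value of \<psi> outside the
  coordinate domain does not count, since the density \<open>dens0 c\<close> vanishes there.\<close>

lemma distr_chart_inv:
  assumes c: "c \<in> A"
  defines "\<psi> \<equiv> (\<lambda>y. if y \<in> coord_dom c then chart_inv c y else undefined)"
  shows "\<psi> \<in> borel \<rightarrow>\<^sub>M borel"
    and "distr (density lborel (\<lambda>y. ennreal (dens0 c y))) borel \<psi> = density vol (\<lambda>p. ennreal (indicator (fst c) p))"
proof -
  show \<psi>: "\<psi> \<in> borel \<rightarrow>\<^sub>M borel"
    unfolding \<psi>_def using borel_dom[OF c] measurable_chart_inv[OF c]
    by (subst measurable_If_restrict_space_iff) auto
  note m = measurable_dens0[OF c]
  show "distr (density lborel (\<lambda>y. ennreal (dens0 c y))) borel \<psi> = density vol (\<lambda>p. ennreal (indicator (fst c) p))"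
  proof (rule measure_eqI)
    fix E assume "E \<in> sets (distr (density lborel (\<lambda>y. ennreal (dens0 c y))) borel \<psi>)"
    then have E: "E \<in> sets borel" by simp
    have fc: "fst c \<in> sets borel" using chart(1)[OF c] by simp
    have "emeasure (distr (density lborel (\<lambda>y. ennreal (dens0 c y))) borel \<psi>) E
        = (\<integral>\<^sup>+ y. ennreal (dens0 c y) * indicator (\<psi> -` E) y \<partial>lborel)"
      using \<psi> E m measurable_sets[OF \<psi> E] by (simp add: emeasure_distr emeasure_density)
    also have "\<dots> = (\<integral>\<^sup>+ y. ennreal (dens0 c y) * indicator (snd c ` (E \<inter> fst c)) y \<partial>lborel)"
    proof (intro nn_integral_cong)
      fix y
      have "y \<in> \<psi> -` E \<longleftrightarrow> y \<in> snd c ` (E \<inter> fst c)" if "y \<in> coord_dom c"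
        using that chart[OF c] unfolding chart_image_eq[OF c Int_lower2] by (simp add: \<psi>_def)
      then show "ennreal (dens0 c y) * indicator (\<psi> -` E) y =
          ennreal (dens0 c y) * indicator (snd c ` (E \<inter> fst c)) y"
        by (cases "y \<in> coord_dom c") (auto simp: dens0_def indicator_def)
    qed
    also have "\<dots> = emeasure vol (E \<inter> fst c)"
      using E fc by (simp add: chart_volume_alt[OF c Int_lower2] emeasure_vol[OF c])
    also have "\<dots> = emeasure (density vol (\<lambda>p. ennreal (indicator (fst c) p))) E"
    proof -
      have "E \<in> sets vol" "fst c \<in> sets vol" using E fc by simp_all
      then show ?thesis
        by (simp add: emeasure_density ennreal_indicator indicator_inter_arith[symmetric] Int_commute mult.commute)
    qed
    finally show "emeasure (distr (density lborel (\<lambda>y. ennreal (dens0 c y))) borel \<psi>) E =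
        emeasure (density vol (\<lambda>p. ennreal (indicator (fst c) p))) E" .
  qed simp
qed

lemma integral_chart:
  fixes f :: "'m \<Rightarrow> real"
  assumes c: "c \<in> A" and f: "f \<in> borel_measurable borel" and supp: "\<And>p. p \<notin> fst c \<Longrightarrow> f p = 0"
  shows "integrable vol f \<longleftrightarrow> integrable lborel (\<lambda>y. indicator (coord_dom c) y * (dens c y * f (chart_inv c y)))"
    and "(LINT p|vol. f p) = (LINT y|lborel. indicator (coord_dom c) y * (dens c y * f (chart_inv c y)))"
proof -
  define \<psi> where "\<psi> = (\<lambda>y. if y \<in> coord_dom c then chart_inv c y else undefined)"
  note \<psi> = distr_chart_inv[OF c, folded \<psi>_def]
  note m = measurable_dens0[OF c]
  have eq: "(\<lambda>y. dens0 c y *\<^sub>R f (\<psi> y)) = (\<lambda>y. indicator (coord_dom c) y * (dens c y * f (chart_inv c y)))"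
    by (rule ext) (auto simp: dens0_def \<psi>_def)
  have eq2: "(\<lambda>p. indicator (fst c) p * f p) = f"
    using supp by (auto simp: indicator_def fun_eq_iff)
  have fv: "f \<in> borel_measurable vol" using f by simp
  have fc: "fst c \<in> sets vol" using chart(1)[OF c] by simp
  have f\<psi>: "(\<lambda>y. f (\<psi> y)) \<in> borel_measurable borel" using \<psi>(1) f by measurable
  have "integrable vol f \<longleftrightarrow> integrable (density vol (\<lambda>p. ennreal (indicator (fst c) p))) f"
    using fv fc by (subst integrable_density) (auto simp: eq2)
  also have "\<dots> \<longleftrightarrow> integrable (density lborel (\<lambda>y. ennreal (dens0 c y))) (\<lambda>y. f (\<psi> y))"
    unfolding \<psi>(2)[symmetric] using \<psi>(1) f by (subst integrable_distr_eq) auto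
  also have "\<dots> \<longleftrightarrow> integrable lborel (\<lambda>y. dens0 c y *\<^sub>R f (\<psi> y))"
    using f\<psi> m dens0_nonneg[OF c] by (subst integrable_density) auto
  finally show "integrable vol f \<longleftrightarrow> integrable lborel (\<lambda>y. indicator (coord_dom c) y * (dens c y * f (chart_inv c y)))"
    unfolding eq .
  have "(LINT p|vol. f p) = integral\<^sup>L (density vol (\<lambda>p. ennreal (indicator (fst c) p))) f"
    using fv fc by (subst integral_density) (auto simp: eq2)
  also have "\<dots> = integral\<^sup>L (density lborel (\<lambda>y. ennreal (dens0 c y))) (\<lambda>y. f (\<psi> y))"
    unfolding \<psi>(2)[symmetric] using \<psi>(1) f by (subst integral_distr) auto
  also have "\<dots> = (LINT y|lborel. dens0 c y *\<^sub>R f (\<psi> y))"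
    using f\<psi> m dens0_nonneg[OF c] by (subst integral_density) auto
  finally show "(LINT p|vol. f p) = (LINT y|lborel. indicator (coord_dom c) y * (dens c y * f (chart_inv c y)))"
    unfolding eq .
qed

lemma chart_cball:
  assumes c: "c \<in> A" "p \<in> fst c"
  obtains r where "0 < r" "cball (snd c p) r \<subseteq> coord_dom c" "compact (chart_inv c ` cball (snd c p) r)"
    "open (chart_inv c ` ball (snd c p) r)" "p \<in> chart_inv c ` ball (snd c p) r"
    "chart_inv c ` cball (snd c p) r \<subseteq> fst c"
proof -
  have "snd c p \<in> coord_dom c" using c by auto
  then obtain r where r: "r > 0" "cball (snd c p) r \<subseteq> coord_dom c"
    using chart(2)[OF c(1)] open_contains_cball by blast
  have "compact (chart_inv c ` cball (snd c p) r)"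
    using continuous_on_subset[OF chart(4)[OF c(1)] r(2)]
    by (intro compact_continuous_image) auto
  moreover have "chart_inv c ` ball (snd c p) r = snd c -` ball (snd c p) r \<inter> fst c"
  proof (intro equalityI subsetI)
    fix q assume "q \<in> chart_inv c ` ball (snd c p) r"
    then obtain y where y: "y \<in> ball (snd c p) r" "q = chart_inv c y" by blast
    have "y \<in> coord_dom c" using y(1) r(2) ball_subset_cball by blast
    then show "q \<in> snd c -` ball (snd c p) r \<inter> fst c"
      using y chart(6,7)[OF c(1)] by simp
  next
    fix q assume "q \<in> snd c -` ball (snd c p) r \<inter> fst c"
    then have "snd c q \<in> ball (snd c p) r" "chart_inv c (snd c q) = q"
      using chart(5)[OF c(1)] by auto
    then show "q \<in> chart_inv c ` ball (snd c p) r" by (metis imageI)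
  qed
  moreover have "open (snd c -` ball (snd c p) r \<inter> fst c)"
    using continuous_on_open_vimage[OF chart(1)[OF c(1)]] chart(3)[OF c(1)] by blast
  moreover have "p \<in> snd c -` ball (snd c p) r \<inter> fst c" using r c by auto
  moreover have "chart_inv c ` cball (snd c p) r \<subseteq> fst c"
    using r(2) chart(7)[OF c(1)] by auto
  ultimately show ?thesis using r by (intro that[of r]) auto
qed

text \<open>Every point has a coordinate ball of finite volume, because the density is continuous on
  the closed ball; finitely many such balls cover K.\<close>

lemma emeasure_vol_compact:
  assumes K: "compact K"
  shows "emeasure vol K < \<infinity>"
proof -
  have "\<exists>V. open V \<and> p \<in> V \<and> emeasure vol V < \<infinity>" for p
  proof -
    let ?c = "chart_at A p"
    note c = chart_at[of p]
    obtain r where r: "0 < r" "cball (snd ?c p) r \<subseteq> coord_dom ?c"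
      "open (chart_inv ?c ` ball (snd ?c p) r)" "p \<in> chart_inv ?c ` ball (snd ?c p) r"
      "chart_inv ?c ` cball (snd ?c p) r \<subseteq> fst ?c"
      using chart_cball[OF c] by metis
    let ?V = "chart_inv ?c ` ball (snd ?c p) r"
    have V: "?V \<subseteq> fst ?c" "?V \<in> sets borel"
      using r(3,5) ball_subset_cball[of "snd ?c p" r] by auto
    have cont: "continuous_on (cball (snd ?c p) r) (dens ?c)"
      using continuous_on_dens[OF c(1)] r(2) continuous_on_subset by blast
    have "snd ?c (chart_inv ?c y) = y" if "y \<in> ball (snd ?c p) r" for y
      using that r(2) ball_subset_cball chart(6)[OF c(1)] by blast
    then have im: "snd ?c ` ?V = ball (snd ?c p) r"
      unfolding image_image by simp
    have "emeasure vol ?V = (\<integral>\<^sup>+ y. ennreal (dens ?c y) * indicator (ball (snd ?c p) r) y \<partial>lborel)"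
      using emeasure_vol[OF c(1) V(2,1)] by (simp add: chart_volume_def im)
    also have "\<dots> \<le> (\<integral>\<^sup>+ y. ennreal (indicator (cball (snd ?c p) r) y *\<^sub>R dens ?c y) \<partial>lborel)"
      by (intro nn_integral_mono) (auto simp: indicator_def)
    also have "\<dots> < \<infinity>"
    proof -
      have "integrable lborel (\<lambda>y. indicator (cball (snd ?c p) r) y *\<^sub>R dens ?c y)"
        by (rule borel_integrable_compact[OF compact_cball cont])
      moreover have "0 \<le> indicator (cball (snd ?c p) r) y *\<^sub>R dens ?c y" for y
        using dens_pos[OF c(1), of y] r(2) by (auto simp: indicator_def less_imp_le)
      ultimately show ?thesis
        by (subst nn_integral_eq_integral) auto
    qed
    finally show ?thesis using r(3,4) by blast
  qed
  then obtain V where V: "\<And>p. open (V p)" "\<And>p. p \<in> V p" "\<And>p. emeasure vol (V p) < \<infinity>" by metis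
  obtain I where I: "I \<subseteq> K" "finite I" "K \<subseteq> (\<Union>p\<in>I. V p)"
    using compactE_image[OF K, of K V] V by blast
  have "emeasure vol K \<le> emeasure vol (\<Union>p\<in>I. V p)"
    using I V by (intro emeasure_mono) auto
  also have "\<dots> \<le> (\<Sum>p\<in>I. emeasure vol (V p))"
    using I V by (intro emeasure_subadditive_finite) auto
  also have "\<dots> < \<infinity>" using V(3) I(2) by (simp add: less_top[symmetric])
  finally show ?thesis .
qed

text \<open>The coordinate domain of any chart around a point is open and nonempty, and the density
  is positive on it. This will make the denominator of the final quotient positive.\<close>

lemma emeasure_vol_UNIV_pos: "0 < emeasure vol UNIV"
proof -
  fix p0 :: 'm
  let ?c = "chart_at A p0"
  note c = chart_at[of p0]
  have "emeasure vol (fst ?c) \<noteq> 0"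
  proof
    assume "emeasure vol (fst ?c) = 0"
    then have "(\<integral>\<^sup>+ y. ennreal (dens0 ?c y) * indicator (coord_dom ?c) y \<partial>lborel) = 0"
      using emeasure_vol[OF c(1)] chart(1)[OF c(1)] by (simp add: chart_volume_alt[OF c(1)])
    then have "AE y in lborel. ennreal (dens0 ?c y) * indicator (coord_dom ?c) y = 0"
      using measurable_dens0[OF c(1)] borel_dom[OF c(1)] by (subst (asm) nn_integral_0_iff_AE) auto
    then have "AE y in lborel. y \<notin> coord_dom ?c"
    proof (rule AE_mp, intro AE_I2 impI notI)
      fix y assume "ennreal (dens0 ?c y) * indicator (coord_dom ?c) y = 0" "y \<in> coord_dom ?c"
      then show False using dens_pos[OF c(1), of y] by (simp add: dens0_def)
    qed
    then have "emeasure lborel (coord_dom ?c) = 0"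
      using borel_dom[OF c(1)] by (subst (asm) AE_iff_measurable[OF _ refl]) auto
    moreover have "coord_dom ?c \<noteq> {}" using c(2) by auto
    ultimately show False
      using open_not_negligible[OF chart(2)[OF c(1)]] borel_dom[OF c(1)]
      by (auto simp: negligible_iff_null_sets null_sets_def)
  qed
  moreover have "emeasure vol (fst ?c) \<le> emeasure vol UNIV"
    by (intro emeasure_mono) auto
  ultimately show ?thesis by (metis zero_less_iff_neq_zero not_gr_zero le_zero_eq)
qed

end

section \<open>The divergence theorem on the manifold\<close>

context parametrization
begin

lemma continuous_on_raise:
  assumes "\<And>i. continuous_on U (\<lambda>y. \<xi> y i)"
  shows "continuous_on U (\<lambda>y. raise (partial G y) (\<xi> y))"
  unfolding raise_def
  by (intro continuous_intros assms Ck_on_imp_continuous_on[OF Ck_gram_inv]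
      Ck_on_imp_continuous_on[OF Ck_partial])

lemma continuous_on_coord_mcv: "continuous_on U (coord_mcv G)"
  unfolding coord_mcv_def[abs_def] proj_def
  by (intro continuous_intros continuous_on_raise Ck_on_imp_continuous_on[OF Ck_gram_inv]
      Ck_on_imp_continuous_on[OF Ck_partial] Ck_on_imp_continuous_on[OF Ck_partial2])

end

context immersed_manifold
begin

lemma continuous_chartwise:
  assumes "\<And>c. c \<in> A \<Longrightarrow> continuous_on (coord_dom c) (\<lambda>y. f (chart_inv c y))"
  shows "continuous_on UNIV f"
proof -
  have "continuous_on (fst c) f" if c: "c \<in> A" for c
  proof (rule continuous_on_eq)
    show "continuous_on (fst c) (\<lambda>p. f (chart_inv c (snd c p)))"
      by (rule continuous_on_compose2[OF assms[OF c] chart(3)[OF c]]) auto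
  qed (simp add: chart(5)[OF c])
  then have "continuous_on (\<Union>c\<in>A. fst c) f"
    by (intro continuous_on_open_UN chart(1))
  then show ?thesis using atlas by (simp add: smooth_atlas_def)
qed

lemma smooth_map_continuous: "smooth_map A u \<Longrightarrow> continuous_on UNIV u"
  using Ck_on_imp_continuous_on[OF smooth_map_D] by (intro continuous_chartwise) (auto simp: o_def)

lemma continuous_F: "continuous_on UNIV F"
  by (rule smooth_map_continuous[OF smooth_map_F])

text \<open>The Riemannian divergence of the field u x^T; that of x^T alone is n plus the inner
  product of the mean curvature vector with x.\<close>

definition div_integrand :: "('m \<Rightarrow> real) \<Rightarrow> 'm \<Rightarrow> real" where
  "div_integrand u p =
     u p * (real CARD('n) + mean_curvature_vector A F p \<bullet> F p) + gradient A F u p \<bullet> F p"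

lemma div_integrand_chart:
  assumes "c \<in> A" "smooth_map A u" "y \<in> coord_dom c"
  shows "div_integrand u (chart_inv c y) =
    (u \<circ> chart_inv c) y * (real CARD('n) + coord_mcv (rep c) y \<bullet> rep c y)
      + raise (partial (rep c) y) (partial (u \<circ> chart_inv c) y) \<bullet> rep c y"
  using chart[OF assms(1)] assms
  by (simp add: div_integrand_def gradient_eq[of c] mean_curvature_vector_eq[of c] tframe_def)

lemma continuous_div_integrand:
  assumes u: "smooth_map A u"
  shows "continuous_on UNIV (div_integrand u)"
proof (rule continuous_chartwise)
  fix c assume c: "c \<in> A"
  interpret c: parametrization "coord_dom c" "rep c" by (rule parametrization_rep[OF c])
  have cu: "continuous_on (coord_dom c) (\<lambda>y. partial (u \<circ> chart_inv c) y i)" for i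
    using smooth_map_D[OF u c, of "Suc 0"] by (simp add: partial_def)
  have "continuous_on (coord_dom c) (\<lambda>y. (u \<circ> chart_inv c) y * (real CARD('n) + coord_mcv (rep c) y \<bullet> rep c y)
      + raise (partial (rep c) y) (partial (u \<circ> chart_inv c) y) \<bullet> rep c y)"
    by (intro continuous_on_add continuous_on_mult continuous_on_inner continuous_on_const
        c.continuous_on_coord_mcv c.continuous_on_raise cu Ck_on_imp_continuous_on[OF c.Ck_G]
        Ck_on_imp_continuous_on[OF smooth_map_D[OF u c]])
  then show "continuous_on (coord_dom c) (\<lambda>y. div_integrand u (chart_inv c y))"
    by (rule continuous_on_eq) (simp only: div_integrand_chart[OF c u])
qed

lemma gradient_zero:
  assumes u: "smooth_map A u" and V: "open V" "p \<in> V" "\<And>q. q \<in> V \<Longrightarrow> u q = 0"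
  shows "gradient A F u p = 0"
proof -
  let ?c = "chart_at A p"
  note c = chart_at[of p]
  have op: "open (chart_inv ?c -` V \<inter> coord_dom ?c)"
    using continuous_on_open_vimage[OF chart(2)[OF c(1)]] chart(4)[OF c(1)] V(1) by blast
  have mem: "snd ?c p \<in> chart_inv ?c -` V \<inter> coord_dom ?c"
    using c V(2) chart[OF c(1)] by auto
  have "partial (u \<circ> chart_inv ?c) (snd ?c p) = partial (\<lambda>y. 0) (snd ?c p)"
    by (rule partial_transform[OF op mem]) (use V(3) in auto)
  then have "partial (u \<circ> chart_inv ?c) (snd ?c p) = (\<lambda>i. 0)"
    by (simp add: partial_def[abs_def])
  then show ?thesis
    by (simp add: gradient_eq[OF c u] raise_def)
qed

lemma div_integrand_zero:
  assumes u: "smooth_map A u" and K: "closed K" "\<And>p. p \<notin> K \<Longrightarrow> u p = 0" and p: "p \<notin> K"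
  shows "div_integrand u p = 0"
  using gradient_zero[OF u open_Compl[OF K(1)], of p] K p by (simp add: div_integrand_def)

lemma integrable_compact_support:
  fixes f :: "'m \<Rightarrow> real"
  assumes f: "continuous_on UNIV f" and K: "compact K" "\<And>p. p \<notin> K \<Longrightarrow> f p = 0"
  shows "integrable vol f"
proof -
  have "bounded (f ` K)"
    using continuous_on_subset[OF f] K(1) by (intro compact_imp_bounded compact_continuous_image) auto
  then obtain C where C: "\<And>p. p \<in> K \<Longrightarrow> \<bar>f p\<bar> \<le> C" by (auto simp: bounded_iff)
  show ?thesis
  proof (rule Bochner_Integration.integrable_bound)
    show "integrable vol (\<lambda>p. C * indicator K p)"
      using emeasure_vol_compact[OF K(1)] compact_imp_closed[OF K(1)]
      by (intro integrable_mult_right integrable_real_indicator) auto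
    show "f \<in> borel_measurable vol"
      using borel_measurable_continuous_onI[OF f] by simp
    show "AE p in vol. norm (f p) \<le> norm (C * indicator K p)"
      using C K(2) by (intro AE_I2) (force simp: indicator_def)
  qed
qed

lemma divergence_chart:
  assumes c: "c \<in> A" and u: "smooth_map A u"
    and K: "compact K" "K \<subseteq> fst c" "\<And>p. p \<notin> K \<Longrightarrow> u p = 0"
  shows "(LINT p|vol. div_integrand u p) = 0"
proof -
  interpret c: parametrization "coord_dom c" "rep c" by (rule parametrization_rep[OF c])
  define u' where "u' = (\<lambda>y. if y \<in> coord_dom c then (u \<circ> chart_inv c) y else 0)"
  have eq: "u' y = (u \<circ> chart_inv c) y" if "y \<in> coord_dom c" for y using that by (simp add: u'_def)
  have "Ck_on 1 (coord_dom c) u' \<longleftrightarrow> Ck_on 1 (coord_dom c) (u \<circ> chart_inv c)"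
    by (rule Ck_on_cong[OF c.open_U eq])
  then have 1: "Ck_on 1 (coord_dom c) u'"
    using smooth_map_D[OF u c] by blast
  have 2: "compact (snd c ` K)"
    using continuous_on_subset[OF chart(3)[OF c] K(2)] K(1) by (rule compact_continuous_image)
  have 3: "snd c ` K \<subseteq> coord_dom c" using K(2) by auto
  have 4: "u' y = 0" if "y \<notin> snd c ` K" for y
  proof (cases "y \<in> coord_dom c")
    case True
    then have "chart_inv c y \<notin> K" using that chart(6)[OF c True] by (metis imageI)
    then show ?thesis using K(3) True by (simp add: u'_def)
  qed (simp add: u'_def)
  have supp: "div_integrand u p = 0" if "p \<notin> fst c" for p
    using div_integrand_zero[OF u compact_imp_closed[OF K(1)] K(3), of p] that K(2) by auto
  have "(LINT p|vol. div_integrand u p)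
    = (LINT y|lborel. indicator (coord_dom c) y * (dens c y * div_integrand u (chart_inv c y)))"
    using borel_measurable_continuous_onI[OF continuous_div_integrand[OF u]] supp
    by (intro integral_chart(2)[OF c])
  also have "\<dots> = (LINT y|lborel. indicator (coord_dom c) y * (dens c y * (u' y * (real CARD('n) + coord_mcv (rep c) y \<bullet> rep c y)
      + raise (partial (rep c) y) (partial u' y) \<bullet> rep c y)))"
  proof (rule Bochner_Integration.integral_cong[OF refl])
    fix y
    show "indicator (coord_dom c) y * (dens c y * div_integrand u (chart_inv c y)) =
      indicator (coord_dom c) y * (dens c y * (u' y * (real CARD('n) + coord_mcv (rep c) y \<bullet> rep c y)
      + raise (partial (rep c) y) (partial u' y) \<bullet> rep c y))"
    proof (cases "y \<in> coord_dom c")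
      case True
      have "partial u' y = partial (u \<circ> chart_inv c) y"
        by (rule partial_transform[OF c.open_U True smooth_map_differentiable[OF u c True]])
          (simp add: u'_def)
      then show ?thesis by (simp only: div_integrand_chart[OF c u True] eq[OF True])
    qed simp
  qed
  also have "\<dots> = 0"
    by (rule c.local_divergence(2)[OF 1 2 3 4])
  finally show ?thesis .
qed

lemma open_chart_image:
  assumes "c \<in> A" "open V"
  shows "open (snd c ` (fst c \<inter> V))"
proof -
  have "snd c ` (fst c \<inter> V) = chart_inv c -` (fst c \<inter> V) \<inter> coord_dom c"
    using chart[OF assms(1)] by (auto simp: image_iff)
  then show ?thesis
    using continuous_on_open_vimage[OF chart(2)[OF assms(1)]] chart(4)[OF assms(1)]
      open_Int[OF chart(1)[OF assms(1)] assms(2)] by metis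
qed

lemma smooth_map_patch:
  assumes "open V" "open W" "V \<union> W = UNIV"
    and "\<And>c k. c \<in> A \<Longrightarrow> Ck_on k (snd c ` (fst c \<inter> V)) (u \<circ> chart_inv c)"
    and "\<And>c k. c \<in> A \<Longrightarrow> Ck_on k (snd c ` (fst c \<inter> W)) (u \<circ> chart_inv c)"
  shows "smooth_map A u"
  unfolding smooth_map_def smooth_on_def
proof (intro ballI allI)
  fix c k assume c: "c \<in> A"
  have "snd c ` fst c = snd c ` (fst c \<inter> V) \<union> snd c ` (fst c \<inter> W)"
    using assms(3) by blast
  then show "Ck_on k (snd c ` fst c) (u \<circ> chart_inv c)"
    using Ck_on_Un[OF open_chart_image[OF c assms(1)] open_chart_image[OF c assms(2)] assms(4,5)[OF c]]
    by simp
qed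

lemma Ck_on_zero:
  assumes "c \<in> A" "open W" "\<And>p. p \<in> W \<Longrightarrow> u p = (0::real)"
  shows "Ck_on k (snd c ` (fst c \<inter> W)) (u \<circ> chart_inv c)"
proof -
  have "Ck_on k (snd c ` (fst c \<inter> W)) (u \<circ> chart_inv c) \<longleftrightarrow>
      Ck_on k (snd c ` (fst c \<inter> W)) (\<lambda>_. 0 :: real)"
    by (rule Ck_on_cong[OF open_chart_image[OF assms(1,2)]])
      (use assms(3) chart[OF assms(1)] in auto)
  then show ?thesis using open_chart_image[OF assms(1,2)] by simp
qed

lemma bump_function:
  assumes c: "c \<in> A" "p \<in> fst c"
  obtains \<eta> :: "'m \<Rightarrow> real" and K where "smooth_map A \<eta>" "\<And>q. 0 \<le> \<eta> q" "0 < \<eta> p"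
    "compact K" "K \<subseteq> fst c" "\<And>q. q \<notin> K \<Longrightarrow> \<eta> q = 0"
proof -
  let ?y = "snd c p"
  obtain r where r: "0 < r" "cball ?y r \<subseteq> coord_dom c" "compact (chart_inv c ` cball ?y r)"
    "chart_inv c ` cball ?y r \<subseteq> fst c"
    using chart_cball[OF c] by metis
  let ?K = "chart_inv c ` cball ?y r"
  \<comment> \<open>The difference is written with \<open>+ -\<close> because
    \<open>Ck_on_add\<close> covers vector values, whereas \<open>Ck_on_minus\<close> is about real
    functions.\<close>
  define \<eta> where "\<eta> q = (if q \<in> fst c then bump 0 (r\<^sup>2 - (snd c q + - ?y) \<bullet> (snd c q + - ?y)) else 0)" for q
  have zero: "\<eta> q = 0" if "q \<notin> ?K" for q
  proof (cases "q \<in> fst c")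
    case True
    have "snd c q \<notin> cball ?y r"
      using that chart(5)[OF c(1) True] by force
    then have "r < norm (snd c q - ?y)" by (simp add: dist_norm norm_minus_commute)
    then have "r\<^sup>2 < (snd c q - ?y) \<bullet> (snd c q - ?y)"
      using r(1) by (simp add: power2_norm_eq_inner[symmetric] power_strict_mono)
    then show ?thesis by (simp add: \<eta>_def bump_def)
  qed (simp add: \<eta>_def)
  have "smooth_map A \<eta>"
  proof (rule smooth_map_patch[of "fst c" "- ?K"])
    show "open (fst c)" by (rule chart[OF c(1)])
    show "open (- ?K)" using r(3) compact_imp_closed by auto
    show "fst c \<union> - ?K = UNIV" using r(4) by auto
    fix d k assume d: "d \<in> A"
    show "Ck_on k (snd d ` (fst d \<inter> - ?K)) (\<eta> \<circ> chart_inv d)"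
      by (rule Ck_on_zero[OF d]) (use zero r(3) compact_imp_closed in auto)
    have op: "open (overlap d c)" by (rule open_overlap[OF d c(1)])
    have tr: "Ck_on k (overlap d c) (transition d c)"
      using transition(1)[OF d c(1)] unfolding smooth_on_def by blast
    have "Ck_on k (overlap d c) (\<lambda>z. bump 0 (r\<^sup>2 - (transition d c z + - ?y) \<bullet> (transition d c z + - ?y)))"
      by (intro Ck_on_bump Ck_on_minus Ck_on_const Ck_on_inner Ck_on_add op tr)
    moreover have "Ck_on k (overlap d c) (\<eta> \<circ> chart_inv d) \<longleftrightarrow>
        Ck_on k (overlap d c) (\<lambda>z. bump 0 (r\<^sup>2 - (transition d c z + - ?y) \<bullet> (transition d c z + - ?y)))"
      by (rule Ck_on_cong[OF op]) (auto simp: \<eta>_def chart[OF d])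
    ultimately show "Ck_on k (snd d ` (fst d \<inter> fst c)) (\<eta> \<circ> chart_inv d)" by blast
  qed
  moreover have "0 \<le> \<eta> q" for q by (simp add: \<eta>_def bump_def)
  moreover have "0 < \<eta> p" using c(2) r(1) by (simp add: \<eta>_def bump_def)
  ultimately show ?thesis using r(3,4) zero by (intro that[of \<eta> ?K])
qed

lemma div_integrand_sum:
  assumes "finite I" and v: "\<And>i. i \<in> I \<Longrightarrow> smooth_map A (v i)" and u: "smooth_map A u"
    and eq: "\<And>p. u p = (\<Sum>i\<in>I. v i p)"
  shows "div_integrand u p = (\<Sum>i\<in>I. div_integrand (v i) p)"
proof -
  let ?c = "chart_at A p"
  note c = chart_at[of p]
  let ?y = "snd ?c p" and ?b = "tframe ?c p"
  have y: "?y \<in> coord_dom ?c" using c by auto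
  have "((\<lambda>y. \<Sum>i\<in>I. (v i \<circ> chart_inv ?c) y) has_derivative
      (\<lambda>x. \<Sum>i\<in>I. frechet_derivative (v i \<circ> chart_inv ?c) (at ?y) x)) (at ?y)"
    by (intro has_derivative_sum frechet_derivative_works[THEN iffD1] smooth_map_differentiable[OF v c(1) y])
  moreover have "(\<lambda>y. \<Sum>i\<in>I. (v i \<circ> chart_inv ?c) y) = u \<circ> chart_inv ?c"
    by (auto simp: eq)
  ultimately have "(u \<circ> chart_inv ?c has_derivative
      (\<lambda>x. \<Sum>i\<in>I. frechet_derivative (v i \<circ> chart_inv ?c) (at ?y) x)) (at ?y)" by metis
  from partial_eqI[OF this]
  have pu: "partial (u \<circ> chart_inv ?c) ?y j = (\<Sum>i\<in>I. partial (v i \<circ> chart_inv ?c) ?y j)" for j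
    by (simp add: partial_def)
  have "gradient A F u p \<bullet> F p = (\<Sum>j\<in>UNIV. \<Sum>l\<in>UNIV. \<Sum>i\<in>I.
      gram_inv ?b $ j $ l * partial (v i \<circ> chart_inv ?c) ?y j * (?b l \<bullet> F p))"
    by (simp add: gradient_eq[OF c u] raise_dot pu sum_distrib_left sum_distrib_right)
  also have "\<dots> = (\<Sum>j\<in>UNIV. \<Sum>i\<in>I. \<Sum>l\<in>UNIV.
      gram_inv ?b $ j $ l * partial (v i \<circ> chart_inv ?c) ?y j * (?b l \<bullet> F p))"
    by (intro sum.cong refl sum.swap)
  also have "\<dots> = (\<Sum>i\<in>I. gradient A F (v i) p \<bullet> F p)"
    by (subst sum.swap) (simp add: gradient_eq[OF c v] raise_dot)
  finally show ?thesis
    by (simp add: div_integrand_def eq sum.distrib sum_distrib_right)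
qed

text \<open>A finite partition of unity on the support of u, made of bump functions in charts,
  reduces the integral to functions supported in a single chart. The divergence is additive in
  u.\<close>

theorem divergence_theorem:
  assumes u: "u \<in> test_functions A"
  shows "integrable vol (div_integrand u)" "(LINT p|vol. div_integrand u p) = 0"
proof -
  define K where "K = closure {p. u p \<noteq> 0}"
  have su: "smooth_map A u" and K: "compact K" using u by (auto simp: test_functions_def K_def)
  have clK: "closed K" by (simp add: K_def)
  have u0: "u p = 0" if "p \<notin> K" for p
    using that closure_subset[of "{p. u p \<noteq> 0}"] by (auto simp: K_def)
  show "integrable vol (div_integrand u)"
    by (rule integrable_compact_support[OF continuous_div_integrand[OF su] K])
      (rule div_integrand_zero[OF su clK u0])
  have "\<forall>p. \<exists>\<eta> L. smooth_map A \<eta> \<and> (\<forall>q. 0 \<le> \<eta> q) \<and> 0 < (\<eta> p :: real) \<and>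
      compact L \<and> L \<subseteq> fst (chart_at A p) \<and> (\<forall>q. q \<notin> L \<longrightarrow> \<eta> q = 0)"
  proof
    fix p
    obtain \<eta> :: "'m \<Rightarrow> real" and L where "smooth_map A \<eta>" "\<And>q. 0 \<le> \<eta> q" "0 < \<eta> p"
      "compact L" "L \<subseteq> fst (chart_at A p)" "\<And>q. q \<notin> L \<Longrightarrow> \<eta> q = 0"
      by (rule bump_function[OF chart_at[of p]]) blast
    then show "\<exists>\<eta> L. smooth_map A \<eta> \<and> (\<forall>q. 0 \<le> \<eta> q) \<and> 0 < (\<eta> p :: real) \<and>
      compact L \<and> L \<subseteq> fst (chart_at A p) \<and> (\<forall>q. q \<notin> L \<longrightarrow> \<eta> q = 0)" by blast
  qed
  then obtain \<eta> :: "'m \<Rightarrow> 'm \<Rightarrow> real" and L where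
    \<eta>: "\<And>p. smooth_map A (\<eta> p)" "\<And>p q. 0 \<le> \<eta> p q" "\<And>p. 0 < \<eta> p p" and
    L: "\<And>p. compact (L p)" "\<And>p. L p \<subseteq> fst (chart_at A p)" "\<And>p q. q \<notin> L p \<Longrightarrow> \<eta> p q = 0"
    by metis
  have "open {q. 0 < \<eta> p q}" for p
    using smooth_map_continuous[OF \<eta>(1)] by (intro open_Collect_less continuous_on_const)
  moreover have "K \<subseteq> (\<Union>p\<in>K. {q. 0 < \<eta> p q})" using \<eta>(3) by auto
  ultimately obtain I where I: "I \<subseteq> K" "finite I" "K \<subseteq> (\<Union>p\<in>I. {q. 0 < \<eta> p q})"
    using compactE_image[OF K, of K "\<lambda>p. {q. 0 < \<eta> p q}"] by metis
  define S where "S q = (\<Sum>p\<in>I. \<eta> p q)" for q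
  have Spos: "0 < S q" if q: "q \<in> K" for q
  proof -
    obtain p where p: "p \<in> I" "0 < \<eta> p q" using I(3) q by auto
    then have "\<eta> p q \<le> S q"
      unfolding S_def using I(2) \<eta>(2) by (intro member_le_sum) auto
    with p show ?thesis by linarith
  qed
  have contS: "continuous_on UNIV S"
    unfolding S_def by (intro continuous_on_sum smooth_map_continuous \<eta>)
  \<comment> \<open>\<open>S\<close> is positive only near K; where it vanishes u is zero, and so is
    the quotient. Smoothness is checked separately on the set \<open>0 < S\<close> and on the
    complement of K.\<close>
  define v where "v p q = u q * \<eta> p q / S q" for p q
  have sv: "smooth_map A (v p)" for p
  proof (rule smooth_map_patch[of "{q. 0 < S q}" "- K"])
    show oS: "open {q. 0 < S q}" by (intro open_Collect_less continuous_on_const contS)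
    show oK: "open (- K)" using clK by auto
    show "{q. 0 < S q} \<union> - K = UNIV" using Spos by auto
    fix c k assume c: "c \<in> A"
    show "Ck_on k (snd c ` (fst c \<inter> - K)) (v p \<circ> chart_inv c)"
      by (rule Ck_on_zero[OF c oK]) (simp add: v_def u0)
    let ?S = "snd c ` (fst c \<inter> {q. 0 < S q})"
    have op: "open ?S" by (rule open_chart_image[OF c oS])
    have sm: "Ck_on k ?S (\<lambda>y. f (chart_inv c y))" if "smooth_map A f" for f :: "'m \<Rightarrow> real"
      using Ck_on_subset[OF smooth_map_D[OF that c], of ?S k] by (auto simp: o_def)
    have "Ck_on k ?S (\<lambda>y. u (chart_inv c y) * \<eta> p (chart_inv c y) / (\<Sum>p\<in>I. \<eta> p (chart_inv c y)))"
      by (intro Ck_on_divide Ck_on_mult Ck_on_sum op sm su \<eta>)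
        (auto simp: S_def chart[OF c] dest!: less_imp_neq)
    then show "Ck_on k ?S (v p \<circ> chart_inv c)"
      by (simp add: v_def S_def o_def)
  qed
  have sum: "u q = (\<Sum>p\<in>I. v p q)" for q
  proof (cases "q \<in> K")
    case True
    then show ?thesis
      using Spos[OF True] by (simp add: v_def S_def sum_divide_distrib[symmetric] sum_distrib_left[symmetric])
  qed (simp add: v_def u0)
  have int: "integrable vol (div_integrand (v p))" for p
  proof (rule integrable_compact_support[OF continuous_div_integrand[OF sv] K])
    show "div_integrand (v p) q = 0" if "q \<notin> K" for q
      by (rule div_integrand_zero[OF sv clK _ that]) (simp add: v_def u0)
  qed
  have "(LINT p|vol. div_integrand u p) = (LINT q|vol. (\<Sum>p\<in>I. div_integrand (v p) q))"
    by (simp only: div_integrand_sum[OF I(2) sv su sum])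
  also have "\<dots> = (\<Sum>p\<in>I. LINT q|vol. div_integrand (v p) q)"
    by (intro Bochner_Integration.integral_sum int)
  also have "\<dots> = 0"
  proof (intro sum.neutral ballI)
    fix p
    show "(LINT q|vol. div_integrand (v p) q) = 0"
      by (rule divergence_chart[OF chart_at(1)[of p] sv L(1,2)]) (simp add: v_def L(3))
  qed
  finally show "(LINT p|vol. div_integrand u p) = 0" .
qed

text \<open>The differential of |x|^2 sends the i-th frame vector to twice its inner product with x,
  and raising this covector amounts to projecting x to the tangent space.\<close>

lemma gradient_radial:
  assumes h: "(h has_real_derivative h') (at ((norm (F p))\<^sup>2))"
    and u: "smooth_map A (\<lambda>p. h ((norm (F p))\<^sup>2))"
  shows "gradient A F (\<lambda>p. h ((norm (F p))\<^sup>2)) p = (2 * h') *\<^sub>R tangent_part A F p (F p)"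
proof -
  let ?c = "chart_at A p"
  note c = chart_at[of p]
  let ?y = "snd ?c p" and ?G = "rep ?c"
  interpret c: parametrization "coord_dom ?c" ?G by (rule parametrization_rep[OF c(1)])
  have y: "?y \<in> coord_dom ?c" "?G ?y = F p" using c chart[OF c(1)] by auto
  note dG = c.has_derivative_G[OF y(1)]
  have "((\<lambda>y. ?G y \<bullet> ?G y) has_derivative
      (\<lambda>v. ?G ?y \<bullet> frechet_derivative ?G (at ?y) v + frechet_derivative ?G (at ?y) v \<bullet> ?G ?y)) (at ?y)"
    by (rule has_derivative_inner[OF dG dG])
  moreover have "(h has_derivative (*) h') (at (?G ?y \<bullet> ?G ?y))"
    using h unfolding has_field_derivative_def y(2) power2_norm_eq_inner .
  ultimately have "((\<lambda>y. h (?G y \<bullet> ?G y)) has_derivative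
      (\<lambda>v. h' * (?G ?y \<bullet> frechet_derivative ?G (at ?y) v + frechet_derivative ?G (at ?y) v \<bullet> ?G ?y))) (at ?y)"
    by (rule has_derivative_compose)
  moreover have "(\<lambda>y. h (?G y \<bullet> ?G y)) = (\<lambda>p. h ((norm (F p))\<^sup>2)) \<circ> chart_inv ?c"
    by (auto simp: power2_norm_eq_inner)
  ultimately have "((\<lambda>p. h ((norm (F p))\<^sup>2)) \<circ> chart_inv ?c has_derivative
      (\<lambda>v. h' * (?G ?y \<bullet> frechet_derivative ?G (at ?y) v + frechet_derivative ?G (at ?y) v \<bullet> ?G ?y))) (at ?y)"
    by metis
  from partial_eqI[OF this]
  have "partial ((\<lambda>p. h ((norm (F p))\<^sup>2)) \<circ> chart_inv ?c) ?y i = 2 * h' * (F p \<bullet> tframe ?c p i)" for i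
    using y(2) by (simp add: partial_def[symmetric] tframe_def inner_commute)
  then have "partial ((\<lambda>p. h ((norm (F p))\<^sup>2)) \<circ> chart_inv ?c) ?y = (\<lambda>i. 2 * h' * (F p \<bullet> tframe ?c p i))"
    by blast
  then show ?thesis
    by (simp add: gradient_eq[OF c u] tangent_part_eq[OF c] proj_def raise_def scaleR_sum_right mult_ac)
qed

lemma tangent_part_inner: "tangent_part A F p v \<bullet> v = (norm (tangent_part A F p v))\<^sup>2"
  using raise_dot_proj[OF frame_tframe[OF chart_at[of p]], of "\<lambda>i. v \<bullet> tframe (chart_at A p) p i" v]
  by (simp add: tangent_part_eq[OF chart_at[of p]] proj_def[symmetric] dot_square_norm)

lemma norm_tangent_part_le: "norm (tangent_part A F p v) \<le> norm v"
proof (cases "tangent_part A F p v = 0")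
  case False
  have "(norm (tangent_part A F p v))\<^sup>2 \<le> norm (tangent_part A F p v) * norm v"
    using norm_cauchy_schwarz[of "tangent_part A F p v" v] by (simp add: tangent_part_inner)
  then show ?thesis using False by (simp add: power2_eq_square)
qed simp

lemma continuous_norm_tangent_part: "continuous_on UNIV (\<lambda>p. (norm (tangent_part A F p (F p)))\<^sup>2)"
proof (rule continuous_chartwise)
  fix c assume c: "c \<in> A"
  interpret c: parametrization "coord_dom c" "rep c" by (rule parametrization_rep[OF c])
  have "continuous_on (coord_dom c) (\<lambda>y. (norm (raise (partial (rep c) y) (\<lambda>i. rep c y \<bullet> partial (rep c) y i)))\<^sup>2)"
    by (intro continuous_on_power continuous_on_norm c.continuous_on_raise continuous_on_inner
        Ck_on_imp_continuous_on[OF c.Ck_G] Ck_on_imp_continuous_on[OF c.Ck_partial])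
  then show "continuous_on (coord_dom c) (\<lambda>y. (norm (tangent_part A F (chart_inv c y) (F (chart_inv c y))))\<^sup>2)"
    by (rule continuous_on_eq)
      (use chart[OF c] in \<open>simp add: tangent_part_eq[OF c] proj_def tframe_def\<close>)
qed

lemma smooth_map_bump_exp: "smooth_map A (\<lambda>p. bump 0 (1 - r * (norm (F p))\<^sup>2) * exp (- b * (norm (F p))\<^sup>2))"
  unfolding smooth_map_def smooth_on_def
proof (intro ballI allI)
  fix c k assume c: "c \<in> A"
  interpret c: parametrization "coord_dom c" "rep c" by (rule parametrization_rep[OF c])
  have "Ck_on k (coord_dom c) (\<lambda>y. bump 0 (1 - r * (rep c y \<bullet> rep c y)) * exp (- b * (rep c y \<bullet> rep c y)))"
    by (intro Ck_on_mult Ck_on_bump Ck_on_exp Ck_on_minus Ck_on_const Ck_on_inner c.Ck_G c.open_U)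
  then show "Ck_on k (coord_dom c) ((\<lambda>p. bump 0 (1 - r * (norm (F p))\<^sup>2) * exp (- b * (norm (F p))\<^sup>2)) \<circ> chart_inv c)"
    by (simp add: o_def power2_norm_eq_inner)
qed

end

section \<open>Integrability and the limit of the Rayleigh quotients\<close>

lemma abs_mult_le:
  fixes x y X Y :: real
  shows "\<bar>x\<bar> \<le> X \<Longrightarrow> \<bar>y\<bar> \<le> Y \<Longrightarrow> \<bar>x * y\<bar> \<le> X * Y"
  unfolding abs_mult by (intro mult_mono) auto

lemma bump_nonneg: "0 \<le> bump m t"
  by (simp add: bump_def)

lemma bump_0_le: "bump 0 t \<le> 1"
  by (simp add: bump_def)

text \<open>With x = 1/t, the square of x/2 \<le> exp (x/2) reads x^2 exp (-x) \<le> 4.\<close>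

lemma bump_2_le: "bump 2 t \<le> 4"
proof (cases "t > 0")
  case True
  define x where "x = 1 / t"
  have x: "x > 0" using True by (simp add: x_def)
  have "(x / 2)\<^sup>2 \<le> (exp (x / 2))\<^sup>2"
    using x exp_ge_add_one_self[of "x / 2"] by (intro power_mono) linarith+
  also have "\<dots> = exp x" by (simp add: power2_eq_square exp_add[symmetric])
  finally have "x\<^sup>2 * exp (- x) \<le> 4"
    by (simp add: exp_minus field_simps power2_eq_square)
  then show ?thesis using True by (simp add: bump_def x_def)
qed (simp add: bump_def)

lemma has_real_derivative_bump_0: "(bump 0 has_real_derivative bump 2 t) (at t)"
  using has_real_derivative_bump[of 0 t] by (simp add: numeral_2_eq_2)

lemma isCont_bump: "isCont (bump m) t"
  using has_real_derivative_bump by (rule DERIV_isCont)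

lemma measurable_bump [measurable]: "bump m \<in> borel_measurable borel"
  by (intro borel_measurable_continuous_onI continuous_at_imp_continuous_on) (auto simp: isCont_bump)

text \<open>The argument x stands for |x|^2, so the support lies in the ball of radius sqrt R. As R
  grows the first factor tends to \<open>bump 0 1\<close>, that is exp (-1) and not 1; this positive
  constant drops out of an inequality with right-hand side or left-hand side 0 and of every
  quotient.\<close>

definition cutoff :: "real \<Rightarrow> real \<Rightarrow> real \<Rightarrow> real" where
  "cutoff R b x = bump 0 (1 - x / R) * exp (- b * x)"

definition cutoff' :: "real \<Rightarrow> real \<Rightarrow> real \<Rightarrow> real" where
  "cutoff' R b x = (- bump 2 (1 - x / R) / R - b * bump 0 (1 - x / R)) * exp (- b * x)"

lemma has_real_derivative_cutoff: "(cutoff R b has_real_derivative cutoff' R b x) (at x)"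
proof -
  have arg: "((\<lambda>x. 1 - x / R) has_real_derivative - (1 / R)) (at x)" for x
    by (cases "R = 0") (auto intro!: derivative_eq_intros)
  have exp': "((\<lambda>x. exp (- b * x)) has_real_derivative exp (- b * x) * (- b)) (at x)" for x
    by (auto intro!: derivative_eq_intros)
  have "(cutoff R b has_real_derivative bump 2 (1 - x / R) * (- (1 / R)) * exp (- b * x)
      + exp (- b * x) * (- b) * bump 0 (1 - x / R)) (at x)"
    unfolding cutoff_def by (rule DERIV_mult[OF DERIV_chain2[OF has_real_derivative_bump_0 arg] exp'])
  then show ?thesis
    by (rule DERIV_cong) (simp add: cutoff'_def algebra_simps)
qed

text \<open>The flux identities give \<open>\<integral> \<eta> w P \<ge> 0\<close> for every cutoff \<open>\<eta>\<close>, where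
  \<open>P = n + s/2 - (\<alpha> + 1) q / 2\<close> is at most \<open>C - \<delta> s\<close>. Hence \<open>\<integral> \<eta> w (1 + s)\<close> is bounded by the
  integral over a fixed sublevel set of \<open>s\<close>, uniformly in the cutoff.\<close>

locale weighted_estimate =
  fixes M :: "'m measure" and s q :: "'m \<Rightarrow> real" and n a b \<alpha> \<mu> :: real
  assumes s [measurable]: "s \<in> borel_measurable M" and q [measurable]: "q \<in> borel_measurable M"
    and q_nonneg: "\<And>p. 0 \<le> q p" and q_le: "\<And>p. q p \<le> s p"
    and curvature_bound: "\<And>p. s p - q p \<le> (2 * a * sqrt (s p) + 2 * b)\<^sup>2"
    and sublevel: "\<And>r. emeasure M {p \<in> space M. s p \<le> r} < \<infinity>"
    and nontrivial: "emeasure M (space M) \<noteq> 0"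
    and n: "0 \<le> n" and a: "0 \<le> a" and b: "0 \<le> b" and \<alpha>: "0 < \<alpha>" "4 * a\<^sup>2 * (\<alpha> + 1) < \<alpha>"
    and flux: "\<And>R. 0 < R \<Longrightarrow>
      (LINT p|M. cutoff R (\<alpha> / 4) (s p) * (n + (s p - q p) / 2) + 2 * cutoff' R (\<alpha> / 4) (s p) * q p) = 0"
    and rayleigh: "\<And>R. 0 < R \<Longrightarrow> (LINT p|M. (cutoff R ((\<alpha> + 1) / 8) (s p))\<^sup>2 * exp (s p / 4)) \<noteq> 0 \<Longrightarrow>
      \<mu> \<le> (LINT p|M. 4 * (cutoff' R ((\<alpha> + 1) / 8) (s p))\<^sup>2 * q p * exp (s p / 4))
         / (LINT p|M. (cutoff R ((\<alpha> + 1) / 8) (s p))\<^sup>2 * exp (s p / 4))"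
begin

text \<open>\<open>E m\<close> is the cutoff factor at the level R = \<open>Suc m\<close>, which is
  positive for every m, and \<open>- B m\<close> is its derivative with respect to s.
  \<open>P\<close> collects what multiplies \<open>E m * w\<close> in the flux identity.\<close>

definition w :: "'m \<Rightarrow> real" where "w p = exp (- (\<alpha> / 4) * s p)"
definition E :: "nat \<Rightarrow> 'm \<Rightarrow> real" where "E m p = bump 0 (1 - s p / real (Suc m))"
definition B :: "nat \<Rightarrow> 'm \<Rightarrow> real" where "B m p = bump 2 (1 - s p / real (Suc m)) / real (Suc m)"
definition P :: "'m \<Rightarrow> real" where "P p = n + (s p - q p) / 2 - \<alpha> / 2 * q p"

lemma measurable_wEBP [measurable]:
  "w \<in> borel_measurable M" "E m \<in> borel_measurable M" "B m \<in> borel_measurable M" "P \<in> borel_measurable M"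
  unfolding w_def E_def B_def P_def by measurable

lemma s_nonneg: "0 \<le> s p"
  using q_nonneg[of p] q_le[of p] by linarith

lemma w: "0 < w p" "w p \<le> 1"
  using s_nonneg[of p] \<alpha> by (auto simp: w_def)

lemma E: "0 \<le> E m p" "E m p \<le> 1" "real (Suc m) \<le> s p \<Longrightarrow> E m p = 0"
  using bump_nonneg bump_0_le by (auto simp: E_def bump_def field_simps)

lemma B: "0 \<le> B m p" "B m p \<le> 4" "real (Suc m) \<le> s p \<Longrightarrow> B m p = 0"
proof -
  show "0 \<le> B m p" by (simp add: B_def bump_nonneg)
  have "bump 2 (1 - s p / real (Suc m)) / real (Suc m) \<le> 4 / 1"
    using bump_2_le bump_nonneg by (intro frac_le) auto
  then show "B m p \<le> 4" by (simp add: B_def)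
  show "real (Suc m) \<le> s p \<Longrightarrow> B m p = 0" by (simp add: B_def bump_def field_simps)
qed

text \<open>As long as no weighted integral is known to be finite, this is the only source of
  integrability.\<close>

lemma integrable_sublevel:
  fixes f :: "'m \<Rightarrow> real"
  assumes [measurable]: "f \<in> borel_measurable M"
    and "\<And>p. s p \<le> r \<Longrightarrow> \<bar>f p\<bar> \<le> C" "\<And>p. r < s p \<Longrightarrow> f p = 0"
  shows "integrable M f"
proof (rule Bochner_Integration.integrable_bound)
  show "integrable M (\<lambda>p. C * indicator {p \<in> space M. s p \<le> r} p)"
    using sublevel[of r] by (intro integrable_mult_right integrable_real_indicator) auto
  show "AE p in M. norm (f p) \<le> norm (C * indicator {p \<in> space M. s p \<le> r} p)"
    using assms(2,3) by (intro AE_I2) (force simp: indicator_def not_le)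
qed simp

text \<open>The coefficient of s in the upper bound for \<open>P\<close> is -(\<alpha>/2 - 2 a^2
  (\<alpha> + 1)) = -2\<delta>. One \<delta> is spent on absorbing the term of order sqrt s, which
  costs the last summand of \<open>C0\<close>; the other is kept.\<close>

definition \<delta> :: real where "\<delta> = (\<alpha> - 4 * a\<^sup>2 * (\<alpha> + 1)) / 4"
definition C0 :: real where "C0 = n + 2 * b\<^sup>2 * (\<alpha> + 1) + (4 * a * b * (\<alpha> + 1))\<^sup>2 / (4 * \<delta>)"

lemma \<delta>: "0 < \<delta>" using \<alpha> by (simp add: \<delta>_def)

lemma C0: "0 \<le> C0" using n \<delta> \<alpha> by (auto simp: C0_def)

text \<open>Written as n - \<alpha>/2 s + (\<alpha> + 1)/2 (s - q), the function \<open>P\<close>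
  contains q only through s - q, which the curvature bound controls. Completing the square removes
  the mixed term in a b sqrt s.\<close>

lemma P_le: "P p \<le> C0 - \<delta> * s p"
proof -
  define r where "r = sqrt (s p)"
  have r: "s p = r\<^sup>2" using s_nonneg by (simp add: r_def)
  define K where "K = 4 * a * b * (\<alpha> + 1)"
  have "K * r \<le> \<delta> * r\<^sup>2 + K\<^sup>2 / (4 * \<delta>)"
  proof -
    have "0 \<le> (2 * \<delta> * r - K)\<^sup>2 / (4 * \<delta>)" using \<delta> by simp
    also have "\<dots> = \<delta> * r\<^sup>2 - K * r + K\<^sup>2 / (4 * \<delta>)"
      using \<delta> by (simp add: power2_eq_square field_simps)
    finally show ?thesis by simp
  qed
  moreover have "(\<alpha> + 1) / 2 * (s p - q p) \<le> (\<alpha> + 1) / 2 * (2 * a * r + 2 * b)\<^sup>2"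
    using curvature_bound[of p] \<alpha> unfolding r_def by (intro mult_left_mono) auto
  moreover have "P p = n - \<alpha> / 2 * s p + (\<alpha> + 1) / 2 * (s p - q p)"
    by (simp add: P_def field_simps)
  moreover have "(\<alpha> + 1) / 2 * (2 * a * r + 2 * b)\<^sup>2 = 2 * a\<^sup>2 * (\<alpha> + 1) * r\<^sup>2 + K * r + 2 * b\<^sup>2 * (\<alpha> + 1)"
    by (simp add: K_def power2_eq_square field_simps)
  moreover have "2 * a\<^sup>2 * (\<alpha> + 1) * r\<^sup>2 - \<alpha> / 2 * s p = - (2 * \<delta> * s p)"
    by (simp add: \<delta>_def r field_simps)
  ultimately show ?thesis
    unfolding C0_def K_def[symmetric] r by linarith
qed

text \<open>Prepares dominated convergence with the majorant \<open>w * (1 + s)\<close>.\<close>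

lemma abs_P_le: "\<bar>P p\<bar> \<le> (n + 1 + \<alpha>) * (1 + s p)"
proof -
  define t where "t = \<alpha> / 2 * q p"
  define t' where "t' = \<alpha> / 2 * s p"
  have "0 \<le> t" "t \<le> t'"
    using q_nonneg[of p] q_le[of p] \<alpha> by (simp_all add: t_def t'_def mult_left_mono)
  note bounds = this q_nonneg[of p] q_le[of p] n s_nonneg[of p]
  have "P p \<le> n + s p" using bounds unfolding P_def t_def[symmetric] by argo
  moreover have "- t' \<le> P p" using bounds unfolding P_def t_def[symmetric] by argo
  moreover have "n + s p \<le> (n + 1 + \<alpha>) * (1 + s p)" "t' \<le> (n + 1 + \<alpha>) * (1 + s p)"
    using n \<alpha> s_nonneg[of p] unfolding t'_def by (auto simp: algebra_simps add_increasing2)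
  ultimately show ?thesis by linarith
qed

lemma integrable_EwP: "integrable M (\<lambda>p. E m p * w p * P p)"
proof (rule integrable_sublevel[of _ "real (Suc m)" "1 * 1 * ((n + 1 + \<alpha>) * (1 + real (Suc m)))"])
  fix p assume "s p \<le> real (Suc m)"
  then have "\<bar>P p\<bar> \<le> (n + 1 + \<alpha>) * (1 + real (Suc m))"
    using n \<alpha> by (intro order.trans[OF abs_P_le] mult_left_mono) auto
  then show "\<bar>E m p * w p * P p\<bar> \<le> 1 * 1 * ((n + 1 + \<alpha>) * (1 + real (Suc m)))"
    using E[of m p] w[of p] by (intro abs_mult_le) auto
qed (use E(3) in \<open>auto simp: less_imp_le\<close>)

lemma integrable_Bwq: "integrable M (\<lambda>p. B m p * w p * q p)"
proof (rule integrable_sublevel[of _ "real (Suc m)" "4 * 1 * real (Suc m)"])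
  fix p assume "s p \<le> real (Suc m)"
  then show "\<bar>B m p * w p * q p\<bar> \<le> 4 * 1 * real (Suc m)"
    using B[of m p] w[of p] q_nonneg[of p] q_le[of p] by (intro abs_mult_le) auto
qed (use B(3) in \<open>auto simp: less_imp_le\<close>)

lemma integral_EwP: "0 \<le> (LINT p|M. E m p * w p * P p)"
proof -
  have "0 = (LINT p|M. E m p * w p * P p - 2 * (B m p * w p * q p))"
    unfolding flux[of "real (Suc m)", simplified, symmetric]
    by (intro Bochner_Integration.integral_cong refl)
      (simp add: cutoff_def cutoff'_def E_def B_def w_def P_def field_simps)
  also have "\<dots> = (LINT p|M. E m p * w p * P p) - 2 * (LINT p|M. B m p * w p * q p)"
    using integrable_EwP[of m] integrable_Bwq[of m] by simp
  finally have "(LINT p|M. E m p * w p * P p) = 2 * (LINT p|M. B m p * w p * q p)" by simp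
  moreover have "0 \<le> (LINT p|M. B m p * w p * q p)"
    using B(1) w(1) q_nonneg by (intro integral_nonneg_AE AE_I2) (simp add: less_imp_le)
  ultimately show ?thesis by simp
qed

lemma integrable_Ew: "integrable M (\<lambda>p. E m p * w p * (1 + s p))"
proof (rule integrable_sublevel[of _ "real (Suc m)" "1 * 1 * (1 + real (Suc m))"])
  fix p assume "s p \<le> real (Suc m)"
  then show "\<bar>E m p * w p * (1 + s p)\<bar> \<le> 1 * 1 * (1 + real (Suc m))"
    using E[of m p] w[of p] s_nonneg[of p] by (intro abs_mult_le) auto
qed (use E(3) in \<open>auto simp: less_imp_le\<close>)

lemma integral_Ew_bounded: "\<exists>C. \<forall>m. (LINT p|M. E m p * w p * (1 + s p)) \<le> C"
proof -
  \<comment> \<open>Beyond the threshold 1 + 2 \<open>C0\<close> / \<delta> one has \<delta>/2 (1 +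
    s) \<le> \<delta> s - \<open>C0\<close>; below it the deficit is at most \<delta>/2 +
    \<open>C0\<close>. The set does not depend on m.\<close>
  define S where "S = {p \<in> space M. s p \<le> 1 + 2 * C0 / \<delta>}"
  have [measurable]: "S \<in> sets M" unfolding S_def by measurable
  have intS: "integrable M (\<lambda>p. (\<delta> / 2 + C0) * indicator S p)"
    using sublevel unfolding S_def by (intro integrable_mult_right integrable_real_indicator) auto
  have pt: "\<delta> / 2 * (1 + s p) \<le> - P p + (\<delta> / 2 + C0) * indicator S p" if "p \<in> space M" for p
  proof -
    have "\<delta> / 2 * (1 + s p) \<le> \<delta> * s p - C0 + (\<delta> / 2 + C0) * indicator S p"
    proof (cases "p \<in> S")
      case True
      then show ?thesis using \<delta> s_nonneg[of p] by (simp add: field_simps)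
    next
      case False
      then have "1 + 2 * C0 / \<delta> \<le> s p" using that by (simp add: S_def)
      then have "\<delta> * (1 + 2 * C0 / \<delta>) \<le> \<delta> * s p" using \<delta> by (intro mult_left_mono) auto
      moreover have "\<delta> * (1 + 2 * C0 / \<delta>) = \<delta> + 2 * C0" using \<delta> by (simp add: field_simps)
      moreover have "\<delta> / 2 * (1 + s p) = \<delta> / 2 + \<delta> * s p / 2" by (simp add: distrib_left)
      ultimately have "\<delta> / 2 * (1 + s p) \<le> \<delta> * s p - C0" by linarith
      then show ?thesis using False by simp
    qed
    then show ?thesis using P_le[of p] by linarith
  qed
  have "(LINT p|M. E m p * w p * (1 + s p)) \<le> 2 / \<delta> * (LINT p|M. (\<delta> / 2 + C0) * indicator S p)" for m
  proof -
    have "\<delta> / 2 * (LINT p|M. E m p * w p * (1 + s p)) = (LINT p|M. \<delta> / 2 * (E m p * w p * (1 + s p)))"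
      by simp
    also have "\<dots> \<le> (LINT p|M. - (E m p * w p * P p) + (\<delta> / 2 + C0) * indicator S p)"
    proof (rule integral_mono)
      show "integrable M (\<lambda>p. \<delta> / 2 * (E m p * w p * (1 + s p)))"
        using integrable_Ew by simp
      show "integrable M (\<lambda>p. - (E m p * w p * P p) + (\<delta> / 2 + C0) * indicator S p)"
        using integrable_EwP intS by simp
      fix p assume p: "p \<in> space M"
      have Ew: "0 \<le> E m p * w p" "E m p * w p \<le> 1"
        using E[of m p] w[of p] by (auto intro: mult_le_one less_imp_le)
      have "\<delta> / 2 * (E m p * w p * (1 + s p)) = E m p * w p * (\<delta> / 2 * (1 + s p))" by simp
      also have "\<dots> \<le> E m p * w p * (- P p + (\<delta> / 2 + C0) * indicator S p)"
        by (intro mult_left_mono pt p Ew)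
      also have "\<dots> = - (E m p * w p * P p) + (E m p * w p) * ((\<delta> / 2 + C0) * indicator S p)"
        by (simp add: algebra_simps)
      also have "\<dots> \<le> - (E m p * w p * P p) + (\<delta> / 2 + C0) * indicator S p"
        using Ew \<delta> C0 by (intro add_left_mono mult_left_le_one_le) auto
      finally show "\<delta> / 2 * (E m p * w p * (1 + s p)) \<le> - (E m p * w p * P p) + (\<delta> / 2 + C0) * indicator S p" .
    qed
    also have "\<dots> = - (LINT p|M. E m p * w p * P p) + (LINT p|M. (\<delta> / 2 + C0) * indicator S p)"
      using integrable_EwP[of m] intS by (subst Bochner_Integration.integral_add) auto
    also have "\<dots> \<le> (LINT p|M. (\<delta> / 2 + C0) * indicator S p)"
      using integral_EwP[of m] by simp
    finally show ?thesis using \<delta> by (simp add: field_simps)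
  qed
  then show ?thesis by blast
qed

lemma E_lim: "(\<lambda>m. E m p) \<longlonglongrightarrow> exp (- 1)"
  and B_lim: "(\<lambda>m. B m p) \<longlonglongrightarrow> 0"
proof -
  have inv: "(\<lambda>m. inverse (real (Suc m))) \<longlonglongrightarrow> 0" by (rule LIMSEQ_inverse_real_of_nat)
  have "(\<lambda>m. 1 - s p * inverse (real (Suc m))) \<longlonglongrightarrow> 1 - s p * 0"
    by (intro tendsto_diff tendsto_const tendsto_mult inv)
  then have arg: "(\<lambda>m. 1 - s p / real (Suc m)) \<longlonglongrightarrow> 1" by (simp add: divide_inverse)
  have "(\<lambda>m. bump k (1 - s p / real (Suc m))) \<longlonglongrightarrow> bump k 1" for k
    by (rule isCont_tendsto_compose[OF isCont_bump arg])
  from this[of 0] tendsto_mult[OF this[of 2] inv]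
  show "(\<lambda>m. E m p) \<longlonglongrightarrow> exp (- 1)" "(\<lambda>m. B m p) \<longlonglongrightarrow> 0"
    by (simp_all add: E_def B_def bump_def divide_inverse)
qed

text \<open>Fatou's lemma carries the bound, which is uniform in the cutoff, to the pointwise limit;
  the factor exp (-1) is the limit of \<open>E m\<close>.\<close>

lemma integrable_w: "integrable M (\<lambda>p. w p * (1 + s p))"
proof -
  obtain C where C: "\<And>m. (LINT p|M. E m p * w p * (1 + s p)) \<le> C"
    using integral_Ew_bounded by blast
  have nn: "0 \<le> E m p * w p * (1 + s p)" for m p
    using E(1)[of m p] w(1)[of p] s_nonneg[of p] by (simp add: less_imp_le)
  have "integrable M (\<lambda>p. exp (- 1) * (w p * (1 + s p)))"
  proof (rule integrableI_nonneg)
    show "AE p in M. 0 \<le> exp (- 1) * (w p * (1 + s p))"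
      using w(1) s_nonneg by (intro AE_I2) (simp add: less_imp_le)
    have "(\<integral>\<^sup>+ p. ennreal (exp (- 1) * (w p * (1 + s p))) \<partial>M)
        = (\<integral>\<^sup>+ p. liminf (\<lambda>m. ennreal (E m p * w p * (1 + s p))) \<partial>M)"
    proof (intro nn_integral_cong)
      fix p
      have "(\<lambda>m. E m p * (w p * (1 + s p))) \<longlonglongrightarrow> exp (- 1) * (w p * (1 + s p))"
        by (intro tendsto_mult_right E_lim)
      then have "(\<lambda>m. ennreal (E m p * w p * (1 + s p))) \<longlonglongrightarrow> ennreal (exp (- 1) * (w p * (1 + s p)))"
        by (intro tendsto_ennrealI) (simp add: mult.assoc)
      then show "ennreal (exp (- 1) * (w p * (1 + s p))) = liminf (\<lambda>m. ennreal (E m p * w p * (1 + s p)))"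
        by (intro lim_imp_Liminf[symmetric]) auto
    qed
    also have "\<dots> \<le> liminf (\<lambda>m. \<integral>\<^sup>+ p. ennreal (E m p * w p * (1 + s p)) \<partial>M)"
      by (intro nn_integral_liminf) measurable
    also have "\<dots> \<le> liminf (\<lambda>m. ennreal C)"
    proof (intro Liminf_mono always_eventually allI)
      fix m
      show "(\<integral>\<^sup>+ p. ennreal (E m p * w p * (1 + s p)) \<partial>M) \<le> ennreal C"
        using C[of m] nn by (subst nn_integral_eq_integral[OF integrable_Ew]) (auto intro: ennreal_leI)
    qed
    also have "\<dots> = ennreal C" by (simp add: Liminf_const)
    also have "\<dots> < \<infinity>" by simp
    finally show "(\<integral>\<^sup>+ p. ennreal (exp (- 1) * (w p * (1 + s p))) \<partial>M) < \<infinity>" .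
  qed measurable
  then show ?thesis by simp
qed

lemma integrable_dominated:
  assumes [measurable]: "f \<in> borel_measurable M" and "\<And>p. \<bar>f p\<bar> \<le> C * (w p * (1 + s p))"
  shows "integrable M f"
proof (rule Bochner_Integration.integrable_bound)
  show "integrable M (\<lambda>p. C * (w p * (1 + s p)))" using integrable_w by simp
  show "AE p in M. norm (f p) \<le> norm (C * (w p * (1 + s p)))"
    using assms(2) by (intro AE_I2) (auto intro: order.trans[OF _ abs_ge_self])
qed simp

lemma w_le: "w p \<le> w p * (1 + s p)" "w p * s p \<le> w p * (1 + s p)" "w p * q p \<le> w p * (1 + s p)"
  using w(1)[of p] s_nonneg[of p] q_le[of p] by (simp_all add: less_imp_le)

lemma integrable_weights:
  "integrable M w" "integrable M (\<lambda>p. w p * s p)" "integrable M (\<lambda>p. w p * q p)"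
  using w_le w(1) s_nonneg q_nonneg
  by (auto intro!: integrable_dominated[where C = 1] simp: abs_mult less_imp_le)

lemma integral_dominated_limit:
  assumes "\<And>m. f m \<in> borel_measurable M" "g \<in> borel_measurable M"
    and "\<And>m p. \<bar>f m p\<bar> \<le> C * (w p * (1 + s p))" "\<And>p. (\<lambda>m. f m p) \<longlonglongrightarrow> g p"
  shows "(\<lambda>m. LINT p|M. f m p) \<longlonglongrightarrow> (LINT p|M. g p)"
proof (rule integral_dominated_convergence[where w = "\<lambda>p. C * (w p * (1 + s p))"])
  show "integrable M (\<lambda>p. C * (w p * (1 + s p)))" using integrable_w by simp
qed (use assms in auto)

lemma flux_limit: "(\<alpha> + 1) / 2 * (LINT p|M. w p * q p) \<le> n * (LINT p|M. w p) + (LINT p|M. w p * s p) / 2"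
proof -
  have "(\<lambda>m. LINT p|M. E m p * w p * P p) \<longlonglongrightarrow> (LINT p|M. exp (- 1) * w p * P p)"
  proof (rule integral_dominated_limit[where C = "n + 1 + \<alpha>"])
    fix m p
    have "\<bar>E m p * w p * P p\<bar> \<le> 1 * w p * ((n + 1 + \<alpha>) * (1 + s p))"
      using E[of m p] w[of p] by (intro abs_mult_le abs_P_le) auto
    then show "\<bar>E m p * w p * P p\<bar> \<le> (n + 1 + \<alpha>) * (w p * (1 + s p))" by (simp add: mult_ac)
    show "(\<lambda>m. E m p * w p * P p) \<longlonglongrightarrow> exp (- 1) * w p * P p"
      by (intro tendsto_mult tendsto_const E_lim)
  qed measurable
  then have "0 \<le> (LINT p|M. exp (- 1) * w p * P p)"
    by (rule LIMSEQ_le_const) (use integral_EwP in auto)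
  also have "\<dots> = (LINT p|M. exp (- 1) * (n * w p + (w p * s p) / 2 - (\<alpha> + 1) / 2 * (w p * q p)))"
    by (intro Bochner_Integration.integral_cong refl) (simp add: P_def field_simps)
  also have "\<dots> = exp (- 1) * (n * (LINT p|M. w p) + (LINT p|M. w p * s p) / 2 - (\<alpha> + 1) / 2 * (LINT p|M. w p * q p))"
    using integrable_weights by simp
  finally show ?thesis by (simp add: zero_le_mult_iff)
qed

lemma integral_w_pos: "0 < (LINT p|M. w p)"
proof -
  have "(LINT p|M. w p) \<noteq> 0"
  proof
    assume "(LINT p|M. w p) = 0"
    then have "AE p in M. w p = 0"
      using integrable_weights(1) w(1)
      by (subst (asm) integral_nonneg_eq_0_iff_AE) (auto simp: less_imp_le)
    then have "AE p in M. False"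
      by (rule AE_mp) (use w(1) in \<open>auto intro!: AE_I2 simp: less_le\<close>)
    then show False using nontrivial by (simp add: AE_iff_null null_sets_def)
  qed
  moreover have "0 \<le> (LINT p|M. w p)"
    using w(1) by (intro integral_nonneg_AE AE_I2) (simp add: less_imp_le)
  ultimately show ?thesis by simp
qed

lemma rayleigh_limit: "\<mu> \<le> (\<alpha> + 1)\<^sup>2 / 16 * (LINT p|M. w p * q p) / (LINT p|M. w p)"
proof -
  let ?\<beta> = "(\<alpha> + 1) / 8"
  let ?N = "\<lambda>m. LINT p|M. 4 * (- B m p - ?\<beta> * E m p)\<^sup>2 * q p * w p"
  let ?D = "\<lambda>m. LINT p|M. (E m p)\<^sup>2 * w p"
  have D: "?D \<longlonglongrightarrow> (LINT p|M. (exp (- 1))\<^sup>2 * w p)"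
  proof (rule integral_dominated_limit[where C = 1])
    fix m p
    have "\<bar>(E m p)\<^sup>2 * w p\<bar> \<le> 1 * w p"
      using E[of m p] w[of p] by (intro abs_mult_le) (auto intro: power_le_one)
    then show "\<bar>(E m p)\<^sup>2 * w p\<bar> \<le> 1 * (w p * (1 + s p))" using w_le(1)[of p] by simp
    show "(\<lambda>m. (E m p)\<^sup>2 * w p) \<longlonglongrightarrow> (exp (- 1))\<^sup>2 * w p"
      by (intro tendsto_mult tendsto_power tendsto_const E_lim)
  qed measurable
  have N: "?N \<longlonglongrightarrow> (LINT p|M. 4 * (- 0 - ?\<beta> * exp (- 1))\<^sup>2 * q p * w p)"
  proof (rule integral_dominated_limit[where C = "4 * (4 + ?\<beta>)\<^sup>2"])
    fix m p
    have "?\<beta> * E m p \<le> ?\<beta> * 1" using E[of m p] \<alpha> by (intro mult_left_mono) auto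
    moreover have "0 \<le> ?\<beta> * E m p" using E[of m p] \<alpha> by simp
    ultimately have "\<bar>- B m p - ?\<beta> * E m p\<bar> \<le> 4 + ?\<beta>" using B[of m p] by linarith
    then have "(- B m p - ?\<beta> * E m p)\<^sup>2 \<le> (4 + ?\<beta>)\<^sup>2"
      using power_mono[of "\<bar>- B m p - ?\<beta> * E m p\<bar>" "4 + ?\<beta>" 2] by simp
    then have "\<bar>4 * (- B m p - ?\<beta> * E m p)\<^sup>2 * (w p * q p)\<bar> \<le> 4 * (4 + ?\<beta>)\<^sup>2 * (w p * (1 + s p))"
      using w_le(3)[of p] w(1)[of p] q_nonneg[of p] by (intro abs_mult_le) (auto simp: abs_mult)
    then show "\<bar>4 * (- B m p - ?\<beta> * E m p)\<^sup>2 * q p * w p\<bar> \<le> 4 * (4 + ?\<beta>)\<^sup>2 * (w p * (1 + s p))"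
      by (simp add: mult_ac)
    show "(\<lambda>m. 4 * (- B m p - ?\<beta> * E m p)\<^sup>2 * q p * w p) \<longlonglongrightarrow> 4 * (- 0 - ?\<beta> * exp (- 1))\<^sup>2 * q p * w p"
      by (intro tendsto_mult tendsto_power tendsto_const tendsto_diff tendsto_minus E_lim B_lim)
  qed measurable
  have D0: "(LINT p|M. (exp (- 1))\<^sup>2 * w p) = (exp (- 1))\<^sup>2 * (LINT p|M. w p)" by simp
  have N0: "(LINT p|M. 4 * (- 0 - ?\<beta> * exp (- 1))\<^sup>2 * q p * w p) = 4 * ?\<beta>\<^sup>2 * (exp (- 1))\<^sup>2 * (LINT p|M. w p * q p)"
  proof -
    have "(LINT p|M. 4 * (- 0 - ?\<beta> * exp (- 1))\<^sup>2 * q p * w p) = (LINT p|M. (4 * ?\<beta>\<^sup>2 * (exp (- 1))\<^sup>2) * (w p * q p))"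
      by (intro Bochner_Integration.integral_cong refl) (simp add: power_mult_distrib power_divide)
    then show ?thesis by simp
  qed
  have Dpos: "0 < (LINT p|M. (exp (- 1))\<^sup>2 * w p)" unfolding D0 using integral_w_pos by simp
  have "(\<lambda>m. ?N m / ?D m) \<longlonglongrightarrow> (LINT p|M. 4 * (- 0 - ?\<beta> * exp (- 1))\<^sup>2 * q p * w p) / (LINT p|M. (exp (- 1))\<^sup>2 * w p)"
    using Dpos by (intro tendsto_divide N D) auto
  \<comment> \<open>The quotient bounds \<mu> only when the denominator is nonzero. The denominators
    have a positive limit, so this holds for all large m.\<close>
  moreover have "\<forall>\<^sub>F m in sequentially. \<mu> \<le> ?N m / ?D m"
    using order_tendstoD(1)[OF D Dpos]
  proof eventually_elim
    case (elim m)
    \<comment> \<open>Origin of (\<alpha> + 1)/8: squaring doubles the exponent, and -(\<alpha> +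
      1)/4 + 1/4 = -\<alpha>/4.\<close>
    have e: "(exp (- ?\<beta> * s p))\<^sup>2 * exp (s p / 4) = w p" for p
      by (simp add: w_def power2_eq_square exp_add[symmetric]) (simp add: field_simps)
    have D: "(cutoff (real (Suc m)) ?\<beta> (s p))\<^sup>2 * exp (s p / 4) = (E m p)\<^sup>2 * w p" for p
      unfolding cutoff_def power_mult_distrib mult.assoc e E_def ..
    have N: "4 * (cutoff' (real (Suc m)) ?\<beta> (s p))\<^sup>2 * q p * exp (s p / 4)
        = 4 * (- B m p - ?\<beta> * E m p)\<^sup>2 * q p * w p" for p
      unfolding cutoff'_def power_mult_distrib e[symmetric] E_def B_def by simp
    show ?case
      using rayleigh[of "real (Suc m)"] elim unfolding D N by simp
  qed
  ultimately have "\<mu> \<le> (LINT p|M. 4 * (- 0 - ?\<beta> * exp (- 1))\<^sup>2 * q p * w p) / (LINT p|M. (exp (- 1))\<^sup>2 * w p)"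
    by (intro tendsto_lowerbound) auto
  also have "\<dots> = 4 * ?\<beta>\<^sup>2 * (LINT p|M. w p * q p) / (LINT p|M. w p)"
    unfolding N0 D0 by simp
  also have "4 * ?\<beta>\<^sup>2 = (\<alpha> + 1)\<^sup>2 / 16" by (simp add: power2_eq_square)
  finally show ?thesis .
qed

text \<open>The flux inequality times (\<alpha> + 1)/4 is added to the Rayleigh bound. This
  multiplier produces the coefficient (\<alpha> + 1)/8 of s, and the coefficients -(\<alpha> +
  1)^2/8 and (\<alpha> + 1)^2/16 of q add up to the one in the statement.\<close>

theorem eigenvalue_estimate:
  "\<mu> \<le> (\<alpha> + 1) * n / 4 + (\<alpha> + 1) * ((LINT p|M. w p * s p) / 8 - (\<alpha> + 1) / 16 * (LINT p|M. w p * q p)) / (LINT p|M. w p)"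
proof -
  define W where "W = (LINT p|M. w p)"
  define X where "X = (LINT p|M. w p * s p)"
  define Y where "Y = (LINT p|M. w p * q p)"
  have W: "0 < W" unfolding W_def by (rule integral_w_pos)
  have "(\<alpha> + 1) / 4 * ((\<alpha> + 1) / 2 * Y) \<le> (\<alpha> + 1) / 4 * (n * W + X / 2)"
    using flux_limit \<alpha> unfolding W_def X_def Y_def by (intro mult_left_mono) auto
  moreover have "(\<alpha> + 1) / 4 * ((\<alpha> + 1) / 2 * Y) = 2 * ((\<alpha> + 1)\<^sup>2 / 16 * Y)"
    by (simp add: power2_eq_square)
  moreover have "(\<alpha> + 1) / 4 * (n * W + X / 2) = (\<alpha> + 1) * n / 4 * W + (\<alpha> + 1) * X / 8"
    by (simp add: algebra_simps)
  moreover have "(\<alpha> + 1) * (X / 8 - (\<alpha> + 1) / 16 * Y) = (\<alpha> + 1) * X / 8 - (\<alpha> + 1)\<^sup>2 / 16 * Y"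
    by (simp add: power2_eq_square right_diff_distrib mult.assoc)
  ultimately have "(\<alpha> + 1)\<^sup>2 / 16 * Y \<le> (\<alpha> + 1) * n / 4 * W + (\<alpha> + 1) * (X / 8 - (\<alpha> + 1) / 16 * Y)"
    by linarith
  then have "(\<alpha> + 1)\<^sup>2 / 16 * Y / W \<le> ((\<alpha> + 1) * n / 4 * W + (\<alpha> + 1) * (X / 8 - (\<alpha> + 1) / 16 * Y)) / W"
    using W by (intro divide_right_mono) auto
  also have "\<dots> = (\<alpha> + 1) * n / 4 + (\<alpha> + 1) * (X / 8 - (\<alpha> + 1) / 16 * Y) / W"
    using W by (simp add: add_divide_distrib)
  finally show ?thesis
    using rayleigh_limit unfolding W_def X_def Y_def by linarith
qed

end

section \<open>Codimension one, the mean curvature function and admissible test functions\<close>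

lemma normal_line:
  fixes v w :: "'v::euclidean_space" and b :: "'n::finite \<Rightarrow> 'v"
  assumes dim: "DIM('v) = CARD('n) + 1" and b: "frame b"
    and v: "norm v = 1" "\<And>i. b i \<bullet> v = 0" and w: "\<And>i. b i \<bullet> w = 0"
  shows "w = (w \<bullet> v) *\<^sub>R v"
proof -
  let ?T = "range (lin_comb b)"
  have inj: "inj (lin_comb b)"
    using b linear_injective_0[OF lin_comb_linear] by (auto simp: frame_def)
  have "dim ?T = dim (UNIV :: (real ^ 'n) set)"
    using inj by (intro dim_image_eq lin_comb_linear) (auto intro: inj_on_subset)
  then have dimT: "dim ?T = CARD('n)" by simp
  have orth: "z \<in> ?T \<Longrightarrow> z \<bullet> x = 0" if "\<And>i. b i \<bullet> x = 0" for x z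
    using that by (auto simp: lin_comb_inner)
  have spanT: "span ?T = ?T"
    by (intro span_eq_iff[THEN iffD2] linear_subspace_image lin_comb_linear subspace_UNIV)
  \<comment> \<open>Adding v to the span of the frame raises its dimension to that of the whole
    space, so a vector orthogonal to v and to the frame is zero.\<close>
  have "v \<notin> span ?T"
    using orth[OF v(2), of v] v(1) unfolding spanT by (auto simp: norm_eq_1)
  then have "dim (insert v ?T) = DIM('v)"
    using dimT dim by (simp add: dim_insert)
  then have full: "span (insert v ?T) = UNIV" by (simp add: dim_eq_full)
  define z where "z = w - (w \<bullet> v) *\<^sub>R v"
  have "orthogonal z x" if "x \<in> insert v ?T" for x
  proof (cases "x = v")
    case True
    then show ?thesis using v(1) by (simp add: z_def orthogonal_def inner_diff_left norm_eq_1)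
  next
    case False
    then have xT: "x \<in> ?T" using that by blast
    have bz: "b i \<bullet> z = 0" for i using w v(2) by (simp add: z_def inner_diff_right)
    from orth[OF bz xT] show ?thesis by (simp add: orthogonal_def inner_commute)
  qed
  then have "orthogonal z z"
    using orthogonal_to_span[of z "insert v ?T" z] full by auto
  then show ?thesis by (simp add: orthogonal_self z_def)
qed

context immersed_manifold
begin

lemma smooth_map_cutoff: "smooth_map A (\<lambda>p. cutoff R b ((norm (F p))\<^sup>2))"
  using smooth_map_bump_exp[of "1 / R" b] by (simp add: cutoff_def)

text \<open>The support lies in the preimage of a closed ball, which is compact by
  properness.\<close>

lemma cutoff_test_function:
  assumes "\<And>K. compact K \<Longrightarrow> compact (F -` K)" "0 < R"
  shows "(\<lambda>p. cutoff R b ((norm (F p))\<^sup>2)) \<in> test_functions A"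
proof -
  let ?S = "{p. cutoff R b ((norm (F p))\<^sup>2) \<noteq> 0}"
  have c: "compact (F -` cball 0 (sqrt R))" by (rule assms(1)[OF compact_cball])
  have "?S \<subseteq> F -` cball 0 (sqrt R)"
  proof
    fix p assume "p \<in> ?S"
    then have "(norm (F p))\<^sup>2 < R"
      using assms(2) by (auto simp: cutoff_def bump_def field_simps split: if_splits)
    then show "p \<in> F -` cball 0 (sqrt R)" by (simp add: real_le_rsqrt)
  qed
  then have "closure ?S \<subseteq> F -` cball 0 (sqrt R)"
    by (rule closure_minimal) (rule compact_imp_closed[OF c])
  then have "compact (closure ?S)"
    using compact_Int_closed[OF c closed_closure, of ?S] by (simp add: Int_absorb1)
  then show ?thesis using smooth_map_cutoff by (simp add: test_functions_def)
qed

text \<open>The definite description in \<open>mean_curvature\<close> denotes a number because the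
  mean curvature vector lies on the normal line. Squaring removes the dependence on the sign of
  \<nu>.\<close>

lemma mean_curvature_square:
  assumes dim: "DIM('v) = CARD('n) + 1" and \<nu>: "unit_normal A F \<nu>"
  shows "(mean_curvature A F \<nu> p)\<^sup>2 = mean_curvature_vector A F p \<bullet> mean_curvature_vector A F p"
proof -
  let ?c = "chart_at A p" and ?h = "mean_curvature_vector A F p"
  note c = chart_at[of p]
  have \<nu>1: "norm (\<nu> p) = 1" using \<nu> by (simp add: unit_normal_def)
  have \<nu>0: "tframe ?c p i \<bullet> \<nu> p = 0" for i
  proof -
    have "tframe ?c p i \<in> tangent_space A F p"
      unfolding tangent_space_eq[OF c] using rangeI[of "lin_comb (tframe ?c p)" "axis i 1"] by simp
    then show ?thesis
      using \<nu> unfolding unit_normal_def orthogonal_def by (metis inner_commute)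
  qed
  have "tframe ?c p i \<bullet> ?h = 0" for i
    using coord_mcv_normal[of "rep ?c" "snd ?c p" i] frame_tframe[OF c]
    by (simp add: mean_curvature_vector_eq[OF c] tframe_def inner_commute)
  then have hv: "?h = (?h \<bullet> \<nu> p) *\<^sub>R \<nu> p"
    by (intro normal_line[OF dim frame_tframe[OF c] \<nu>1 \<nu>0])
  have "mean_curvature A F \<nu> p = - (?h \<bullet> \<nu> p)"
    unfolding mean_curvature_def
  proof (rule the_equality)
    show "?h = - (- (?h \<bullet> \<nu> p) *\<^sub>R \<nu> p)" using hv by simp
    fix x assume "?h = - (x *\<^sub>R \<nu> p)"
    then have "?h \<bullet> \<nu> p = - (x * (\<nu> p \<bullet> \<nu> p))" by simp
    then show "x = - (?h \<bullet> \<nu> p)" using \<nu>1 by (simp add: norm_eq_1)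
  qed
  moreover have "?h \<bullet> ?h = (?h \<bullet> \<nu> p)\<^sup>2"
    by (subst (1) hv) (simp add: inner_commute power2_eq_square)
  ultimately show ?thesis by simp
qed

text \<open>An infimum of reals is a lower bound only if the set is bounded below; here 0 bounds all
  quotients.\<close>

lemma lambda1_le:
  assumes "\<phi> \<in> test_functions A" "(LINT p|vol. (\<phi> p)\<^sup>2 * exp ((norm (F p))\<^sup>2 / 4)) \<noteq> 0"
  shows "lambda1 A F \<le> (LINT p|vol. (norm (gradient A F \<phi> p))\<^sup>2 * exp ((norm (F p))\<^sup>2 / 4))
    / (LINT p|vol. (\<phi> p)\<^sup>2 * exp ((norm (F p))\<^sup>2 / 4))"
  unfolding lambda1_def Let_def
proof (rule cInf_lower)
  show "bdd_below {(LINT p|vol. (norm (gradient A F \<phi> p))\<^sup>2 * exp ((norm (F p))\<^sup>2 / 4)) /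
      (LINT p|vol. (\<phi> p)\<^sup>2 * exp ((norm (F p))\<^sup>2 / 4)) |\<phi>.
      \<phi> \<in> test_functions A \<and> (LINT p|vol. (\<phi> p)\<^sup>2 * exp ((norm (F p))\<^sup>2 / 4)) \<noteq> 0}"
    by (rule bdd_belowI[of _ 0])
      (auto intro!: divide_nonneg_nonneg Bochner_Integration.integral_nonneg)
qed (use assms in blast)

end

text \<open>Integrability of both integrands belongs to the conclusion: the integral of a function
  that is not integrable is 0 by convention, and the inequality alone would then say something
  else.\<close>

theorem theorem5p1:
  fixes A :: "('m::{t2_space, second_countable_topology}, 'n::finite) chart set"
    and F :: "'m \<Rightarrow> real ^ 'k::finite"
    and \<nu> :: "'m \<Rightarrow> real ^ 'k"
    and a b \<alpha> :: real
  defines "\<sigma> \<equiv> volume_measure A F"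
    and "n \<equiv> real CARD('n)"
    and "H \<equiv> mean_curvature A F \<nu>"
    and "xT \<equiv> (\<lambda>p. tangent_part A F p (F p))"
    and "w \<equiv> (\<lambda>p. exp (- (\<alpha> / 4) * (norm (F p))\<^sup>2))"
  assumes "CARD('k) = CARD('n) + 1"
    and "smooth_atlas A"
    and "properly_immersed A F"
    and "riem_complete A F"
    and "self_expander A F"
    and "unit_normal A F \<nu>"
    and "0 \<le> a" and "a < 1/2" and "b > 0"
    and "\<And>p. \<bar>H p\<bar> \<le> a * norm (F p) + b"
    and "\<alpha> > a\<^sup>2 / (1/4 - a\<^sup>2)"
  shows "integrable \<sigma> w \<and>
         integrable \<sigma> (\<lambda>p. ((H p)\<^sup>2 / 2 - (\<alpha> - 1) / 16 * (norm (xT p))\<^sup>2) * w p) \<and>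
         lambda1 A F \<le> (\<alpha> + 1) * n / 4 +
           (\<alpha> + 1) * (LINT p|\<sigma>. ((H p)\<^sup>2 / 2 - (\<alpha> - 1) / 16 * (norm (xT p))\<^sup>2) * w p)
             / (LINT p|\<sigma>. w p)"
proof -
  have proper: "\<And>K. compact K \<Longrightarrow> compact (F -` K)" and "immersion A F"
    using assms(8) by (auto simp: properly_immersed_def)
  interpret immersed_manifold A F by unfold_locales fact+
  define s where "s = (\<lambda>p. (norm (F p))\<^sup>2)"
  define q where "q = (\<lambda>p. (norm (xT p))\<^sup>2)"
  let ?h = "\<lambda>p. mean_curvature_vector A F p"
  have h: "?h p = (1/2) *\<^sub>R (F p - xT p)" for p
    using assms(10) by (simp add: self_expander_def normal_part_def xT_def)
  have xTF: "xT p \<bullet> F p = q p" for p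
    by (simp add: xT_def q_def tangent_part_inner)
  have hF: "?h p \<bullet> F p = (s p - q p) / 2" for p
    by (simp add: h inner_diff_left xTF s_def power2_norm_eq_inner)
  have hh: "?h p \<bullet> ?h p = (s p - q p) / 4" for p
  proof -
    have "?h p \<bullet> ?h p = (F p \<bullet> F p - 2 * (xT p \<bullet> F p) + xT p \<bullet> xT p) / 4"
      by (simp add: h inner_diff_left inner_diff_right inner_commute)
    also have "\<dots> = (s p - q p) / 4"
      by (simp add: xTF) (simp add: s_def q_def power2_norm_eq_inner)
    finally show ?thesis .
  qed
  have H2: "(H p)\<^sup>2 = (s p - q p) / 4" for p
    unfolding H_def using mean_curvature_square[OF _ assms(11)] assms(6) hh by simp
  have w_s: "w = (\<lambda>p. exp (- (\<alpha> / 4) * s p))" by (simp add: w_def s_def)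
  have q0: "0 \<le> q p" "q p \<le> s p" for p
    using norm_tangent_part_le[of p "F p"] by (simp_all add: q_def s_def xT_def power_mono)
  have a2: "a\<^sup>2 < 1 / 4"
    using power_strict_mono[of a "1 / 2" 2] assms(12,13) by (simp add: power2_eq_square)
  \<comment> \<open>Clearing the positive denominator 1/4 - a^2 in the bound on \<alpha> gives the
    form in which \<delta> is visibly positive.\<close>
  have \<alpha>: "0 < \<alpha>" "4 * a\<^sup>2 * (\<alpha> + 1) < \<alpha>"
  proof -
    have "0 \<le> a\<^sup>2 / (1 / 4 - a\<^sup>2)" using a2 by simp
    then show "0 < \<alpha>" using assms(16) by linarith
    have "a\<^sup>2 < \<alpha> * (1 / 4 - a\<^sup>2)" using assms(16) a2 by (simp add: pos_divide_less_eq)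
    then show "4 * a\<^sup>2 * (\<alpha> + 1) < \<alpha>" by (simp add: algebra_simps)
  qed
  interpret weighted_estimate vol s q n a b \<alpha> "lambda1 A F"
  proof
    have "continuous_on UNIV s" unfolding s_def by (intro continuous_intros continuous_F)
    from borel_measurable_continuous_onI[OF this] show "s \<in> borel_measurable vol" by simp
    have "continuous_on UNIV q" unfolding q_def xT_def by (rule continuous_norm_tangent_part)
    from borel_measurable_continuous_onI[OF this] show "q \<in> borel_measurable vol" by simp
    show "0 \<le> q p" "q p \<le> s p" for p by (rule q0)+
    show "s p - q p \<le> (2 * a * sqrt (s p) + 2 * b)\<^sup>2" for p
    proof -
      have "s p - q p = (2 * \<bar>H p\<bar>)\<^sup>2" using H2[of p] by (simp add: power2_eq_square)
      also have "\<dots> \<le> (2 * (a * norm (F p) + b))\<^sup>2"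
        using assms(15)[of p] by (intro power_mono mult_left_mono) auto
      finally show ?thesis by (simp add: s_def algebra_simps)
    qed
    show "emeasure vol {p \<in> space vol. s p \<le> r} < \<infinity>" for r
    proof -
      have "{p \<in> space vol. s p \<le> r} \<subseteq> F -` cball 0 (sqrt r)"
        by (auto simp: s_def intro: real_le_rsqrt)
      then have "emeasure vol {p \<in> space vol. s p \<le> r} \<le> emeasure vol (F -` cball 0 (sqrt r))"
        using compact_imp_closed[OF proper[OF compact_cball]] by (intro emeasure_mono) auto
      also have "\<dots> < \<infinity>" by (rule emeasure_vol_compact[OF proper[OF compact_cball]])
      finally show ?thesis .
    qed
    show "emeasure vol (space vol) \<noteq> 0" using emeasure_vol_UNIV_pos by simp
    show "0 \<le> n" "0 \<le> a" "0 \<le> b" using assms(12,14) by (auto simp: n_def)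
    show "0 < \<alpha>" "4 * a\<^sup>2 * (\<alpha> + 1) < \<alpha>" by (rule \<alpha>)+
  next
    fix R :: real assume R: "0 < R"
    note grad = gradient_radial[OF has_real_derivative_cutoff smooth_map_cutoff]
    let ?u = "\<lambda>p. cutoff R (\<alpha> / 4) (s p)" and ?\<phi> = "\<lambda>p. cutoff R ((\<alpha> + 1) / 8) (s p)"
    have test: "?u \<in> test_functions A" "?\<phi> \<in> test_functions A"
      unfolding s_def using cutoff_test_function[OF proper R] by auto
    have "div_integrand ?u p = ?u p * (n + (s p - q p) / 2) + 2 * cutoff' R (\<alpha> / 4) (s p) * q p" for p
      unfolding div_integrand_def hF unfolding s_def grad using xTF[of p]
      by (simp add: n_def xT_def)
    then show "(LINT p|vol. ?u p * (n + (s p - q p) / 2) + 2 * cutoff' R (\<alpha> / 4) (s p) * q p) = 0"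
      using divergence_theorem(2)[OF test(1)] by simp
    assume D: "(LINT p|vol. (?\<phi> p)\<^sup>2 * exp (s p / 4)) \<noteq> 0"
    have "(norm (gradient A F ?\<phi> p))\<^sup>2 = 4 * (cutoff' R ((\<alpha> + 1) / 8) (s p))\<^sup>2 * q p" for p
      unfolding s_def grad q_def xT_def by (simp add: power_mult_distrib)
    then show "lambda1 A F \<le> (LINT p|vol. 4 * (cutoff' R ((\<alpha> + 1) / 8) (s p))\<^sup>2 * q p * exp (s p / 4))
         / (LINT p|vol. (?\<phi> p)\<^sup>2 * exp (s p / 4))"
      using lambda1_le[OF test(2)] D by (simp add: s_def)
  qed
  have ww: "weighted_estimate.w s \<alpha> = w"
    by (simp add: fun_eq_iff w_def w_s)
  \<comment> \<open>As H^2 = (s - q)/4, the coefficients -1/8 and -(\<alpha> - 1)/16 of q combine to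
    -(\<alpha> + 1)/16.\<close>
  have integrand: "((H p)\<^sup>2 / 2 - (\<alpha> - 1) / 16 * (norm (xT p))\<^sup>2) * w p =
      w p * s p / 8 - (\<alpha> + 1) / 16 * (w p * q p)" for p
    unfolding H2 by (simp add: q_def field_simps)
  note int = integrable_weights[unfolded ww]
  have "integrable vol (\<lambda>p. ((H p)\<^sup>2 / 2 - (\<alpha> - 1) / 16 * (norm (xT p))\<^sup>2) * w p)"
    unfolding integrand using int by simp
  moreover have "(LINT p|vol. ((H p)\<^sup>2 / 2 - (\<alpha> - 1) / 16 * (norm (xT p))\<^sup>2) * w p) =
      (LINT p|vol. w p * s p) / 8 - (\<alpha> + 1) / 16 * (LINT p|vol. w p * q p)"
    unfolding integrand using int by simp
  ultimately show ?thesis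
    using int(1) eigenvalue_estimate[unfolded ww] unfolding \<sigma>_def by simp
qed

end
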